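(* Let $n\ge1$, let $\mathfrak z$ be an integral domain, and let $p(u)=-u^{n+1}+A_0u^n+\ldots+A_n\in\mathfrak z[u]$ with $p(0)=A_n\ne0$. Then a non-trivial small solution $K(x)\in\mathcal K_p(x)$ of the equation $R(\frac xy)K(x)R(xy)K(y)=K(y)R(xy)K(x)R(\frac xy)$ in $\mathcal H_p(x,y)$ has the form $$K(x)=a_+K+a_0+a_-K^{-1}$$ for some $a_\pm,a_0\in\mathfrak z(x)$. Such a solution may exist only for $n=3$.
   Context: $k$ is a field of characteristic zero, $\mathfrak z$ is a commutative unital $k$-algebra, $q\in k$ is invertible with $q\ne\pm1$, and $\omega:=q-q^{-1}$. The affine Hecke algebra $\mathcal H$ is the unital associative $\mathfrak z$-algebra generated by $R,K$ with relations $R^2=\omega R+1$ and $RKRK=KRKR$; thus $R^{-1}=R-\omega$. For $p\in\mathfrak z[u]$, $\mathcal H_p$ is the quotient of $\mathcal H$ by the two-sided ideal generated by $p(K)$, and $\mathcal K_p\subset\mathcal H_p$ is the $\mathfrak z$-subalgebra generated by $K$; one has $\mathcal K_p\simeq\mathfrak z[u]/(p)$. For a $k$-module $B$ put $B(x):=B\otimes_k k(x)$ and $B(x,y):=B\otimes_k k(x,y)$. Put $R(x):=R-x^{-1}R^{-1}$. Solutions are sought in $\mathcal K_p(x)$; a solution is trivial if it lies in $\mathfrak z(x)\cdot1$. Since $A_n\ne 0$, $K$ becomes invertible after extending scalars from $\mathfrak z$ to the localization $\mathfrak z[A_n^{-1}]$, and $K^{-1}$ is understood there (if $A_n$ is invertible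 in $\mathfrak z$, then $K^{-1}\in\mathcal K_p$). For $n>1$ put $\tilde K:=K^n-A_0K^{n-1}-\ldots-A_{n-1}$; then $\{K^i\}_{i=0}^{n-1}\cup\{\tilde K\}$ is a $\mathfrak z$-basis of $\mathcal K_p$. A solution is called principal if either $n=1$, or $n>1$ and the coefficient of $K^{n-1}$ in its expansion over this basis is non-zero; otherwise it is called small. *)

theory Defs
  imports "HOL-Algebra.Algebraic_Closure_Type" "HOL-Algebra.Generated_Rings"
    "HOL-Library.Poly_Mapping"
begin

section \<open>The free algebra on two generators\<close>

datatype gen = Gen_R | Gen_K

datatype word = Word (letters: "gen list")

instantiation word :: monoid_add
begin

definition zero_word :: word where
  "0 = Word []"

definition plus_word :: "word \<Rightarrow> word \<Rightarrow> word" where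
  "u + v = Word (letters u @ letters v)"

instance
  by standard (simp_all add: zero_word_def plus_word_def)

end

text \<open>Addition of words is concatenation, so the convolution product of finitely supported
  functions on words makes them the free associative unital algebra on the two letters.\<close>

type_synonym 'z free_alg = "word \<Rightarrow>\<^sub>0 'z"

definition free_scalar :: "'z \<Rightarrow> 'z::comm_ring_1 free_alg" where
  "free_scalar c = Poly_Mapping.single 0 c"

definition free_R :: "'z::comm_ring_1 free_alg" where
  "free_R = Poly_Mapping.single (Word [Gen_R]) 1"

definition free_K :: "'z::comm_ring_1 free_alg" where
  "free_K = Poly_Mapping.single (Word [Gen_K]) 1"


section \<open>The affine Hecke algebra and its quotients\<close>

text \<open>Throughout, \<open>\<phi> :: 'k \<Rightarrow> 'z\<close> is the structure map of the \<open>k\<close>-algebra \<open>\<zz>\<close>.\<close>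

definition hecke_omega :: "('k::field \<Rightarrow> 'z::comm_ring_1) \<Rightarrow> 'k \<Rightarrow> 'z" where
  "hecke_omega \<phi> q = \<phi> (q - inverse q)"

definition hecke_ideal :: "('k::field \<Rightarrow> 'z::comm_ring_1) \<Rightarrow> 'k \<Rightarrow> 'z free_alg set" where
  "hecke_ideal \<phi> q = genideal ring_of_type_algebra
     {free_R ^ 2 - (free_scalar (hecke_omega \<phi> q) * free_R + 1),
      free_R * free_K * free_R * free_K - free_K * free_R * free_K * free_R}"

definition hecke :: "('k::field \<Rightarrow> 'z::comm_ring_1) \<Rightarrow> 'k \<Rightarrow> 'z free_alg set ring" where
  "hecke \<phi> q = ring_of_type_algebra Quot hecke_ideal \<phi> q"

definition hecke_class ::
  "('k::field \<Rightarrow> 'z::comm_ring_1) \<Rightarrow> 'k \<Rightarrow> 'z free_alg \<Rightarrow> 'z free_alg set" where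
  "hecke_class \<phi> q f = hecke_ideal \<phi> q +>\<^bsub>ring_of_type_algebra\<^esub> f"

definition alg_eval ::
  "('a, 'm) ring_scheme \<Rightarrow> ('z::comm_ring_1 \<Rightarrow> 'a) \<Rightarrow> 'z poly \<Rightarrow> 'a \<Rightarrow> 'a" where
  "alg_eval B \<eta> p b =
     (\<Oplus>\<^bsub>B\<^esub>i\<in>{..Polynomial.degree p}. \<eta> (poly.coeff p i) \<otimes>\<^bsub>B\<^esub> b [^]\<^bsub>B\<^esub> i)"

definition hecke_p_ideal ::
  "('k::field \<Rightarrow> 'z::comm_ring_1) \<Rightarrow> 'k \<Rightarrow> 'z poly \<Rightarrow> 'z free_alg set set" where
  "hecke_p_ideal \<phi> q p = genideal (hecke \<phi> q)
     {alg_eval (hecke \<phi> q) (\<lambda>c. hecke_class \<phi> q (free_scalar c)) p (hecke_class \<phi> q free_K)}"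

definition hecke_p ::
  "('k::field \<Rightarrow> 'z::comm_ring_1) \<Rightarrow> 'k \<Rightarrow> 'z poly \<Rightarrow> 'z free_alg set set ring" where
  "hecke_p \<phi> q p = hecke \<phi> q Quot hecke_p_ideal \<phi> q p"

definition hecke_p_class ::
  "('k::field \<Rightarrow> 'z::comm_ring_1) \<Rightarrow> 'k \<Rightarrow> 'z poly \<Rightarrow> 'z free_alg \<Rightarrow> 'z free_alg set set" where
  "hecke_p_class \<phi> q p f = hecke_p_ideal \<phi> q p +>\<^bsub>hecke \<phi> q\<^esub> hecke_class \<phi> q f"

definition Hp_scalar ::
  "('k::field \<Rightarrow> 'z::comm_ring_1) \<Rightarrow> 'k \<Rightarrow> 'z poly \<Rightarrow> 'z \<Rightarrow> 'z free_alg set set" where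
  "Hp_scalar \<phi> q p c = hecke_p_class \<phi> q p (free_scalar c)"

definition Hp_R ::
  "('k::field \<Rightarrow> 'z::comm_ring_1) \<Rightarrow> 'k \<Rightarrow> 'z poly \<Rightarrow> 'z free_alg set set" where
  "Hp_R \<phi> q p = hecke_p_class \<phi> q p free_R"

definition Hp_K ::
  "('k::field \<Rightarrow> 'z::comm_ring_1) \<Rightarrow> 'k \<Rightarrow> 'z poly \<Rightarrow> 'z free_alg set set" where
  "Hp_K \<phi> q p = hecke_p_class \<phi> q p free_K"

definition K_alg ::
  "('k::field \<Rightarrow> 'z::comm_ring_1) \<Rightarrow> 'k \<Rightarrow> 'z poly \<Rightarrow> 'z free_alg set set ring" where
  "K_alg \<phi> q p = (hecke_p \<phi> q p)
     \<lparr>carrier := generate_ring (hecke_p \<phi> q p) (range (Hp_scalar \<phi> q p) \<union> {Hp_K \<phi> q p})\<rparr>"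


section \<open>Tensor products of algebras\<close>

text \<open>The tensor product of two algebras \<open>A\<close>, \<open>B\<close> over a commutative ring \<open>'s\<close>, with structure
  maps \<open>\<alpha> :: 's \<Rightarrow> A\<close> and \<open>\<beta> :: 's \<Rightarrow> B\<close> (central images): the free abelian group on pairs, with
  the product \<open>(a, b) (a', b') = (a a', b b')\<close>, modulo the relations of bilinearity. The additive
  subgroup generated by these relations is already a two-sided ideal, so passing to the
  generated ideal yields the usual tensor product.\<close>

definition pair_ring ::
  "('a, 'm) ring_scheme \<Rightarrow> ('b, 'n) ring_scheme \<Rightarrow> ('a \<times> 'b \<Rightarrow>\<^sub>0 int) ring" where
  "pair_ring A B =
     \<lparr>carrier = {u. Poly_Mapping.keys u \<subseteq> carrier A \<times> carrier B},
      monoid.mult = (\<lambda>u v. frag_extend (\<lambda>(a, b).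
         frag_extend (\<lambda>(a', b'). frag_of (a \<otimes>\<^bsub>A\<^esub> a', b \<otimes>\<^bsub>B\<^esub> b')) v) u),
      one = frag_of (\<one>\<^bsub>A\<^esub>, \<one>\<^bsub>B\<^esub>),
      ring.zero = 0,
      add = (\<lambda>u v. u + v)\<rparr>"

definition tensor_ideal ::
  "('s \<Rightarrow> 'a) \<Rightarrow> ('a, 'm) ring_scheme \<Rightarrow> ('s \<Rightarrow> 'b) \<Rightarrow> ('b, 'n) ring_scheme
     \<Rightarrow> ('a \<times> 'b \<Rightarrow>\<^sub>0 int) set" where
  "tensor_ideal \<alpha> A \<beta> B = genideal (pair_ring A B)
     ({frag_of (a \<oplus>\<^bsub>A\<^esub> a', b) - frag_of (a, b) - frag_of (a', b) | a a' b.
         a \<in> carrier A \<and> a' \<in> carrier A \<and> b \<in> carrier B} \<union>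
      {frag_of (a, b \<oplus>\<^bsub>B\<^esub> b') - frag_of (a, b) - frag_of (a, b') | a b b'.
         a \<in> carrier A \<and> b \<in> carrier B \<and> b' \<in> carrier B} \<union>
      {frag_of (\<alpha> c \<otimes>\<^bsub>A\<^esub> a, b) - frag_of (a, \<beta> c \<otimes>\<^bsub>B\<^esub> b) | c a b.
         a \<in> carrier A \<and> b \<in> carrier B})"

definition tensor_ring ::
  "('s \<Rightarrow> 'a) \<Rightarrow> ('a, 'm) ring_scheme \<Rightarrow> ('s \<Rightarrow> 'b) \<Rightarrow> ('b, 'n) ring_scheme
     \<Rightarrow> ('a \<times> 'b \<Rightarrow>\<^sub>0 int) set ring" where
  "tensor_ring \<alpha> A \<beta> B = pair_ring A B Quot tensor_ideal \<alpha> A \<beta> B"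

definition tensor_elt ::
  "('s \<Rightarrow> 'a) \<Rightarrow> ('a, 'm) ring_scheme \<Rightarrow> ('s \<Rightarrow> 'b) \<Rightarrow> ('b, 'n) ring_scheme
     \<Rightarrow> 'a \<Rightarrow> 'b \<Rightarrow> ('a \<times> 'b \<Rightarrow>\<^sub>0 int) set" where
  "tensor_elt \<alpha> A \<beta> B a b = tensor_ideal \<alpha> A \<beta> B +>\<^bsub>pair_ring A B\<^esub> frag_of (a, b)"

text \<open>The additive map out of the tensor product that sends the pure tensor of \<open>a\<close> and \<open>b\<close>
  to \<open>F a b\<close>, for a balanced biadditive \<open>F\<close> with values in \<open>T\<close>: the value at a coset is the
  common value at all of its representatives.\<close>

definition tensor_lift ::
  "('t, 'm) ring_scheme \<Rightarrow> ('a \<Rightarrow> 'b \<Rightarrow> 't) \<Rightarrow> ('a \<times> 'b \<Rightarrow>\<^sub>0 int) set \<Rightarrow> 't" where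
  "tensor_lift T F C = the_elem
     ((\<lambda>u. finsum T (\<lambda>s. add_pow T (poly_mapping.lookup u s) (F (fst s) (snd s)))
        (Poly_Mapping.keys u)) ` C)"


section \<open>Extension of scalars to rational functions\<close>

text \<open>\<open>k(x)\<close> is \<open>'k poly fract\<close>; \<open>k(x, y)\<close> is \<open>'k poly poly fract\<close>, the fraction field of
  \<open>k[x][y]\<close>.\<close>

definition kx_const :: "'k::field \<Rightarrow> 'k poly fract" where
  "kx_const c = to_fract [:c:]"

definition kxy_const :: "'k::field \<Rightarrow> 'k poly poly fract" where
  "kxy_const c = to_fract [:[:c:]:]"

definition kxy_x :: "'k::field poly poly fract" where
  "kxy_x = to_fract [:[:0, 1:]:]"

definition kxy_y :: "'k::field poly poly fract" where
  "kxy_y = to_fract [:0, 1:]"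

text \<open>\<open>f \<mapsto> f(t)\<close> for \<open>t \<in> k(x, y)\<close> transcendental over \<open>k\<close>; it is used for \<open>t = x\<close> and \<open>t = y\<close>.\<close>

definition rat_at :: "'k::field poly poly fract \<Rightarrow> 'k poly fract \<Rightarrow> 'k poly poly fract" where
  "rat_at t f = (THE w. \<exists>a b. b \<noteq> 0 \<and> f = Fract a b \<and>
     w = poly (map_poly kxy_const a) t / poly (map_poly kxy_const b) t)"

text \<open>\<open>B(x)\<close> and \<open>B(x, y)\<close> for a \<open>k\<close>-algebra \<open>B\<close> with structure map \<open>\<eta>\<close>, and their pure tensors.\<close>

definition ext_x :: "('k::field \<Rightarrow> 'b) \<Rightarrow> ('b, 'm) ring_scheme
    \<Rightarrow> ('b \<times> 'k poly fract \<Rightarrow>\<^sub>0 int) set ring" where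
  "ext_x \<eta> B = tensor_ring \<eta> B kx_const ring_of_type_algebra"

definition ext_x_elt :: "('k::field \<Rightarrow> 'b) \<Rightarrow> ('b, 'm) ring_scheme
    \<Rightarrow> 'b \<Rightarrow> 'k poly fract \<Rightarrow> ('b \<times> 'k poly fract \<Rightarrow>\<^sub>0 int) set" where
  "ext_x_elt \<eta> B = tensor_elt \<eta> B kx_const ring_of_type_algebra"

definition ext_xy :: "('k::field \<Rightarrow> 'b) \<Rightarrow> ('b, 'm) ring_scheme
    \<Rightarrow> ('b \<times> 'k poly poly fract \<Rightarrow>\<^sub>0 int) set ring" where
  "ext_xy \<eta> B = tensor_ring \<eta> B kxy_const ring_of_type_algebra"

definition ext_xy_elt :: "('k::field \<Rightarrow> 'b) \<Rightarrow> ('b, 'm) ring_scheme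
    \<Rightarrow> 'b \<Rightarrow> 'k poly poly fract \<Rightarrow> ('b \<times> 'k poly poly fract \<Rightarrow>\<^sub>0 int) set" where
  "ext_xy_elt \<eta> B = tensor_elt \<eta> B kxy_const ring_of_type_algebra"

text \<open>The map \<open>B(x) \<rightarrow> C(x)\<close> induced by a homomorphism \<open>g :: B \<rightarrow> C\<close> of \<open>k\<close>-algebras, where \<open>\<eta>\<close> is
  the structure map of \<open>C\<close>.\<close>

definition ext_x_map :: "('k::field \<Rightarrow> 'c) \<Rightarrow> ('c, 'm) ring_scheme \<Rightarrow> ('b \<Rightarrow> 'c)
    \<Rightarrow> ('b \<times> 'k poly fract \<Rightarrow>\<^sub>0 int) set \<Rightarrow> ('c \<times> 'k poly fract \<Rightarrow>\<^sub>0 int) set" where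
  "ext_x_map \<eta> C g = tensor_lift (ext_x \<eta> C) (\<lambda>b f. ext_x_elt \<eta> C (g b) f)"


section \<open>The reflection equation\<close>

definition z_x :: "('k::field \<Rightarrow> 'z::comm_ring_1) \<Rightarrow> ('z \<times> 'k poly fract \<Rightarrow>\<^sub>0 int) set ring" where
  "z_x \<phi> = ext_x \<phi> ring_of_type_algebra"

text \<open>The structure map \<open>k \<rightarrow> \<K>\<^sub>p \<subseteq> \<H>\<^sub>p\<close>.\<close>

definition Hp_const ::
  "('k::field \<Rightarrow> 'z::comm_ring_1) \<Rightarrow> 'k \<Rightarrow> 'z poly \<Rightarrow> 'k \<Rightarrow> 'z free_alg set set" where
  "Hp_const \<phi> q p c = Hp_scalar \<phi> q p (\<phi> c)"

definition K_alg_x :: "('k::field \<Rightarrow> 'z::comm_ring_1) \<Rightarrow> 'k \<Rightarrow> 'z poly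
    \<Rightarrow> ('z free_alg set set \<times> 'k poly fract \<Rightarrow>\<^sub>0 int) set ring" where
  "K_alg_x \<phi> q p = ext_x (Hp_const \<phi> q p) (K_alg \<phi> q p)"

definition K_alg_x_elt :: "('k::field \<Rightarrow> 'z::comm_ring_1) \<Rightarrow> 'k \<Rightarrow> 'z poly
    \<Rightarrow> 'z free_alg set set \<Rightarrow> ('z free_alg set set \<times> 'k poly fract \<Rightarrow>\<^sub>0 int) set" where
  "K_alg_x_elt \<phi> q p b = ext_x_elt (Hp_const \<phi> q p) (K_alg \<phi> q p) b 1"

definition K_alg_x_scalar :: "('k::field \<Rightarrow> 'z::comm_ring_1) \<Rightarrow> 'k \<Rightarrow> 'z poly
    \<Rightarrow> ('z \<times> 'k poly fract \<Rightarrow>\<^sub>0 int) set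
    \<Rightarrow> ('z free_alg set set \<times> 'k poly fract \<Rightarrow>\<^sub>0 int) set" where
  "K_alg_x_scalar \<phi> q p = ext_x_map (Hp_const \<phi> q p) (K_alg \<phi> q p) (Hp_scalar \<phi> q p)"

definition hecke_p_xy :: "('k::field \<Rightarrow> 'z::comm_ring_1) \<Rightarrow> 'k \<Rightarrow> 'z poly
    \<Rightarrow> ('z free_alg set set \<times> 'k poly poly fract \<Rightarrow>\<^sub>0 int) set ring" where
  "hecke_p_xy \<phi> q p = ext_xy (Hp_const \<phi> q p) (hecke_p \<phi> q p)"

definition hecke_p_xy_elt :: "('k::field \<Rightarrow> 'z::comm_ring_1) \<Rightarrow> 'k \<Rightarrow> 'z poly
    \<Rightarrow> 'z free_alg set set \<Rightarrow> 'k poly poly fract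
    \<Rightarrow> ('z free_alg set set \<times> 'k poly poly fract \<Rightarrow>\<^sub>0 int) set" where
  "hecke_p_xy_elt \<phi> q p = ext_xy_elt (Hp_const \<phi> q p) (hecke_p \<phi> q p)"

text \<open>\<open>R(t) = R - t\<^sup>-\<^sup>1 R\<^sup>-\<^sup>1\<close> for \<open>t \<in> k(x, y)\<close>.\<close>

definition R_at :: "('k::field \<Rightarrow> 'z::comm_ring_1) \<Rightarrow> 'k \<Rightarrow> 'z poly \<Rightarrow> 'k poly poly fract
    \<Rightarrow> ('z free_alg set set \<times> 'k poly poly fract \<Rightarrow>\<^sub>0 int) set" where
  "R_at \<phi> q p t = hecke_p_xy_elt \<phi> q p (Hp_R \<phi> q p) 1
     \<ominus>\<^bsub>hecke_p_xy \<phi> q p\<^esub> hecke_p_xy_elt \<phi> q p (inv\<^bsub>hecke_p \<phi> q p\<^esub> Hp_R \<phi> q p) (inverse t)"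

text \<open>\<open>K(t) \<in> \<H>\<^sub>p(x, y)\<close> for \<open>K(x) \<in> \<K>\<^sub>p(x)\<close> and \<open>t = x\<close> or \<open>t = y\<close>.\<close>

definition K_at :: "('k::field \<Rightarrow> 'z::comm_ring_1) \<Rightarrow> 'k \<Rightarrow> 'z poly \<Rightarrow> 'k poly poly fract
    \<Rightarrow> ('z free_alg set set \<times> 'k poly fract \<Rightarrow>\<^sub>0 int) set
    \<Rightarrow> ('z free_alg set set \<times> 'k poly poly fract \<Rightarrow>\<^sub>0 int) set" where
  "K_at \<phi> q p t =
     tensor_lift (hecke_p_xy \<phi> q p) (\<lambda>b f. hecke_p_xy_elt \<phi> q p b (rat_at t f))"

definition reflection_solution :: "('k::field \<Rightarrow> 'z::comm_ring_1) \<Rightarrow> 'k \<Rightarrow> 'z poly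
    \<Rightarrow> ('z free_alg set set \<times> 'k poly fract \<Rightarrow>\<^sub>0 int) set \<Rightarrow> bool" where
  "reflection_solution \<phi> q p Kx \<longleftrightarrow> Kx \<in> carrier (K_alg_x \<phi> q p) \<and>
     R_at \<phi> q p (kxy_x / kxy_y) \<otimes>\<^bsub>hecke_p_xy \<phi> q p\<^esub> K_at \<phi> q p kxy_x Kx
       \<otimes>\<^bsub>hecke_p_xy \<phi> q p\<^esub> R_at \<phi> q p (kxy_x * kxy_y) \<otimes>\<^bsub>hecke_p_xy \<phi> q p\<^esub> K_at \<phi> q p kxy_y Kx
     = K_at \<phi> q p kxy_y Kx \<otimes>\<^bsub>hecke_p_xy \<phi> q p\<^esub> R_at \<phi> q p (kxy_x * kxy_y)
       \<otimes>\<^bsub>hecke_p_xy \<phi> q p\<^esub> K_at \<phi> q p kxy_x Kx \<otimes>\<^bsub>hecke_p_xy \<phi> q p\<^esub> R_at \<phi> q p (kxy_x / kxy_y)"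

definition trivial_solution :: "('k::field \<Rightarrow> 'z::comm_ring_1) \<Rightarrow> 'k \<Rightarrow> 'z poly
    \<Rightarrow> ('z free_alg set set \<times> 'k poly fract \<Rightarrow>\<^sub>0 int) set \<Rightarrow> bool" where
  "trivial_solution \<phi> q p Kx \<longleftrightarrow> reflection_solution \<phi> q p Kx \<and>
     Kx \<in> K_alg_x_scalar \<phi> q p ` carrier (z_x \<phi>)"

definition K_tilde :: "('k::field \<Rightarrow> 'z::comm_ring_1) \<Rightarrow> 'k \<Rightarrow> 'z poly \<Rightarrow> nat \<Rightarrow> (nat \<Rightarrow> 'z)
    \<Rightarrow> 'z free_alg set set" where
  "K_tilde \<phi> q p n A = Hp_K \<phi> q p [^]\<^bsub>hecke_p \<phi> q p\<^esub> n \<ominus>\<^bsub>hecke_p \<phi> q p\<^esub>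
     (\<Oplus>\<^bsub>hecke_p \<phi> q p\<^esub>i\<in>{..<n}. Hp_scalar \<phi> q p (A i) \<otimes>\<^bsub>hecke_p \<phi> q p\<^esub>
        Hp_K \<phi> q p [^]\<^bsub>hecke_p \<phi> q p\<^esub> (n - 1 - i))"

text \<open>\<open>c\<close> lists the coordinates of \<open>Kx\<close> over the basis \<open>1, K, \<dots>, K\<^sup>n\<^sup>-\<^sup>1\<close>, followed by
  the coordinate of the last basis element \<open>K_tilde\<close>.\<close>

definition tilde_expansion :: "('k::field \<Rightarrow> 'z::comm_ring_1) \<Rightarrow> 'k \<Rightarrow> 'z poly \<Rightarrow> nat \<Rightarrow> (nat \<Rightarrow> 'z)
    \<Rightarrow> ('z free_alg set set \<times> 'k poly fract \<Rightarrow>\<^sub>0 int) set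
    \<Rightarrow> (nat \<Rightarrow> ('z \<times> 'k poly fract \<Rightarrow>\<^sub>0 int) set) \<Rightarrow> bool" where
  "tilde_expansion \<phi> q p n A Kx c \<longleftrightarrow> (\<forall>i\<le>n. c i \<in> carrier (z_x \<phi>)) \<and>
     Kx = (\<Oplus>\<^bsub>K_alg_x \<phi> q p\<^esub>i\<in>{..<n}. K_alg_x_scalar \<phi> q p (c i) \<otimes>\<^bsub>K_alg_x \<phi> q p\<^esub>
            K_alg_x_elt \<phi> q p (Hp_K \<phi> q p [^]\<^bsub>hecke_p \<phi> q p\<^esub> i))
       \<oplus>\<^bsub>K_alg_x \<phi> q p\<^esub> K_alg_x_scalar \<phi> q p (c n) \<otimes>\<^bsub>K_alg_x \<phi> q p\<^esub>
            K_alg_x_elt \<phi> q p (K_tilde \<phi> q p n A)"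

definition principal_solution :: "('k::field \<Rightarrow> 'z::comm_ring_1) \<Rightarrow> 'k \<Rightarrow> 'z poly \<Rightarrow> nat
    \<Rightarrow> (nat \<Rightarrow> 'z) \<Rightarrow> ('z free_alg set set \<times> 'k poly fract \<Rightarrow>\<^sub>0 int) set \<Rightarrow> bool" where
  "principal_solution \<phi> q p n A Kx \<longleftrightarrow> reflection_solution \<phi> q p Kx \<and>
     (n = 1 \<or> (n > 1 \<and> (\<exists>c. tilde_expansion \<phi> q p n A Kx c \<and> c (n - 1) \<noteq> \<zero>\<^bsub>z_x \<phi>\<^esub>)))"

definition small_solution :: "('k::field \<Rightarrow> 'z::comm_ring_1) \<Rightarrow> 'k \<Rightarrow> 'z poly \<Rightarrow> nat
    \<Rightarrow> (nat \<Rightarrow> 'z) \<Rightarrow> ('z free_alg set set \<times> 'k poly fract \<Rightarrow>\<^sub>0 int) set \<Rightarrow> bool" where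
  "small_solution \<phi> q p n A Kx \<longleftrightarrow>
     reflection_solution \<phi> q p Kx \<and> \<not> principal_solution \<phi> q p n A Kx"


section \<open>Inverting the constant term\<close>

text \<open>\<open>\<zz>[s\<^sup>-\<^sup>1]\<close> for \<open>s \<noteq> 0\<close> in a domain, inside the fraction field.\<close>

definition localization_at :: "'z::idom \<Rightarrow> 'z fract ring" where
  "localization_at s = ring_of_type_algebra\<lparr>carrier := {Fract a (s ^ m) | a m. True}\<rparr>"

text \<open>\<open>\<K>\<^sub>p\<close> with scalars extended from \<open>\<zz>\<close> to \<open>\<zz>[p(0)\<^sup>-\<^sup>1]\<close>.\<close>

definition K_loc :: "('k::field \<Rightarrow> 'z::idom) \<Rightarrow> 'k \<Rightarrow> 'z poly
    \<Rightarrow> ('z free_alg set set \<times> 'z fract \<Rightarrow>\<^sub>0 int) set ring" where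
  "K_loc \<phi> q p =
     tensor_ring (Hp_scalar \<phi> q p) (K_alg \<phi> q p) to_fract (localization_at (poly p 0))"

definition K_loc_elt :: "('k::field \<Rightarrow> 'z::idom) \<Rightarrow> 'k \<Rightarrow> 'z poly
    \<Rightarrow> 'z free_alg set set \<Rightarrow> ('z free_alg set set \<times> 'z fract \<Rightarrow>\<^sub>0 int) set" where
  "K_loc_elt \<phi> q p b =
     tensor_elt (Hp_scalar \<phi> q p) (K_alg \<phi> q p) to_fract (localization_at (poly p 0)) b 1"

definition K_loc_const :: "('k::field \<Rightarrow> 'z::idom) \<Rightarrow> 'k \<Rightarrow> 'z poly
    \<Rightarrow> 'k \<Rightarrow> ('z free_alg set set \<times> 'z fract \<Rightarrow>\<^sub>0 int) set" where
  "K_loc_const \<phi> q p c = K_loc_elt \<phi> q p (Hp_const \<phi> q p c)"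

definition K_loc_x :: "('k::field \<Rightarrow> 'z::idom) \<Rightarrow> 'k \<Rightarrow> 'z poly
    \<Rightarrow> (('z free_alg set set \<times> 'z fract \<Rightarrow>\<^sub>0 int) set \<times> 'k poly fract \<Rightarrow>\<^sub>0 int) set ring" where
  "K_loc_x \<phi> q p = ext_x (K_loc_const \<phi> q p) (K_loc \<phi> q p)"

definition K_loc_x_elt :: "('k::field \<Rightarrow> 'z::idom) \<Rightarrow> 'k \<Rightarrow> 'z poly
    \<Rightarrow> ('z free_alg set set \<times> 'z fract \<Rightarrow>\<^sub>0 int) set
    \<Rightarrow> (('z free_alg set set \<times> 'z fract \<Rightarrow>\<^sub>0 int) set \<times> 'k poly fract \<Rightarrow>\<^sub>0 int) set" where
  "K_loc_x_elt \<phi> q p b = ext_x_elt (K_loc_const \<phi> q p) (K_loc \<phi> q p) b 1"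

definition K_loc_x_scalar :: "('k::field \<Rightarrow> 'z::idom) \<Rightarrow> 'k \<Rightarrow> 'z poly
    \<Rightarrow> ('z \<times> 'k poly fract \<Rightarrow>\<^sub>0 int) set
    \<Rightarrow> (('z free_alg set set \<times> 'z fract \<Rightarrow>\<^sub>0 int) set \<times> 'k poly fract \<Rightarrow>\<^sub>0 int) set" where
  "K_loc_x_scalar \<phi> q p = ext_x_map (K_loc_const \<phi> q p) (K_loc \<phi> q p)
     (\<lambda>c. K_loc_elt \<phi> q p (Hp_scalar \<phi> q p c))"

text \<open>The natural map \<open>\<K>\<^sub>p(x) \<rightarrow> (\<K>\<^sub>p \<otimes> \<zz>[p(0)\<^sup>-\<^sup>1])(x)\<close>.\<close>

definition K_alg_x_to_loc :: "('k::field \<Rightarrow> 'z::idom) \<Rightarrow> 'k \<Rightarrow> 'z poly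
    \<Rightarrow> ('z free_alg set set \<times> 'k poly fract \<Rightarrow>\<^sub>0 int) set
    \<Rightarrow> (('z free_alg set set \<times> 'z fract \<Rightarrow>\<^sub>0 int) set \<times> 'k poly fract \<Rightarrow>\<^sub>0 int) set" where
  "K_alg_x_to_loc \<phi> q p = ext_x_map (K_loc_const \<phi> q p) (K_loc \<phi> q p) (K_loc_elt \<phi> q p)"

end

theory Submission
  imports Defs
begin

text \<open>In \<open>\<H>\<^sub>p(x, y)\<close> the commutator of \<open>R a(K) R\<close> with \<open>b(K)\<close> is a combination of the elements
  \<open>K\<^sup>i R K\<^sup>j\<close>. Writing \<open>u\<^sup>i v\<^sup>j\<close> for \<open>K\<^sup>i R K\<^sup>j\<close> and \<open>a = f(x; u)\<close>, \<open>b = f(y; u)\<close> for the solution, the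
  reflection equation becomes the vanishing, modulo \<open>p(u)\<close> and \<open>p(v)\<close>, of a combination of
  \<open>(b(u) - b(v)) (v a(u) - u a(v)) / (u - v)\<close>, \<open>a(u) b(v) - b(u) a(v)\<close> and \<open>a(v) b(v) - a(u) b(u)\<close>.
  This is seen by letting both sides act on the generator of the module induced from the character
  \<open>R \<mapsto> q\<close>, which is \<open>F[u, v] / (p(u), p(v))\<close>.

  The element \<open>K_tilde\<close> equals \<open>A\<^sub>n K\<^sup>-\<^sup>1\<close>, so a small \<open>f\<close> is a combination of \<open>u\<^sup>-\<^sup>1, 1, \<dots>, u\<^sup>n\<^sup>-\<^sup>2\<close>. If
  \<open>f\<^sub>N\<close> with \<open>2 \<le> N \<le> n - 2\<close> is the last non-zero coefficient, the coefficient of \<open>u\<^sup>N\<^sup>+\<^sup>1 v\<^sup>N\<^sup>-\<^sup>1\<close> yields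
  \<open>f\<^sub>N(x) f\<^sub>N(y) = 0\<close>; so only \<open>u\<^sup>-\<^sup>1, 1, u\<close> survive. Reducing \<open>u\<^sup>-\<^sup>2\<close> modulo \<open>p\<close> produces \<open>u\<^sup>n\<^sup>-\<^sup>1\<close>, which unless
  \<open>n = 3\<close> cannot cancel against \<open>u\<^sup>2\<close>, and the coefficients of \<open>u\<^sup>n\<^sup>-\<^sup>1\<close> and \<open>u\<^sup>2\<close> force \<open>f\<close> to be a scalar.\<close>

lemma ring_of_type_algebra_simps [simp]:
  "carrier ring_of_type_algebra = UNIV"
  "x \<otimes>\<^bsub>ring_of_type_algebra\<^esub> y = x * y"
  "\<one>\<^bsub>ring_of_type_algebra\<^esub> = 1"
  "\<zero>\<^bsub>ring_of_type_algebra\<^esub> = 0"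
  "x \<oplus>\<^bsub>ring_of_type_algebra\<^esub> y = x + y"
  by (simp_all add: ring_of_type_algebra_def)

lemma ring_ring_of_type_algebra: "ring (ring_of_type_algebra :: 'a::ring_1 ring)"
proof (rule ringI)
  show "abelian_group (ring_of_type_algebra :: 'a ring)"
  proof (rule abelian_groupI)
    fix x :: 'a
    show "\<exists>y\<in>carrier ring_of_type_algebra. y \<oplus>\<^bsub>ring_of_type_algebra\<^esub> x = \<zero>\<^bsub>ring_of_type_algebra\<^esub>"
      by (rule bexI[of _ "- x"]) simp_all
  qed (simp_all add: ac_simps)
  show "monoid (ring_of_type_algebra :: 'a ring)"
    by (rule monoidI) (simp_all add: mult.assoc)
qed (simp_all add: distrib_left distrib_right)

lemma ring_of_type_algebra_a_inv [simp]:
  "\<ominus>\<^bsub>ring_of_type_algebra\<^esub> (x::'a::ring_1) = - x"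
proof -
  interpret ring "ring_of_type_algebra :: 'a ring" by (rule ring_ring_of_type_algebra)
  show ?thesis by (rule minus_equality) auto
qed

lemma ring_of_type_algebra_finsum [simp]:
  assumes "finite A"
  shows "finsum (ring_of_type_algebra :: 'a::ring_1 ring) f A = sum f A"
proof -
  interpret ring "ring_of_type_algebra :: 'a ring" by (rule ring_ring_of_type_algebra)
  show ?thesis using assms by (induction A) (auto simp: finsum_insert)
qed

section \<open>Homomorphisms out of quotient rings\<close>

lemma ring_hom_ringI':
  assumes "ring R" "ring S" "h \<in> ring_hom R S"
  shows "ring_hom_ring R S h"
  using assms by (simp add: ring_hom_ring_def ring_hom_ring_axioms_def)

lemma FactRing_carrierE:

  assumes "W \<in> carrier (R Quot I)"
  obtains a where "a \<in> carrier R" "W = I +>\<^bsub>R\<^esub> a"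
  using assms unfolding FactRing_simps by auto

lemma quotient_lift_aux:

  assumes "ring R" "ring S" "h \<in> ring_hom R S" "ideal I R"
    and "\<And>i. i \<in> I \<Longrightarrow> h i = \<zero>\<^bsub>S\<^esub>" and "a \<in> carrier R"
  shows "h ` (I +>\<^bsub>R\<^esub> a) = {h a}"
proof -
  interpret ring_hom_ring R S h using assms by (intro ring_hom_ringI')
  interpret I: ideal I R by fact
  have "h (i \<oplus>\<^bsub>R\<^esub> a) = h a" if "i \<in> I" for i
    using that assms by (simp add: I.Icarr)
  moreover have "\<zero>\<^bsub>R\<^esub> \<in> I" by (rule I.zero_closed)
  then have "h a \<in> h ` (I +>\<^bsub>R\<^esub> a)"
    unfolding a_r_coset_def' using assms(6) by (force intro!: image_eqI[of _ _ "\<zero>\<^bsub>R\<^esub> \<oplus>\<^bsub>R\<^esub> a"])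
  ultimately show ?thesis
    unfolding a_r_coset_def' by auto
qed

lemma quotient_lift:

  assumes "ring R" "ring S" "h \<in> ring_hom R S" "ideal I R"
    and "\<And>i. i \<in> I \<Longrightarrow> h i = \<zero>\<^bsub>S\<^esub>"
  shows "(\<lambda>W. the_elem (h ` W)) \<in> ring_hom (R Quot I) S"
    and "\<And>a. a \<in> carrier R \<Longrightarrow> the_elem (h ` (I +>\<^bsub>R\<^esub> a)) = h a"
proof -
  interpret ring_hom_ring R S h using assms by (intro ring_hom_ringI')
  interpret I: ideal I R by fact
  show *: "the_elem (h ` (I +>\<^bsub>R\<^esub> a)) = h a" if "a \<in> carrier R" for a
    using quotient_lift_aux[OF assms(1-4) assms(5) that] by simp
  show "(\<lambda>W. the_elem (h ` W)) \<in> ring_hom (R Quot I) S"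
  proof (rule ring_hom_memI)
    fix W assume "W \<in> carrier (R Quot I)"
    then obtain a where "a \<in> carrier R" "W = I +>\<^bsub>R\<^esub> a" by (rule FactRing_carrierE)
    then show "the_elem (h ` W) \<in> carrier S" using * by simp
  next
    fix W Y assume "W \<in> carrier (R Quot I)" "Y \<in> carrier (R Quot I)"
    then obtain a b where ab: "a \<in> carrier R" "W = I +>\<^bsub>R\<^esub> a" "b \<in> carrier R" "Y = I +>\<^bsub>R\<^esub> b"
      by (elim FactRing_carrierE) blast
    have "W \<otimes>\<^bsub>R Quot I\<^esub> Y = I +>\<^bsub>R\<^esub> (a \<otimes>\<^bsub>R\<^esub> b)"
      using ab by (simp add: FactRing_def I.rcoset_mult_add)
    then show "the_elem (h ` (W \<otimes>\<^bsub>R Quot I\<^esub> Y)) = the_elem (h ` W) \<otimes>\<^bsub>S\<^esub> the_elem (h ` Y)"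
      using ab by (simp add: *)
    have "W \<oplus>\<^bsub>R Quot I\<^esub> Y = I +>\<^bsub>R\<^esub> (a \<oplus>\<^bsub>R\<^esub> b)"
      using ab by (simp add: FactRing_def I.a_rcos_sum)
    then show "the_elem (h ` (W \<oplus>\<^bsub>R Quot I\<^esub> Y)) = the_elem (h ` W) \<oplus>\<^bsub>S\<^esub> the_elem (h ` Y)"
      using ab by (simp add: *)
  next
    show "the_elem (h ` \<one>\<^bsub>R Quot I\<^esub>) = \<one>\<^bsub>S\<^esub>"
      by (simp add: FactRing_def *)
  qed
qed

lemma genideal_hom_zero:
  assumes "ring R" "ring S" "h \<in> ring_hom R S" "G \<subseteq> carrier R"
    and "\<And>g. g \<in> G \<Longrightarrow> h g = \<zero>\<^bsub>S\<^esub>" and "i \<in> genideal R G"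
  shows "h i = \<zero>\<^bsub>S\<^esub>"
proof -
  interpret ring_hom_ring R S h using assms by (intro ring_hom_ringI')
  have "G \<subseteq> a_kernel R S h"
    unfolding a_kernel_def' using assms(4,5) by blast
  then have "genideal R G \<subseteq> a_kernel R S h"
    by (rule R.genideal_minimal[OF kernel_is_ideal])
  with assms(6) have "i \<in> a_kernel R S h" by blast
  then show ?thesis unfolding a_kernel_def' by blast
qed

section \<open>Tensor products\<close>

context
  fixes A :: "('a, 'm) ring_scheme" and B :: "('b, 'n) ring_scheme"
  assumes A: "ring A" and B: "ring B"
begin

interpretation A: ring A by (rule A)
interpretation B: ring B by (rule B)

lemma pair_ring_carrier: "u \<in> carrier (pair_ring A B) \<longleftrightarrow> Poly_Mapping.keys u \<subseteq> carrier A \<times> carrier B"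
  by (simp add: pair_ring_def)

lemma pair_ring_simps:
  "u \<oplus>\<^bsub>pair_ring A B\<^esub> v = u + v"
  "\<zero>\<^bsub>pair_ring A B\<^esub> = 0"
  "\<one>\<^bsub>pair_ring A B\<^esub> = frag_of (\<one>\<^bsub>A\<^esub>, \<one>\<^bsub>B\<^esub>)"
  "frag_of s \<otimes>\<^bsub>pair_ring A B\<^esub> frag_of t = frag_of (fst s \<otimes>\<^bsub>A\<^esub> fst t, snd s \<otimes>\<^bsub>B\<^esub> snd t)"
  by (auto simp: pair_ring_def case_prod_beta)

lemma pair_ring_mult_add:
  "(u + u') \<otimes>\<^bsub>pair_ring A B\<^esub> v = u \<otimes>\<^bsub>pair_ring A B\<^esub> v + u' \<otimes>\<^bsub>pair_ring A B\<^esub> v"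
  "(u - u') \<otimes>\<^bsub>pair_ring A B\<^esub> v = u \<otimes>\<^bsub>pair_ring A B\<^esub> v - u' \<otimes>\<^bsub>pair_ring A B\<^esub> v"
  "0 \<otimes>\<^bsub>pair_ring A B\<^esub> v = 0"
  by (simp_all add: pair_ring_def frag_extend_add frag_extend_diff)

lemma frag_extend_fun_add: "frag_extend (\<lambda>x. f x + g x) u = frag_extend f u + frag_extend g u"
  by (simp add: frag_extend_def frag_cmul_distrib2 sum.distrib)

lemma frag_extend_fun_minus: "frag_extend (\<lambda>x. f x - g x) u = frag_extend f u - frag_extend g u"
  using frag_extend_fun_add[of "\<lambda>x. f x - g x" g u] by simp

lemma pair_ring_add_mult:
  "v \<otimes>\<^bsub>pair_ring A B\<^esub> (u + u') = v \<otimes>\<^bsub>pair_ring A B\<^esub> u + v \<otimes>\<^bsub>pair_ring A B\<^esub> u'"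
  "v \<otimes>\<^bsub>pair_ring A B\<^esub> (u - u') = v \<otimes>\<^bsub>pair_ring A B\<^esub> u - v \<otimes>\<^bsub>pair_ring A B\<^esub> u'"
  "v \<otimes>\<^bsub>pair_ring A B\<^esub> 0 = 0"
    apply (simp only: pair_ring_def monoid.simps frag_extend_add case_prod_unfold frag_extend_fun_add)
   apply (simp only: pair_ring_def monoid.simps frag_extend_diff case_prod_unfold frag_extend_fun_minus)
  apply (simp add: pair_ring_def frag_extend_def)
  done

lemma pair_ring_induct [consumes 1, case_names zero one diff]:
  assumes "u \<in> carrier (pair_ring A B)" "P 0"
    and "\<And>a b. a \<in> carrier A \<Longrightarrow> b \<in> carrier B \<Longrightarrow> P (frag_of (a, b))"
    and "\<And>u v. u \<in> carrier (pair_ring A B) \<Longrightarrow> v \<in> carrier (pair_ring A B) \<Longrightarrow> P u \<Longrightarrow> P v \<Longrightarrow> P (u - v)"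
  shows "P u"
proof -
  have "Poly_Mapping.keys u \<subseteq> carrier A \<times> carrier B" using assms(1) by (simp add: pair_ring_def)
  then have "P u \<and> u \<in> carrier (pair_ring A B)"
  proof (induction u rule: frag_induction)
    case (diff a b)
    then have "a - b \<in> carrier (pair_ring A B)" 
      using keys_diff[of a b] by (auto simp: pair_ring_def)
    then show ?case using diff assms(4) by blast
  qed (use assms in \<open>auto simp: pair_ring_def\<close>)
  then show ?thesis ..
qed

lemma pair_ring_diff_closed:
  assumes "u \<in> carrier (pair_ring A B)" "v \<in> carrier (pair_ring A B)"
  shows "u - v \<in> carrier (pair_ring A B)"
  using assms keys_diff[of u v] by (auto simp: pair_ring_def)

lemma pair_ring_frag_closed:
  "a \<in> carrier A \<Longrightarrow> b \<in> carrier B \<Longrightarrow> frag_of (a, b) \<in> carrier (pair_ring A B)"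
  by (auto simp: pair_ring_def)

lemma pair_ring_mult_closed:
  assumes "u \<in> carrier (pair_ring A B)" "v \<in> carrier (pair_ring A B)"
  shows "u \<otimes>\<^bsub>pair_ring A B\<^esub> v \<in> carrier (pair_ring A B)"
  using assms(1)
proof (induction rule: pair_ring_induct)
  case zero then show ?case by (simp add: pair_ring_mult_add pair_ring_carrier)
next
  case (one a b)
  show ?case using assms(2)
  proof (induction rule: pair_ring_induct)
    case zero then show ?case by (simp add: pair_ring_add_mult pair_ring_carrier)
  next
    case (one a' b')
    then show ?case using \<open>a \<in> _\<close> \<open>b \<in> _\<close> by (simp add: pair_ring_simps pair_ring_frag_closed)
  next
    case (diff u v)
    then show ?case by (simp add: pair_ring_add_mult pair_ring_diff_closed)
  qed
next
  case (diff u v)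
  then show ?case by (simp add: pair_ring_mult_add pair_ring_diff_closed)
qed

lemma pair_ring_mult_assoc:
  assumes "u \<in> carrier (pair_ring A B)" "v \<in> carrier (pair_ring A B)" "w \<in> carrier (pair_ring A B)"
  shows "(u \<otimes>\<^bsub>pair_ring A B\<^esub> v) \<otimes>\<^bsub>pair_ring A B\<^esub> w = u \<otimes>\<^bsub>pair_ring A B\<^esub> (v \<otimes>\<^bsub>pair_ring A B\<^esub> w)"
  using assms(1)
proof (induction rule: pair_ring_induct)
  case u: (one a b)
  show ?case using assms(2)
  proof (induction rule: pair_ring_induct)
    case v: (one a' b')
    show ?case using assms(3)
    proof (induction rule: pair_ring_induct)
      case (one a'' b'')
      then show ?case using u v by (simp add: pair_ring_simps A.m_assoc B.m_assoc)
    qed (simp_all add: pair_ring_add_mult)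
  qed (simp_all add: pair_ring_add_mult pair_ring_mult_add)
qed (simp_all add: pair_ring_mult_add)

lemma ring_pair_ring: "ring (pair_ring A B)"
proof (rule ringI)
  show "abelian_group (pair_ring A B)"
  proof (rule abelian_groupI)
    fix u assume u: "u \<in> carrier (pair_ring A B)"
    show "\<exists>y\<in>carrier (pair_ring A B). y \<oplus>\<^bsub>pair_ring A B\<^esub> u = \<zero>\<^bsub>pair_ring A B\<^esub>"
      by (rule bexI[of _ "- u"]) (use u in \<open>auto simp: pair_ring_simps pair_ring_carrier\<close>)
  next
    fix u v assume "u \<in> carrier (pair_ring A B)" "v \<in> carrier (pair_ring A B)"
    then show "u \<oplus>\<^bsub>pair_ring A B\<^esub> v \<in> carrier (pair_ring A B)"
      using keys_add[of u v] by (auto simp: pair_ring_simps pair_ring_carrier)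
  qed (auto simp: pair_ring_simps pair_ring_carrier add.assoc add.commute)
  show "monoid (pair_ring A B)"
  proof (rule monoidI)
    fix u assume "u \<in> carrier (pair_ring A B)"
    then show "\<one>\<^bsub>pair_ring A B\<^esub> \<otimes>\<^bsub>pair_ring A B\<^esub> u = u"
      by (induction rule: pair_ring_induct) (auto simp: pair_ring_simps pair_ring_add_mult)
  next
    fix u assume "u \<in> carrier (pair_ring A B)"
    then show "u \<otimes>\<^bsub>pair_ring A B\<^esub> \<one>\<^bsub>pair_ring A B\<^esub> = u"
      by (induction rule: pair_ring_induct) (auto simp: pair_ring_simps pair_ring_mult_add)
  qed (auto simp: pair_ring_mult_closed pair_ring_mult_assoc pair_ring_simps pair_ring_frag_closed)
qed (simp_all add: pair_ring_simps pair_ring_mult_add pair_ring_add_mult)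

lemma pair_ring_minus:
  assumes "u \<in> carrier (pair_ring A B)" "v \<in> carrier (pair_ring A B)"
  shows "u \<ominus>\<^bsub>pair_ring A B\<^esub> v = u - v"
proof -
  interpret P: ring "pair_ring A B" by (rule ring_pair_ring)
  have "- v \<in> carrier (pair_ring A B)" using assms by (simp add: pair_ring_carrier)
  then have "\<ominus>\<^bsub>pair_ring A B\<^esub> v = - v"
    using assms by (intro P.minus_equality) (auto simp: pair_ring_simps)
  then show ?thesis by (simp add: a_minus_def pair_ring_simps)
qed

end

definition frag_sum :: "('t, 'm) ring_scheme \<Rightarrow> ('s \<Rightarrow> 't) \<Rightarrow> ('s \<Rightarrow>\<^sub>0 int) \<Rightarrow> 't" where
  "frag_sum T F u = finsum T (\<lambda>s. add_pow T (poly_mapping.lookup u s) (F s)) (Poly_Mapping.keys u)"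

lemma tensor_lift_eq: "tensor_lift T F C = the_elem (frag_sum T (\<lambda>s. F (fst s) (snd s)) ` C)"
  by (simp add: tensor_lift_def frag_sum_def)

context ring
begin

lemma frag_sum_superset:
  assumes "finite S" "Poly_Mapping.keys u \<subseteq> S" "F \<in> S \<rightarrow> carrier R"
  shows "frag_sum R F u = (\<Oplus>s\<in>S. add_pow R (poly_mapping.lookup u s) (F s))"
  unfolding frag_sum_def
proof (rule add.finprod_mono_neutral_cong_left)
  fix s assume "s \<in> S - Poly_Mapping.keys u"
  then have "poly_mapping.lookup u s = 0" by (simp add: in_keys_iff)
  then show "add_pow R (poly_mapping.lookup u s) (F s) = \<zero>"
    by (simp add: add_pow_def)
next
  show "(\<lambda>s. add_pow R (poly_mapping.lookup u s) (F s)) \<in> S \<rightarrow> carrier R"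
    using assms(3) add.int_pow_closed by blast
qed (use assms in simp_all)

lemma frag_sum_closed:
  assumes "F \<in> Poly_Mapping.keys u \<rightarrow> carrier R"
  shows "frag_sum R F u \<in> carrier R"
  unfolding frag_sum_def using assms add.int_pow_closed by (intro finsum_closed) blast

lemma frag_sum_add:
  assumes "F \<in> S \<rightarrow> carrier R" "Poly_Mapping.keys u \<subseteq> S" "Poly_Mapping.keys v \<subseteq> S"
  shows "frag_sum R F (u + v) = frag_sum R F u \<oplus> frag_sum R F v"
proof -
  let ?S = "Poly_Mapping.keys u \<union> Poly_Mapping.keys v"
  have F: "F \<in> ?S \<rightarrow> carrier R" using assms by auto
  have "frag_sum R F (u + v) = (\<Oplus>s\<in>?S. add_pow R (poly_mapping.lookup (u + v) s) (F s))"
    using keys_add[of u v] F by (intro frag_sum_superset) auto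
  also have "\<dots> = (\<Oplus>s\<in>?S. add_pow R (poly_mapping.lookup u s) (F s) \<oplus> add_pow R (poly_mapping.lookup v s) (F s))"
    using F by (intro finsum_cong') (auto simp: lookup_add Pi_iff intro!: a_closed
        add.int_pow_mult add.int_pow_closed)
  also have "\<dots> = frag_sum R F u \<oplus> frag_sum R F v"
    using F by (subst (1 2) frag_sum_superset[of ?S]) (auto intro!: finsum_addf)
  finally show ?thesis .
qed

lemma frag_sum_zero: "frag_sum R F 0 = \<zero>"
  by (simp add: frag_sum_def)

lemma frag_sum_frag_of:
  assumes "F s \<in> carrier R"
  shows "frag_sum R F (frag_of s) = F s"
  using assms frag_sum_superset[of "{s}" "frag_of s" F] by simp

lemma frag_sum_diff:
  assumes "F \<in> S \<rightarrow> carrier R" "Poly_Mapping.keys u \<subseteq> S" "Poly_Mapping.keys v \<subseteq> S"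
  shows "frag_sum R F (u - v) = frag_sum R F u \<ominus> frag_sum R F v"
proof -
  have "Poly_Mapping.keys (u - v) \<subseteq> S" using assms keys_diff[of u v] by blast
  then have "frag_sum R F u = frag_sum R F (u - v) \<oplus> frag_sum R F v"
    using frag_sum_add[OF assms(1) _ assms(3), of "u - v"] by simp
  moreover have "frag_sum R F (u - v) \<in> carrier R" "frag_sum R F v \<in> carrier R"
    using assms \<open>Poly_Mapping.keys (u - v) \<subseteq> S\<close> by (auto intro!: frag_sum_closed)
  ultimately show ?thesis by (simp add: a_minus_def a_assoc r_neg)
qed

end

locale tensor_alg =
  fixes \<alpha> :: "'s \<Rightarrow> 'a" and A :: "('a, 'm) ring_scheme" and \<beta> :: "'s \<Rightarrow> 'b" and B :: "('b, 'n) ring_scheme"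
  assumes ring_A: "ring A" and ring_B: "ring B"
    and \<alpha>_closed: "\<And>c. \<alpha> c \<in> carrier A" and \<beta>_closed: "\<And>c. \<beta> c \<in> carrier B"
begin

sublocale A: ring A by (rule ring_A)
sublocale B: ring B by (rule ring_B)
sublocale P: ring "pair_ring A B" by (rule ring_pair_ring[OF ring_A ring_B])

definition tensor_rels where "tensor_rels =
     ({frag_of (a \<oplus>\<^bsub>A\<^esub> a', b) - frag_of (a, b) - frag_of (a', b) | a a' b.
         a \<in> carrier A \<and> a' \<in> carrier A \<and> b \<in> carrier B} \<union>
      {frag_of (a, b \<oplus>\<^bsub>B\<^esub> b') - frag_of (a, b) - frag_of (a, b') | a b b'.
         a \<in> carrier A \<and> b \<in> carrier B \<and> b' \<in> carrier B} \<union>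
      {frag_of (\<alpha> c \<otimes>\<^bsub>A\<^esub> a, b) - frag_of (a, \<beta> c \<otimes>\<^bsub>B\<^esub> b) | c a b.
         a \<in> carrier A \<and> b \<in> carrier B})"

lemmas frag_closed = pair_ring_frag_closed[OF ring_A ring_B]
lemmas diff_closed = pair_ring_diff_closed[OF ring_A ring_B]
lemmas pair_induct = pair_ring_induct[OF ring_A ring_B, consumes 1, case_names zero one diff]
lemmas psimps = pair_ring_simps[OF ring_A ring_B]

lemma tensor_ideal_eq: "tensor_ideal \<alpha> A \<beta> B = genideal (pair_ring A B) tensor_rels"
  by (simp add: tensor_ideal_def tensor_rels_def)

lemma tensor_rels_closed: "tensor_rels \<subseteq> carrier (pair_ring A B)"
  unfolding tensor_rels_def using \<alpha>_closed \<beta>_closed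
  by (auto intro!: diff_closed frag_closed)

sublocale I: ideal "tensor_ideal \<alpha> A \<beta> B" "pair_ring A B"
  unfolding tensor_ideal_eq by (rule P.genideal_ideal[OF tensor_rels_closed])

sublocale T: ring "tensor_ring \<alpha> A \<beta> B"
  unfolding tensor_ring_def by (rule I.quotient_is_ring)

abbreviation T where "T \<equiv> tensor_ring \<alpha> A \<beta> B"
abbreviation elt where "elt \<equiv> tensor_elt \<alpha> A \<beta> B"

lemma proj_hom: "(+>\<^bsub>pair_ring A B\<^esub>) (tensor_ideal \<alpha> A \<beta> B) \<in> ring_hom (pair_ring A B) T"
  unfolding tensor_ring_def by (rule I.rcos_ring_hom)

lemma elt_closed [simp, intro]:
  "a \<in> carrier A \<Longrightarrow> b \<in> carrier B \<Longrightarrow> elt a b \<in> carrier T"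
  unfolding tensor_elt_def using ring_hom_closed[OF proj_hom] frag_closed by blast

lemma elt_mult:
  assumes "a \<in> carrier A" "b \<in> carrier B" "a' \<in> carrier A" "b' \<in> carrier B"
  shows "elt a b \<otimes>\<^bsub>T\<^esub> elt a' b' = elt (a \<otimes>\<^bsub>A\<^esub> a') (b \<otimes>\<^bsub>B\<^esub> b')"
  unfolding tensor_elt_def using assms
  by (subst ring_hom_mult[OF proj_hom, symmetric]) (auto simp: psimps intro!: frag_closed)

lemma elt_one: "elt \<one>\<^bsub>A\<^esub> \<one>\<^bsub>B\<^esub> = \<one>\<^bsub>T\<^esub>"
  unfolding tensor_elt_def using ring_hom_one[OF proj_hom] by (simp add: psimps)

lemma proj_eqI:
  assumes "u \<in> carrier (pair_ring A B)" "v \<in> carrier (pair_ring A B)" "u - v \<in> tensor_rels"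
  shows "tensor_ideal \<alpha> A \<beta> B +>\<^bsub>pair_ring A B\<^esub> u = tensor_ideal \<alpha> A \<beta> B +>\<^bsub>pair_ring A B\<^esub> v"
proof -
  have "u \<ominus>\<^bsub>pair_ring A B\<^esub> v \<in> tensor_ideal \<alpha> A \<beta> B"
    using assms pair_ring_minus[OF ring_A ring_B] P.genideal_self[OF tensor_rels_closed]
    by (auto simp: tensor_ideal_eq)
  then show ?thesis
    using P.quotient_eq_iff_same_a_r_cos[OF I.is_ideal assms(1,2)] by blast
qed

lemma elt_add_left:
  assumes "a \<in> carrier A" "a' \<in> carrier A" "b \<in> carrier B"
  shows "elt (a \<oplus>\<^bsub>A\<^esub> a') b = elt a b \<oplus>\<^bsub>T\<^esub> elt a' b"
proof -
  have "elt a b \<oplus>\<^bsub>T\<^esub> elt a' b = tensor_ideal \<alpha> A \<beta> B +>\<^bsub>pair_ring A B\<^esub> (frag_of (a, b) + frag_of (a', b))"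
    unfolding tensor_elt_def using assms
    by (subst ring_hom_add[OF proj_hom, symmetric]) (auto simp: psimps intro!: frag_closed)
  also have "\<dots> = elt (a \<oplus>\<^bsub>A\<^esub> a') b"
    unfolding tensor_elt_def
  proof (rule proj_eqI[symmetric])
    show "frag_of (a, b) + frag_of (a', b) \<in> carrier (pair_ring A B)"
      using P.a_closed[OF frag_closed frag_closed] assms by (auto simp: psimps)
    have "frag_of (a \<oplus>\<^bsub>A\<^esub> a', b) - frag_of (a, b) - frag_of (a', b) \<in> tensor_rels"
      unfolding tensor_rels_def using assms by blast
    then show "frag_of (a \<oplus>\<^bsub>A\<^esub> a', b) - (frag_of (a, b) + frag_of (a', b)) \<in> tensor_rels"
      by (simp add: diff_diff_add)
  qed (use assms in \<open>auto intro!: frag_closed\<close>)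
  finally show ?thesis ..
qed

lemma elt_add_right:
  assumes "a \<in> carrier A" "b \<in> carrier B" "b' \<in> carrier B"
  shows "elt a (b \<oplus>\<^bsub>B\<^esub> b') = elt a b \<oplus>\<^bsub>T\<^esub> elt a b'"
proof -
  have "elt a b \<oplus>\<^bsub>T\<^esub> elt a b' = tensor_ideal \<alpha> A \<beta> B +>\<^bsub>pair_ring A B\<^esub> (frag_of (a, b) + frag_of (a, b'))"
    unfolding tensor_elt_def using assms
    by (subst ring_hom_add[OF proj_hom, symmetric]) (auto simp: psimps intro!: frag_closed)
  also have "\<dots> = elt a (b \<oplus>\<^bsub>B\<^esub> b')"
    unfolding tensor_elt_def
  proof (rule proj_eqI[symmetric])
    show "frag_of (a, b) + frag_of (a, b') \<in> carrier (pair_ring A B)"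
      using P.a_closed[OF frag_closed frag_closed] assms by (auto simp: psimps)
    have "frag_of (a, b \<oplus>\<^bsub>B\<^esub> b') - frag_of (a, b) - frag_of (a, b') \<in> tensor_rels"
      unfolding tensor_rels_def using assms by blast
    then show "frag_of (a, b \<oplus>\<^bsub>B\<^esub> b') - (frag_of (a, b) + frag_of (a, b')) \<in> tensor_rels"
      by (simp add: diff_diff_add)
  qed (use assms in \<open>auto intro!: frag_closed\<close>)
  finally show ?thesis ..
qed

lemma elt_balanced:
  assumes "a \<in> carrier A" "b \<in> carrier B"
  shows "elt (\<alpha> c \<otimes>\<^bsub>A\<^esub> a) b = elt a (\<beta> c \<otimes>\<^bsub>B\<^esub> b)"
  unfolding tensor_elt_def
proof (rule proj_eqI)
  show "frag_of (\<alpha> c \<otimes>\<^bsub>A\<^esub> a, b) - frag_of (a, \<beta> c \<otimes>\<^bsub>B\<^esub> b) \<in> tensor_rels"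
    unfolding tensor_rels_def using assms by blast
qed (use assms \<alpha>_closed \<beta>_closed in \<open>auto intro!: frag_closed\<close>)

lemma elt_zero_left: "b \<in> carrier B \<Longrightarrow> elt \<zero>\<^bsub>A\<^esub> b = \<zero>\<^bsub>T\<^esub>"
  using elt_add_left[of "\<zero>\<^bsub>A\<^esub>" "\<zero>\<^bsub>A\<^esub>" b, symmetric] by (simp add: T.add.l_cancel_one')

lemma elt_zero_right: "a \<in> carrier A \<Longrightarrow> elt a \<zero>\<^bsub>B\<^esub> = \<zero>\<^bsub>T\<^esub>"
  using elt_add_right[of a "\<zero>\<^bsub>B\<^esub>" "\<zero>\<^bsub>B\<^esub>", symmetric] by (simp add: T.add.l_cancel_one')

lemma tensor_induct [consumes 1, case_names zero elt diff]:
  assumes "W \<in> carrier T" "P \<zero>\<^bsub>T\<^esub>"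
    and "\<And>a b. a \<in> carrier A \<Longrightarrow> b \<in> carrier B \<Longrightarrow> P (elt a b)"
    and "\<And>W Y. W \<in> carrier T \<Longrightarrow> Y \<in> carrier T \<Longrightarrow> P W \<Longrightarrow> P Y \<Longrightarrow> P (W \<ominus>\<^bsub>T\<^esub> Y)"
  shows "P W"
proof -
  interpret pr: ring_hom_ring "pair_ring A B" T "(+>\<^bsub>pair_ring A B\<^esub>) (tensor_ideal \<alpha> A \<beta> B)"
    by (intro ring_hom_ringI' proj_hom P.ring_axioms T.ring_axioms)
  obtain u where u: "u \<in> carrier (pair_ring A B)" "W = tensor_ideal \<alpha> A \<beta> B +>\<^bsub>pair_ring A B\<^esub> u"
    using assms(1) unfolding tensor_ring_def by (rule FactRing_carrierE)
  from u(1) have "P (tensor_ideal \<alpha> A \<beta> B +>\<^bsub>pair_ring A B\<^esub> u)"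
  proof (induction rule: pair_induct)
    case zero
    then show ?case using P.zero_closed pr.hom_zero assms(2) by (simp add: psimps)
  next
    case (one a b)
    then show ?case using assms(3) by (simp add: tensor_elt_def)
  next
    case (diff u v)
    then have "tensor_ideal \<alpha> A \<beta> B +>\<^bsub>pair_ring A B\<^esub> (u - v) =
      (tensor_ideal \<alpha> A \<beta> B +>\<^bsub>pair_ring A B\<^esub> u) \<ominus>\<^bsub>T\<^esub> (tensor_ideal \<alpha> A \<beta> B +>\<^bsub>pair_ring A B\<^esub> v)"
      by (simp add: pair_ring_minus[OF ring_A ring_B, symmetric] a_minus_def)
    then show ?case using diff assms(4) by simp
  qed
  then show ?thesis using u by simp
qed

lemma tensor_hom_eqI:
  assumes "ring S" "f \<in> ring_hom T S" "g \<in> ring_hom T S" "W \<in> carrier T"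
    and "\<And>a b. a \<in> carrier A \<Longrightarrow> b \<in> carrier B \<Longrightarrow> f (elt a b) = g (elt a b)"
  shows "f W = g W"
proof -
  interpret f: ring_hom_ring T S f by (intro ring_hom_ringI' assms T.ring_axioms)
  interpret g: ring_hom_ring T S g by (intro ring_hom_ringI' assms T.ring_axioms)
  from assms(4) show ?thesis
    by (induction rule: tensor_induct) (simp_all add: assms(5) a_minus_def)
qed

end

locale tensor_map = tensor_alg \<alpha> A \<beta> B
  for \<alpha> :: "'s \<Rightarrow> 'a" and A :: "('a, 'm) ring_scheme" and \<beta> :: "'s \<Rightarrow> 'b" and B :: "('b, 'n) ring_scheme" +
  fixes S :: "('t, 'o) ring_scheme" and F :: "'a \<Rightarrow> 'b \<Rightarrow> 't"
  assumes ring_S: "ring S"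
    and F_closed: "\<And>a b. a \<in> carrier A \<Longrightarrow> b \<in> carrier B \<Longrightarrow> F a b \<in> carrier S"
    and F_add_left: "\<And>a a' b. a \<in> carrier A \<Longrightarrow> a' \<in> carrier A \<Longrightarrow> b \<in> carrier B
      \<Longrightarrow> F (a \<oplus>\<^bsub>A\<^esub> a') b = F a b \<oplus>\<^bsub>S\<^esub> F a' b"
    and F_add_right: "\<And>a b b'. a \<in> carrier A \<Longrightarrow> b \<in> carrier B \<Longrightarrow> b' \<in> carrier B
      \<Longrightarrow> F a (b \<oplus>\<^bsub>B\<^esub> b') = F a b \<oplus>\<^bsub>S\<^esub> F a b'"
    and F_balanced: "\<And>a b c. a \<in> carrier A \<Longrightarrow> b \<in> carrier B
      \<Longrightarrow> F (\<alpha> c \<otimes>\<^bsub>A\<^esub> a) b = F a (\<beta> c \<otimes>\<^bsub>B\<^esub> b)"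
    and F_mult: "\<And>a b a' b'. a \<in> carrier A \<Longrightarrow> b \<in> carrier B \<Longrightarrow> a' \<in> carrier A \<Longrightarrow> b' \<in> carrier B
      \<Longrightarrow> F (a \<otimes>\<^bsub>A\<^esub> a') (b \<otimes>\<^bsub>B\<^esub> b') = F a b \<otimes>\<^bsub>S\<^esub> F a' b'"
    and F_one: "F \<one>\<^bsub>A\<^esub> \<one>\<^bsub>B\<^esub> = \<one>\<^bsub>S\<^esub>"
begin

sublocale S: ring S by (rule ring_S)

abbreviation FS where "FS \<equiv> frag_sum S (\<lambda>s. F (fst s) (snd s))"

lemma FS_diff:
  assumes "u \<in> carrier (pair_ring A B)" "v \<in> carrier (pair_ring A B)"
  shows "FS (u - v) = FS u \<ominus>\<^bsub>S\<^esub> FS v"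
  by (rule S.frag_sum_diff[where S = "carrier A \<times> carrier B"])
     (use assms F_closed in \<open>auto simp: pair_ring_carrier[OF ring_A ring_B]\<close>)

lemma FS_frag: "a \<in> carrier A \<Longrightarrow> b \<in> carrier B \<Longrightarrow> FS (frag_of (a, b)) = F a b"
  using S.frag_sum_frag_of[of "\<lambda>s. F (fst s) (snd s)" "(a, b)"] F_closed by simp

lemma FS_closed: "u \<in> carrier (pair_ring A B) \<Longrightarrow> FS u \<in> carrier S"
  by (rule S.frag_sum_closed) (use F_closed in \<open>auto simp: pair_ring_carrier[OF ring_A ring_B]\<close>)

lemma FS_hom: "FS \<in> ring_hom (pair_ring A B) S"
proof (rule ring_hom_memI)
  fix u v assume u: "u \<in> carrier (pair_ring A B)" and v: "v \<in> carrier (pair_ring A B)"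
  show "FS (u \<oplus>\<^bsub>pair_ring A B\<^esub> v) = FS u \<oplus>\<^bsub>S\<^esub> FS v" unfolding psimps
    by (rule S.frag_sum_add[where S = "carrier A \<times> carrier B"])
       (use u v F_closed in \<open>auto simp: pair_ring_carrier[OF ring_A ring_B]\<close>)
  note mc = pair_ring_mult_closed[OF ring_A ring_B]
  note pm = pair_ring_mult_add[OF ring_A ring_B]
  note pa = pair_ring_add_mult[OF ring_A ring_B]
  show "FS (u \<otimes>\<^bsub>pair_ring A B\<^esub> v) = FS u \<otimes>\<^bsub>S\<^esub> FS v" using u
  proof (induction rule: pair_induct)
    case zero
    then show ?case using v by (simp add: pm S.frag_sum_zero FS_closed)
  next
    case u: (one a b)
    then have Fab: "F a b \<in> carrier S" by (rule F_closed)
    show ?case using v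
    proof (induction rule: pair_induct)
      case zero
      then show ?case using u by (simp add: pa S.frag_sum_zero FS_closed frag_closed)
    next
      case (one a' b')
      then show ?case using u by (simp add: psimps FS_frag F_mult)
    next
      case (diff v w)
      then show ?case using u Fab
        by (simp add: pa FS_diff FS_closed mc frag_closed FS_frag S.r_distr S.r_minus a_minus_def)
    qed
  next
    case (diff w w')
    then show ?case using v
      by (simp add: pm FS_diff FS_closed mc S.l_distr S.l_minus a_minus_def)
  qed
qed (simp_all add: FS_closed psimps FS_frag F_one)

lemma FS_ideal: "i \<in> tensor_ideal \<alpha> A \<beta> B \<Longrightarrow> FS i = \<zero>\<^bsub>S\<^esub>"
  unfolding tensor_ideal_eq
proof (rule genideal_hom_zero[OF P.ring_axioms ring_S FS_hom tensor_rels_closed])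
  fix g assume "g \<in> tensor_rels"
  moreover have "(x \<oplus>\<^bsub>S\<^esub> y) \<ominus>\<^bsub>S\<^esub> x \<ominus>\<^bsub>S\<^esub> y = \<zero>\<^bsub>S\<^esub>" if "x \<in> carrier S" "y \<in> carrier S" for x y
  proof -
    have "(x \<oplus>\<^bsub>S\<^esub> y) \<ominus>\<^bsub>S\<^esub> x \<ominus>\<^bsub>S\<^esub> y = (x \<oplus>\<^bsub>S\<^esub> y) \<oplus>\<^bsub>S\<^esub> (\<ominus>\<^bsub>S\<^esub> x \<oplus>\<^bsub>S\<^esub> \<ominus>\<^bsub>S\<^esub> y)"
      using that by (simp add: a_minus_def S.a_assoc)
    also have "\<dots> = (x \<oplus>\<^bsub>S\<^esub> y) \<oplus>\<^bsub>S\<^esub> \<ominus>\<^bsub>S\<^esub> (x \<oplus>\<^bsub>S\<^esub> y)"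
      using that by (simp add: S.minus_add)
    finally show ?thesis using that by (simp only: S.r_neg S.a_closed)
  qed
  ultimately show "FS g = \<zero>\<^bsub>S\<^esub>"
    unfolding tensor_rels_def
    by (auto simp: FS_diff FS_closed FS_frag frag_closed diff_closed F_add_left F_add_right
         F_balanced F_closed \<alpha>_closed \<beta>_closed)
qed

lemma lift_hom: "tensor_lift S F \<in> ring_hom T S"
  unfolding tensor_lift_eq[abs_def] tensor_ring_def
  by (rule quotient_lift(1)[OF P.ring_axioms ring_S FS_hom I.is_ideal FS_ideal])

lemma lift_elt: "a \<in> carrier A \<Longrightarrow> b \<in> carrier B \<Longrightarrow> tensor_lift S F (elt a b) = F a b"
  unfolding tensor_lift_eq tensor_elt_def
  by (subst quotient_lift(2)[OF P.ring_axioms ring_S FS_hom I.is_ideal FS_ideal])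
     (auto simp: frag_closed FS_frag)

end

section \<open>Evaluation homomorphisms\<close>

locale comm_hom =
  fixes f :: "'a::comm_ring_1 \<Rightarrow> 'b::comm_ring_1"
  assumes hom_add: "f (a + b) = f a + f b" and hom_mult: "f (a * b) = f a * f b" and hom_one: "f 1 = 1"
begin

lemma hom_zero: "f 0 = 0"
  using hom_add[of 0 0] by simp

lemma hom_uminus: "f (- a) = - f a"
  using hom_add[of a "- a"] by (simp add: hom_zero add_eq_0_iff)

lemma hom_diff: "f (a - b) = f a - f b"
  using hom_add[of a "- b"] by (simp add: hom_uminus)

lemma hom_power: "f (a ^ n) = f a ^ n"
  by (induction n) (simp_all add: hom_mult hom_one)

lemma hom_sum: "f (sum g S) = (\<Sum>i\<in>S. f (g i))"
  by (induction S rule: infinite_finite_induct) (simp_all add: hom_add hom_zero)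

lemmas hom_simps = hom_add hom_mult hom_one hom_zero hom_uminus hom_diff hom_power hom_sum

end

lemma comm_hom_id: "comm_hom (\<lambda>x. x)"
  by unfold_locales auto

lemma comm_hom_compose: "comm_hom f \<Longrightarrow> comm_hom g \<Longrightarrow> comm_hom (\<lambda>x. f (g x))"
  by (simp add: comm_hom_def)

definition poly_eval :: "('a::comm_ring_1 \<Rightarrow> 'b::comm_ring_1) \<Rightarrow> 'b \<Rightarrow> 'a poly \<Rightarrow> 'b" where
  "poly_eval f t p = poly (map_poly f p) t"

context comm_hom
begin

lemma poly_eval_pCons: "poly_eval f t (pCons a p) = f a + t * poly_eval f t p"
  by (simp add: poly_eval_def map_poly_pCons hom_zero)

lemma poly_eval_0: "poly_eval f t 0 = 0"
  by (simp add: poly_eval_def)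

lemma poly_eval_const: "poly_eval f t [:a:] = f a"
  by (simp add: poly_eval_pCons poly_eval_0)

lemma poly_eval_add: "poly_eval f t (p + p') = poly_eval f t p + poly_eval f t p'"
  by (induction p p' rule: poly_induct2) (simp_all add: poly_eval_pCons poly_eval_0 hom_add algebra_simps)

lemma poly_eval_smult: "poly_eval f t (smult a p) = f a * poly_eval f t p"
  by (induction p) (simp_all add: poly_eval_pCons poly_eval_0 hom_mult algebra_simps)

lemma comm_hom_poly_eval: "comm_hom (poly_eval f t)"
proof
  show "poly_eval f t (p * p') = poly_eval f t p * poly_eval f t p'" for p p'
    by (induction p)
       (simp_all add: poly_eval_pCons poly_eval_0 poly_eval_add poly_eval_smult hom_zero algebra_simps)
  show "poly_eval f t 1 = 1"
    using poly_eval_const[of t 1] by (simp add: hom_one one_pCons)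
qed (rule poly_eval_add)

lemma poly_eval_var: "poly_eval f t [:0, 1:] = t"
  by (simp add: poly_eval_pCons poly_eval_0 hom_zero hom_one)

end

lemma poly_hom_eqI:
  assumes "comm_hom f" "comm_hom g" "\<And>a. f [:a:] = g [:a:]" "f [:0, 1:] = g [:0, 1:]"
  shows "f = g"
proof
  interpret f: comm_hom f by fact
  interpret g: comm_hom g by fact
  fix p
  show "f p = g p"
  proof (induction p)
    case 0
    show ?case by (simp only: f.hom_zero g.hom_zero)
  next
    case (pCons a p)
    have "pCons a p = [:a:] + [:0, 1:] * p" by simp
    then show ?case by (simp only: f.hom_add g.hom_add f.hom_mult g.hom_mult assms(3,4) pCons.IH)
  qed
qed

section \<open>Bivariate polynomials\<close>

text \<open>\<open>F[u, v]\<close> is \<open>'f poly poly\<close> with \<open>u\<close> the inner and \<open>v\<close> the outer variable.\<close>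

definition bi_const :: "'f::comm_ring_1 \<Rightarrow> 'f poly poly" where "bi_const c = [:[:c:]:]"
definition bi_u :: "'f::comm_ring_1 poly poly" where "bi_u = [:[:0, 1:]:]"
definition bi_v :: "'f::comm_ring_1 poly poly" where "bi_v = [:0, 1:]"
definition in_u :: "'f::comm_ring_1 poly \<Rightarrow> 'f poly poly" where "in_u a = [:a:]"
definition in_v :: "'f::comm_ring_1 poly \<Rightarrow> 'f poly poly" where "in_v = poly_eval bi_const bi_v"

definition swap_uv :: "'f::comm_ring_1 poly poly \<Rightarrow> 'f poly poly" where "swap_uv = poly_eval in_v bi_u"
definition diag_u :: "'f::comm_ring_1 poly poly \<Rightarrow> 'f poly poly" where "diag_u = poly_eval in_u bi_u"
definition diag_v :: "'f::comm_ring_1 poly poly \<Rightarrow> 'f poly poly" where "diag_v = poly_eval in_v bi_v"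

interpretation bi_const: comm_hom bi_const
  by unfold_locales (simp_all add: bi_const_def one_pCons)

interpretation in_u: comm_hom in_u
  by unfold_locales (simp_all add: in_u_def one_pCons)

interpretation in_v: comm_hom in_v
  unfolding in_v_def by (rule bi_const.comm_hom_poly_eval)

interpretation swap_uv: comm_hom swap_uv
  unfolding swap_uv_def by (rule in_v.comm_hom_poly_eval)

interpretation diag_u: comm_hom diag_u
  unfolding diag_u_def by (rule in_u.comm_hom_poly_eval)

interpretation diag_v: comm_hom diag_v
  unfolding diag_v_def by (rule in_v.comm_hom_poly_eval)

lemma in_v_base: "in_v [:c:] = bi_const c" "in_v [:0, 1:] = bi_v"
  by (simp_all only: in_v_def bi_const.poly_eval_const bi_const.poly_eval_var)

lemma in_u_base: "in_u [:c:] = bi_const c" "in_u [:0, 1:] = bi_u"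
  by (simp_all only: in_u_def bi_const_def bi_u_def)

lemma bi_hom_eqI:
  assumes "comm_hom f" "comm_hom g" "\<And>c. f (bi_const c) = g (bi_const c)" "f bi_u = g bi_u" "f bi_v = g bi_v"
  shows "f = g"
proof (rule poly_hom_eqI)
  have "(\<lambda>a. f (in_u a)) = (\<lambda>a. g (in_u a))"
    by (rule poly_hom_eqI[OF comm_hom_compose[OF assms(1) in_u.comm_hom_axioms]
          comm_hom_compose[OF assms(2) in_u.comm_hom_axioms]]) (simp_all only: in_u_base assms)
  from fun_cong[OF this] show "f [:a:] = g [:a:]" for a by (simp only: in_u_def)
qed (use assms in \<open>simp_all only: bi_v_def\<close>)

lemma uni_hom_eqI:
  assumes "comm_hom f" "comm_hom g" "\<And>c. f [:c:] = g [:c:]" "f [:0, 1:] = g [:0, 1:]"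
  shows "f p = g p"
  using poly_hom_eqI[OF assms] by simp

lemma bi_swap_base: "swap_uv (in_u a) = in_v a" "swap_uv bi_v = bi_u"
  by (simp_all only: swap_uv_def in_u_def bi_v_def in_v.poly_eval_const in_v.poly_eval_var)

lemma bi_diag_base: "diag_u (in_u a) = in_u a" "diag_u bi_v = bi_u" "diag_v (in_u a) = in_v a" "diag_v bi_v = bi_v"
  using in_u.poly_eval_const[of bi_u a] in_v.poly_eval_const[of bi_v a]
    in_u.poly_eval_var[of bi_u] in_v.poly_eval_var[of bi_v]
  by (simp_all add: diag_u_def diag_v_def in_u_def[of a] bi_v_def[symmetric])

lemma bi_swap_simps [simp]:
  "swap_uv (bi_const c) = bi_const c" "swap_uv bi_u = bi_v" "swap_uv bi_v = bi_u" "swap_uv (in_u a) = in_v a"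
  using bi_swap_base(1)[of "[:c:]"] bi_swap_base(1)[of "[:0, 1:]"] bi_swap_base
  by (simp_all add: in_u_base in_v_base)

lemma bi_diag_simps [simp]:
  "diag_u (bi_const c) = bi_const c" "diag_u bi_u = bi_u" "diag_u bi_v = bi_u" "diag_u (in_u a) = in_u a"
  "diag_v (bi_const c) = bi_const c" "diag_v bi_u = bi_v" "diag_v bi_v = bi_v" "diag_v (in_u a) = in_v a"
  using bi_diag_base(1,3)[of "[:c:]"] bi_diag_base(1,3)[of "[:0, 1:]"] bi_diag_base
  by (simp_all add: in_u_base in_v_base)

lemma bi_compose [simp]:
  "swap_uv (swap_uv h) = h" "swap_uv (diag_u h) = diag_v h" "swap_uv (diag_v h) = diag_u h"
  "diag_u (swap_uv h) = diag_u h" "diag_v (swap_uv h) = diag_v h"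
  "diag_u (diag_u h) = diag_u h" "diag_u (diag_v h) = diag_u h"
  "diag_v (diag_u h) = diag_v h" "diag_v (diag_v h) = diag_v h"
proof -
  show "swap_uv (swap_uv h) = h"
    by (rule bi_hom_eqI[OF comm_hom_compose[OF swap_uv.comm_hom_axioms swap_uv.comm_hom_axioms] comm_hom_id, THEN fun_cong]) simp_all
  show "swap_uv (diag_u h) = diag_v h"
    by (rule bi_hom_eqI[OF comm_hom_compose[OF swap_uv.comm_hom_axioms diag_u.comm_hom_axioms] diag_v.comm_hom_axioms, THEN fun_cong]) simp_all
  show "swap_uv (diag_v h) = diag_u h"
    by (rule bi_hom_eqI[OF comm_hom_compose[OF swap_uv.comm_hom_axioms diag_v.comm_hom_axioms] diag_u.comm_hom_axioms, THEN fun_cong]) simp_all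
  show "diag_u (swap_uv h) = diag_u h"
    by (rule bi_hom_eqI[OF comm_hom_compose[OF diag_u.comm_hom_axioms swap_uv.comm_hom_axioms] diag_u.comm_hom_axioms, THEN fun_cong]) simp_all
  show "diag_v (swap_uv h) = diag_v h"
    by (rule bi_hom_eqI[OF comm_hom_compose[OF diag_v.comm_hom_axioms swap_uv.comm_hom_axioms] diag_v.comm_hom_axioms, THEN fun_cong]) simp_all
  show "diag_u (diag_u h) = diag_u h"
    by (rule bi_hom_eqI[OF comm_hom_compose[OF diag_u.comm_hom_axioms diag_u.comm_hom_axioms] diag_u.comm_hom_axioms, THEN fun_cong]) simp_all
  show "diag_u (diag_v h) = diag_u h"
    by (rule bi_hom_eqI[OF comm_hom_compose[OF diag_u.comm_hom_axioms diag_v.comm_hom_axioms] diag_u.comm_hom_axioms, THEN fun_cong]) simp_all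
  show "diag_v (diag_u h) = diag_v h"
    by (rule bi_hom_eqI[OF comm_hom_compose[OF diag_v.comm_hom_axioms diag_u.comm_hom_axioms] diag_v.comm_hom_axioms, THEN fun_cong]) simp_all
  show "diag_v (diag_v h) = diag_v h"
    by (rule bi_hom_eqI[OF comm_hom_compose[OF diag_v.comm_hom_axioms diag_v.comm_hom_axioms] diag_v.comm_hom_axioms, THEN fun_cong]) simp_all
qed

lemma bi_in_v_simps [simp]: "swap_uv (in_v a) = in_u a" "diag_u (in_v a) = in_u a" "diag_v (in_v a) = in_v a"
  by (simp_all flip: bi_swap_simps(4))

lemma bi_u_minus_v_nonzero: "(bi_u :: 'f::comm_ring_1 poly poly) - bi_v \<noteq> 0"
proof -
  have "bi_u - bi_v = [:[:0, 1:], -1 :: 'f poly:]" by (simp add: bi_u_def bi_v_def)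
  then show ?thesis by simp
qed

lemma diag_u_zero_dvd:
  fixes h :: "'f::idom poly poly"
  assumes "diag_u h = 0"
  shows "bi_u - bi_v dvd h"
proof -
  have "diag_u h = [:poly h [:0, 1:]:]"
  proof (rule bi_hom_eqI[of diag_u "\<lambda>h. [:poly h [:0, 1:]:]", THEN fun_cong])
    show "comm_hom (\<lambda>h. [:poly h [:0, 1:] :: 'f poly:])"
      by unfold_locales (simp_all add: one_pCons)
  qed (simp_all add: diag_u.comm_hom_axioms, simp_all add: bi_const_def bi_u_def bi_v_def)
  then have "[:- [:0, 1:], 1:] dvd h" using assms by (simp add: poly_eq_0_iff_dvd)
  moreover have "bi_u - bi_v = - [:- [:0, 1:], 1 :: 'f poly:]" by (simp add: bi_u_def bi_v_def)
  ultimately show ?thesis by (simp only: minus_dvd_iff)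
qed

section \<open>A representation of the affine Hecke algebra\<close>

text \<open>The module induced from the character \<open>R \<mapsto> q\<close> of the finite Hecke algebra, where \<open>q u\<^sup>i v\<^sup>j\<close> is
  \<open>K\<^sup>i R K\<^sup>j\<close> applied to the generator: \<open>K\<close> multiplies by \<open>u\<close>, and \<open>R\<close> acts by
  \<open>q h(v, u) + \<omega> (v h(u, u) + u h(v, v) - u h(v, u) - v h(u, v)) / (u - v)\<close>.\<close>

definition sym_num :: "'f::field poly poly \<Rightarrow> 'f poly poly" where
  "sym_num h = bi_v * diag_u h + bi_u * diag_v h - bi_u * swap_uv h - bi_v * h"

definition divided_diff :: "'f::field poly poly \<Rightarrow> 'f poly poly" where
  "divided_diff h = sym_num h div (bi_u - bi_v)"

lemma divided_diff: "(bi_u - bi_v) * divided_diff h = sym_num h"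
proof -
  have "diag_u (sym_num h) = 0"
    by (simp add: sym_num_def diag_u.hom_simps)
  from diag_u_zero_dvd[OF this] show ?thesis by (simp add: divided_diff_def)
qed

lemma divided_diff_unique: "(bi_u - bi_v) * g = sym_num h \<Longrightarrow> divided_diff h = g"
  using divided_diff[of h] bi_u_minus_v_nonzero by (metis mult_cancel_left)

lemma divided_diff_add: "divided_diff (g + h) = divided_diff g + divided_diff h"
  by (rule divided_diff_unique)
     (simp add: distrib_left divided_diff, simp add: sym_num_def swap_uv.hom_simps diag_u.hom_simps diag_v.hom_simps algebra_simps)

lemma divided_diff_const_mult: "divided_diff (bi_const c * h) = bi_const c * divided_diff h"
proof (rule divided_diff_unique)
  have "(bi_u - bi_v) * (bi_const c * divided_diff h) = bi_const c * sym_num h"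
    by (simp add: divided_diff[symmetric] algebra_simps)
  also have "\<dots> = sym_num (bi_const c * h)"
    by (simp add: sym_num_def swap_uv.hom_simps diag_u.hom_simps diag_v.hom_simps algebra_simps)
  finally show "(bi_u - bi_v) * (bi_const c * divided_diff h) = sym_num (bi_const c * h)" .
qed

lemma swap_divided_diff: "swap_uv (divided_diff h) = - divided_diff h"
proof -
  have "swap_uv ((bi_u - bi_v) * divided_diff h) = sym_num h"
    unfolding divided_diff by (simp add: sym_num_def swap_uv.hom_simps algebra_simps)
  then have "(bi_u - bi_v) * (- swap_uv (divided_diff h)) = sym_num h"
    by (simp add: swap_uv.hom_simps algebra_simps)
  from divided_diff_unique[OF this] show ?thesis by (metis minus_minus)
qed

text \<open>A symmetric polynomial that vanishes on the diagonal is divisible by \<open>(u - v)\<^sup>2\<close>.\<close>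

lemma diag_divided_diff:
  assumes "(2::'f::field) \<noteq> 0"
  shows "diag_u (divided_diff h) = 0" "diag_v (divided_diff (h :: 'f poly poly)) = 0"
proof -
  have "diag_u (divided_diff h) = - diag_u (divided_diff h)"
    using arg_cong[OF swap_divided_diff[of h], of diag_u] by (simp add: diag_u.hom_simps)
  then have "2 * diag_u (divided_diff h) = 0" by (metis add.right_inverse mult_2)
  moreover have "(2 :: 'f poly poly) \<noteq> 0"
    using assms by (metis bi_const_def bi_const.hom_add bi_const.hom_one one_add_one pCons_eq_0_iff)
  ultimately show "diag_u (divided_diff h) = 0" by simp
  from arg_cong[OF this, of swap_uv] show "diag_v (divided_diff h) = 0" by (simp add: swap_uv.hom_simps)
qed

locale hecke_rep =
  fixes q \<omega> :: "'f::field"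
  assumes quadratic: "q ^ 2 = \<omega> * q + 1" and two: "(2::'f) \<noteq> 0"
begin

definition op_R :: "'f poly poly \<Rightarrow> 'f poly poly" where
  "op_R h = bi_const q * swap_uv h + bi_const \<omega> * divided_diff h"

lemma op_R_add: "op_R (g + h) = op_R g + op_R h"
  by (simp add: op_R_def divided_diff_add swap_uv.hom_simps algebra_simps)

lemma op_R_const_mult: "op_R (bi_const c * h) = bi_const c * op_R h"
  by (simp only: op_R_def divided_diff_const_mult swap_uv.hom_mult bi_swap_simps distrib_left mult.left_commute)

lemma diag_op_R: "diag_u (op_R h) = bi_const q * diag_u h" "diag_v (op_R h) = bi_const q * diag_v h"
  by (simp_all add: op_R_def diag_u.hom_simps diag_v.hom_simps diag_divided_diff[OF two])

lemma op_R_eq: "(bi_u - bi_v) * op_R h = (bi_u - bi_v) * bi_const q * swap_uv h + bi_const \<omega> * sym_num h"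
  by (simp add: op_R_def divided_diff[symmetric] algebra_simps)

lemma swap_op_R_eq:
  "(bi_u - bi_v) * swap_uv (op_R h) = (bi_u - bi_v) * bi_const q * h - bi_const \<omega> * sym_num h"
  by (simp add: op_R_def swap_uv.hom_simps swap_divided_diff divided_diff[symmetric] algebra_simps)

lemma bi_quadratic: "bi_const q * bi_const q = bi_const \<omega> * bi_const q + 1"
  using arg_cong[OF quadratic, of bi_const] by (simp add: bi_const.hom_simps power2_eq_square)

lemma op_R_quadratic: "op_R (op_R h) = bi_const \<omega> * op_R h + h"
proof -
  define Q W A B s d Y Z where defs: "Q = bi_const q" "W = bi_const \<omega>" "A = diag_u h" "B = diag_v h"
    "s = swap_uv h" "d = bi_u - (bi_v :: 'f poly poly)" "Y = op_R h" "Z = swap_uv (op_R h)"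
  define u v :: "'f poly poly" where uv: "u = bi_u" "v = bi_v"
  define N where "N = v * A + u * B - u * s - v * h"
  have Y: "d * Y = d * Q * s + W * N" and Z: "d * Z = d * Q * h - W * N"
    using op_R_eq[of h] swap_op_R_eq[of h] by (simp_all add: defs uv N_def sym_num_def)
  have QQ: "Q * Q = W * Q + 1" using bi_quadratic by (simp add: defs)
  have d: "d = u - v" by (simp add: defs uv)
  have "d * op_R (op_R h) = d * Q * Z + W * (v * (Q * A) + u * (Q * B) - u * Z - v * Y)"
    using op_R_eq[of "op_R h"] by (simp add: defs uv sym_num_def diag_op_R)
  from arg_cong[OF this, of "(*) d"]
  have "d * (d * op_R (op_R h)) = d * Q * (d * Z) + W * (d * v * (Q * A) + d * u * (Q * B) - u * (d * Z) - v * (d * Y))"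
    by (simp add: algebra_simps)
  also have "\<dots> = d * d * (Q * Q) * h - d * Q * W * N + W * Q * d * (v * A + u * B - u * h - v * s) + W * W * d * N"
    unfolding Y Z by (simp add: d algebra_simps)
  also have "\<dots> = d * d * h + W * d * (d * Q * s + W * N)"
    unfolding QQ by (simp add: d N_def algebra_simps)
  also have "\<dots> = d * (d * (W * Y + h))" unfolding Y[symmetric] by (simp add: algebra_simps)
  finally show ?thesis
    using bi_u_minus_v_nonzero[where ?'f = 'f] by (simp add: defs)
qed

lemma op_R_braid: "op_R (bi_u * op_R (bi_u * h)) = bi_u * op_R (bi_u * op_R h)"
proof -
  define Q W A B s d Y Z where defs: "Q = bi_const q" "W = bi_const \<omega>" "A = diag_u h" "B = diag_v h"
    "s = swap_uv h" "d = bi_u - (bi_v :: 'f poly poly)" "Y = op_R h" "Z = swap_uv (op_R h)"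
  define u v :: "'f poly poly" where uv: "u = bi_u" "v = bi_v"
  define S T where ST: "S = op_R (u * h)" "T = swap_uv (op_R (u * h))"
  define N M where "N = v * A + u * B - u * s - v * h" and "M = u * v * (A + B - s - h)"
  have Y: "d * Y = d * Q * s + W * N" and Z: "d * Z = d * Q * h - W * N"
    using op_R_eq[of h] swap_op_R_eq[of h] by (simp_all add: defs uv N_def sym_num_def)
  have S: "d * S = d * Q * v * s + W * M" and T: "d * T = d * Q * u * h - W * M"
    using op_R_eq[of "u * h"] swap_op_R_eq[of "u * h"]
    by (simp_all add: defs uv ST M_def sym_num_def swap_uv.hom_simps diag_u.hom_simps diag_v.hom_simps algebra_simps)
  have d: "d = u - v" by (simp add: defs uv)
  have "d * op_R (u * S) = d * Q * v * T + W * (v * u * (Q * u * A) + u * v * (Q * v * B) - u * v * T - v * u * S)"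
    using op_R_eq[of "u * S"]
    by (simp add: defs uv ST sym_num_def diag_op_R swap_uv.hom_simps diag_u.hom_simps diag_v.hom_simps algebra_simps)
  from arg_cong[OF this, of "(*) d"]
  have "d * (d * op_R (u * S)) = d * Q * v * (d * T) + W * u * v * (d * Q * u * A + d * Q * v * B - d * T - d * S)"
    by (simp add: algebra_simps)
  also have "\<dots> = d * Q * v * (d * Q * u * h - W * M) + W * u * v * d * Q * (u * A + v * B - u * h - v * s)"
    unfolding S T by (simp add: algebra_simps)
  also have "\<dots> = u * (d * Q * v * (d * Q * h - W * N) + W * u * v * d * Q * (A + B - h - s))"
    by (simp add: d N_def M_def algebra_simps)
  also have "\<dots> = u * (d * Q * v * (d * Z) + W * u * v * (d * Q * A + d * Q * B - d * Z - d * Y))"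
    unfolding Y Z by (simp add: algebra_simps)
  also have "\<dots> = d * (d * (u * op_R (u * Y)))"
  proof -
    have "d * op_R (u * Y) = d * Q * v * Z + W * (v * u * (Q * A) + u * v * (Q * B) - u * v * Z - v * u * Y)"
      using op_R_eq[of "u * Y"]
      by (simp add: defs uv sym_num_def diag_op_R swap_uv.hom_simps diag_u.hom_simps diag_v.hom_simps algebra_simps)
    from arg_cong[OF this, of "(*) (d * u)"]
    have "d * (d * (u * op_R (u * Y))) = d * u * (d * Q * v * Z + W * (v * u * (Q * A) + u * v * (Q * B) - u * v * Z - v * u * Y))"
      by (simp add: algebra_simps)
    then show ?thesis by (simp add: algebra_simps)
  qed
  finally show ?thesis
    using bi_u_minus_v_nonzero[where ?'f = 'f] by (simp add: defs uv ST)
qed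

lemma op_R_in_v: "op_R (in_u a * in_v b) = bi_const q * (in_u b * in_v a) + bi_const \<omega> * divided_diff (in_u a * in_v b)"
  by (simp add: op_R_def swap_uv.hom_simps mult.commute)

lemma op_R_in_u: "op_R (in_u b) = bi_const q * in_v b"
proof -
  have "divided_diff (in_u b) = 0"
    by (rule divided_diff_unique) (simp add: sym_num_def algebra_simps)
  then show ?thesis by (simp add: op_R_def)
qed

end

definition bi_ideal :: "'f::field poly \<Rightarrow> 'f poly poly set" where
  "bi_ideal p = {in_u p * a + in_v p * b | a b. True}"

lemma bi_ideal_add: "g \<in> bi_ideal p \<Longrightarrow> h \<in> bi_ideal p \<Longrightarrow> g + h \<in> bi_ideal p"
proof -
  assume "g \<in> bi_ideal p" "h \<in> bi_ideal p"
  then obtain a b c d where "g = in_u p * a + in_v p * b" "h = in_u p * c + in_v p * d"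
    unfolding bi_ideal_def by blast
  then have "g + h = in_u p * (a + c) + in_v p * (b + d)" by (simp add: algebra_simps)
  then show ?thesis unfolding bi_ideal_def by blast
qed

lemma bi_ideal_mult: "g \<in> bi_ideal p \<Longrightarrow> h * g \<in> bi_ideal p"
proof -
  assume "g \<in> bi_ideal p"
  then obtain a b where "g = in_u p * a + in_v p * b" unfolding bi_ideal_def by blast
  then have "h * g = in_u p * (h * a) + in_v p * (h * b)" by (simp add: algebra_simps)
  then show ?thesis unfolding bi_ideal_def by blast
qed

lemma bi_ideal_zero: "0 \<in> bi_ideal p"
proof -
  have "0 = in_u p * 0 + in_v p * 0" by simp
  then show ?thesis unfolding bi_ideal_def by blast
qed

lemma bi_ideal_uminus: "g \<in> bi_ideal p \<Longrightarrow> - g \<in> bi_ideal p"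
  using bi_ideal_mult[of g p "-1"] by simp

lemma bi_ideal_diff: "g \<in> bi_ideal p \<Longrightarrow> h \<in> bi_ideal p \<Longrightarrow> g - h \<in> bi_ideal p"
  using bi_ideal_add[of g p "- h"] bi_ideal_uminus by auto

lemma bi_ideal_gens: "in_u p * a \<in> bi_ideal p" "in_v p * a \<in> bi_ideal p"
proof -
  have "in_u p * a = in_u p * a + in_v p * 0" "in_v p * a = in_u p * 0 + in_v p * a" by simp_all
  then show "in_u p * a \<in> bi_ideal p" "in_v p * a \<in> bi_ideal p" unfolding bi_ideal_def by blast+
qed

lemma bi_ideal_divided_diff:
  assumes "h \<in> bi_ideal p"
  shows "divided_diff h \<in> bi_ideal p"
proof -
  obtain a b where h: "h = in_u p * a + in_v p * b" using assms unfolding bi_ideal_def by blast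
  have "diag_u (diag_u a - a) = 0" by (simp add: diag_u.hom_simps)
  from diag_u_zero_dvd[OF this] obtain e where e: "diag_u a - a = (bi_u - bi_v) * e" by (rule dvdE)
  have e': "diag_v a - swap_uv a = - (bi_u - bi_v) * swap_uv e"
    using arg_cong[OF e, of swap_uv] by (simp add: swap_uv.hom_simps algebra_simps)
  have "diag_u (bi_v * diag_u b - bi_u * swap_uv b) = 0" by (simp add: diag_u.hom_simps)
  from diag_u_zero_dvd[OF this] obtain c where
    c: "bi_v * diag_u b - bi_u * swap_uv b = (bi_u - bi_v) * c" by (rule dvdE)
  have c': "bi_u * diag_v b - bi_v * b = - (bi_u - bi_v) * swap_uv c"
    using arg_cong[OF c, of swap_uv] by (simp add: swap_uv.hom_simps algebra_simps)
  have "sym_num h = bi_v * in_u p * (diag_u a - a) + bi_u * in_v p * (diag_v a - swap_uv a) +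
      in_u p * (bi_v * diag_u b - bi_u * swap_uv b) + in_v p * (bi_u * diag_v b - bi_v * b)"
    by (simp add: h sym_num_def swap_uv.hom_simps diag_u.hom_simps diag_v.hom_simps algebra_simps)
  also have "\<dots> = (bi_u - bi_v) * (in_u p * (bi_v * e + c) + in_v p * (- bi_u * swap_uv e - swap_uv c))"
    unfolding e e' c c' by (simp add: algebra_simps)
  finally have "divided_diff h = in_u p * (bi_v * e + c) + in_v p * (- bi_u * swap_uv e - swap_uv c)"
    by (intro divided_diff_unique) simp
  then show ?thesis unfolding bi_ideal_def by blast
qed

lemma bi_ideal_swap:
  assumes "h \<in> bi_ideal p"
  shows "swap_uv h \<in> bi_ideal p"
proof -
  obtain a b where "h = in_u p * a + in_v p * b" using assms unfolding bi_ideal_def by blast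
  then have "swap_uv h = in_u p * swap_uv b + in_v p * swap_uv a" by (simp add: swap_uv.hom_simps)
  then show ?thesis unfolding bi_ideal_def by blast
qed

lemma (in hecke_rep) bi_ideal_op_R: "h \<in> bi_ideal p \<Longrightarrow> op_R h \<in> bi_ideal p"
  unfolding op_R_def by (intro bi_ideal_add bi_ideal_mult bi_ideal_swap bi_ideal_divided_diff)

section \<open>Linear functionals\<close>

locale lin_fun =
  fixes p :: "'f::field poly" and L :: "'f poly \<Rightarrow> 'f"
  assumes add: "L (a + b) = L a + L b" and smult: "L (Polynomial.smult c a) = c * L a"
    and ideal: "L (p * a) = 0"
begin

lemma zero: "L 0 = 0"
  using smult[of 0 0] by simp

lemma uminus: "L (- a) = - L a"
  using smult[of "-1" a] by simp

lemma diff: "L (a - b) = L a - L b"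
  using add[of a "- b"] by (simp add: uminus)

lemma sum: "L (sum g S) = (\<Sum>i\<in>S. L (g i))"
  by (induction S rule: infinite_finite_induct) (simp_all add: add zero)

end

definition bi_fun :: "('f::field poly \<Rightarrow> 'f) \<Rightarrow> ('f poly \<Rightarrow> 'f) \<Rightarrow> 'f poly poly \<Rightarrow> 'f" where
  "bi_fun L L' h = L' (map_poly L h)"

lemma in_v_pCons: "in_v (pCons a b) = pCons [:a:] (in_v b)"
  by (simp add: in_v_def bi_const.poly_eval_pCons bi_const_def bi_v_def)

lemma coeff_in_v: "poly.coeff (in_v b) j = [:poly.coeff b j:]"
  by (induction b arbitrary: j) (simp_all add: in_v.hom_zero in_v_pCons coeff_pCons split: nat.split)

locale lin_fun2 = L: lin_fun p L + L': lin_fun p L'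
  for p :: "'f::field poly" and L L'
begin

abbreviation \<Lambda> where "\<Lambda> \<equiv> bi_fun L L'"

lemma coeff_L: "poly.coeff (map_poly L h) j = L (poly.coeff h j)"
  by (simp add: coeff_map_poly L.zero)

lemma bi_add: "\<Lambda> (g + h) = \<Lambda> g + \<Lambda> h"
proof -
  have "map_poly L (g + h) = map_poly L g + map_poly L h"
    by (rule poly_eqI) (simp add: coeff_L L.add)
  then show ?thesis by (simp add: bi_fun_def L'.add)
qed

lemma bi_const_mult: "\<Lambda> (bi_const c * h) = c * \<Lambda> h"
proof -
  have "map_poly L (bi_const c * h) = Polynomial.smult c (map_poly L h)"
    by (rule poly_eqI) (simp add: coeff_L bi_const_def L.smult)
  then show ?thesis by (simp add: bi_fun_def L'.smult)
qed

lemma bi_zero: "\<Lambda> 0 = 0"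
  using bi_const_mult[of 0 0] by simp

lemma bi_uminus: "\<Lambda> (- h) = - \<Lambda> h"
  using bi_add[of h "- h"] by (simp add: bi_zero add_eq_0_iff)

lemma bi_diff: "\<Lambda> (g - h) = \<Lambda> g - \<Lambda> h"
  using bi_add[of g "- h"] by (simp add: bi_uminus)

lemma bi_sum: "\<Lambda> (sum g S) = (\<Sum>i\<in>S. \<Lambda> (g i))"
  by (induction S rule: infinite_finite_induct) (simp_all add: bi_add bi_zero)

lemma bi_prod: "\<Lambda> (in_u a * in_v b) = L a * L' b"
proof -
  have "map_poly L (in_u a * in_v b) = Polynomial.smult (L a) b"
    by (rule poly_eqI) (simp add: coeff_L in_u_def coeff_in_v L.smult)
  then show ?thesis by (simp add: bi_fun_def L'.smult)
qed

lemma bi_in_u: "\<Lambda> (in_u a) = L a * L' 1"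
  using bi_prod[of a 1] by (simp add: in_v.hom_one)

lemma bi_in_v: "\<Lambda> (in_v b) = L 1 * L' b"
  using bi_prod[of 1 b] by (simp add: in_u.hom_one)

lemma bi_ideal: 
  assumes "h \<in> bi_ideal p"
  shows "\<Lambda> h = 0"
proof -
  obtain a b where h: "h = in_u p * a + in_v p * b" using assms unfolding bi_ideal_def by blast
  have "map_poly L (in_u p * a) = 0"
    by (rule poly_eqI) (simp add: coeff_L in_u_def L.ideal)
  then have 1: "\<Lambda> (in_u p * a) = 0" by (simp add: bi_fun_def L'.zero)
  have "map_poly L (in_v p * b) = p * map_poly L b"
    by (rule poly_eqI) (simp add: coeff_L coeff_mult coeff_in_v L.sum L.smult)
  then have 2: "\<Lambda> (in_v p * b) = 0" by (simp add: bi_fun_def L'.ideal)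
  show ?thesis by (simp add: h bi_add 1 2)
qed

end

section \<open>Divided differences of monomials\<close>

lemma sym_num_prod:
  "sym_num (in_u a * in_v b) = (in_u b - in_v b) * (bi_v * in_u a - bi_u * in_v a)"
  by (simp add: sym_num_def swap_uv.hom_simps diag_u.hom_simps diag_v.hom_simps algebra_simps)

lemma divided_diff_prod:
  assumes "(bi_u - bi_v) * g = bi_v * in_u a - bi_u * in_v a"
  shows "divided_diff (in_u a * in_v b) = (in_u b - in_v b) * g"
  by (rule divided_diff_unique) (simp only: sym_num_prod flip: assms, simp only: mult_ac)

lemma in_u_monom: "in_u (Polynomial.monom 1 m) = bi_u ^ m"
  using in_u.hom_power[of "[:0, 1:]" m] by (simp add: monom_altdef in_u_base)

lemma in_v_monom: "in_v (Polynomial.monom 1 m) = bi_v ^ m"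
  using in_v.hom_power[of "[:0, 1:]" m] by (simp add: monom_altdef in_v_base)

lemma divided_diff_one: "divided_diff (in_u 1 * in_v b) = in_v b - in_u b"
proof -
  have "divided_diff (in_u 1 * in_v b) = (in_u b - in_v b) * (- 1)"
    by (rule divided_diff_prod) (simp add: in_u.hom_one in_v.hom_one)
  then show ?thesis by simp
qed

lemma divided_diff_monom:
  fixes b :: "'f::field poly"
  assumes "m \<ge> 1"
  shows "divided_diff (in_u (Polynomial.monom 1 m) * in_v b) =
    (in_u b - in_v b) * (\<Sum>s\<in>{1..<m}. in_u (Polynomial.monom 1 s) * in_v (Polynomial.monom 1 (m - s)))"
proof (rule divided_diff_prod)
  let ?G = "\<lambda>m. \<Sum>s\<in>{1..<m}. (bi_u :: 'f poly poly) ^ s * bi_v ^ (m - s)"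
  have "(bi_u - bi_v) * ?G m = bi_v * bi_u ^ m - bi_u * bi_v ^ m" using assms
  proof (induction m rule: dec_induct)
    case (step m)
    have "?G (Suc m) = (\<Sum>s\<in>{1..<m}. bi_u ^ s * bi_v ^ (Suc m - s)) + bi_u ^ m * bi_v"
      using step by simp
    also have "(\<Sum>s\<in>{1..<m}. bi_u ^ s * bi_v ^ (Suc m - s)) = bi_v * ?G m"
      unfolding sum_distrib_left by (rule sum.cong) (auto simp: Suc_diff_le)
    finally have G: "?G (Suc m) = bi_v * ?G m + bi_u ^ m * bi_v" .
    have "(bi_u - bi_v) * ?G (Suc m) = bi_v * ((bi_u - bi_v) * ?G m) + (bi_u - bi_v) * bi_u ^ m * bi_v"
      unfolding G by (simp only: distrib_left mult_ac)
    also have "\<dots> = bi_v * bi_u ^ Suc m - bi_u * bi_v ^ Suc m"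
      unfolding step.IH by (simp add: algebra_simps)
    finally show ?case .
  qed simp
  then show "(bi_u - bi_v :: 'f poly poly) * (\<Sum>s\<in>{1..<m}. in_u (Polynomial.monom 1 s) * in_v (Polynomial.monom 1 (m - s))) =
      bi_v * in_u (Polynomial.monom 1 m) - bi_u * in_v (Polynomial.monom 1 m)"
    by (simp add: in_u_monom in_v_monom)
qed

section \<open>The minimal polynomial and its dual functionals\<close>

definition min_poly :: "nat \<Rightarrow> (nat \<Rightarrow> 'a::comm_ring_1) \<Rightarrow> 'a poly" where
  "min_poly n A = - Polynomial.monom 1 (n + 1) + (\<Sum>i\<le>n. Polynomial.monom (A i) (n - i))"

definition tilde_poly :: "nat \<Rightarrow> (nat \<Rightarrow> 'a::comm_ring_1) \<Rightarrow> 'a poly" where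
  "tilde_poly n A = Polynomial.monom 1 n - (\<Sum>i<n. Polynomial.monom (A i) (n - 1 - i))"

lemma min_poly_tilde: "min_poly n A = [:A n:] - [:0, 1:] * tilde_poly n A"
proof -
  have m: "[:0, 1:] * Polynomial.monom c k = Polynomial.monom c (Suc k)" for c :: 'a and k
    by (simp add: monom_Suc)
  have "[:0, 1:] * tilde_poly n A = Polynomial.monom 1 (Suc n) - (\<Sum>i<n. Polynomial.monom (A i) (Suc (n - 1 - i)))"
    unfolding tilde_poly_def right_diff_distrib sum_distrib_left m ..
  also have "(\<Sum>i<n. Polynomial.monom (A i) (Suc (n - 1 - i))) = (\<Sum>i<n. Polynomial.monom (A i) (n - i))"
    by (rule sum.cong) (auto simp: Suc_diff_Suc)
  finally show ?thesis
    by (simp add: min_poly_def lessThan_Suc_atMost[symmetric] monom_0)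
qed

lemma coeff_tilde_poly:
  "j < n \<Longrightarrow> poly.coeff (tilde_poly n A) j = - A (n - 1 - j)"
  "poly.coeff (tilde_poly n A) n = 1"
  "j > n \<Longrightarrow> poly.coeff (tilde_poly n A) j = 0"
proof -
  have "poly.coeff (tilde_poly n A) j = (if n = j then 1 else 0) - (\<Sum>i<n. if n - 1 - i = j then A i else 0)" for j
    by (simp add: tilde_poly_def coeff_sum)
  moreover have "(\<Sum>i<n. if n - 1 - i = j then A i else 0) = (if j < n then A (n - 1 - j) else 0)" for j
  proof -
    have "(\<Sum>i<n. if n - 1 - i = j then A i else 0) = (\<Sum>i<n. if i = n - 1 - j then (if j < n then A i else 0) else 0)"
      by (rule sum.cong) auto
    then show ?thesis by (auto simp: sum.delta)
  qed
  ultimately show "j < n \<Longrightarrow> poly.coeff (tilde_poly n A) j = - A (n - 1 - j)"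
    "poly.coeff (tilde_poly n A) n = 1" "j > n \<Longrightarrow> poly.coeff (tilde_poly n A) j = 0"
    by auto
qed

lemma degree_min_poly:
  fixes A :: "nat \<Rightarrow> 'a::idom"
  shows "degree (min_poly n A) = Suc n"
proof (rule antisym)
  have d: "degree (tilde_poly n A) \<le> n"
    using coeff_tilde_poly(3) by (intro degree_le) auto
  then show "degree (min_poly n A) \<le> Suc n"
    unfolding min_poly_tilde by (intro degree_diff_le) (auto intro: order_trans[OF degree_pCons_le])
  have "poly.coeff (min_poly n A) (Suc n) = -1"
    by (simp add: min_poly_tilde coeff_tilde_poly)
  then show "Suc n \<le> degree (min_poly n A)" by (intro le_degree) simp
qed

text \<open>The functionals on \<open>F[u] / (p)\<close> that are dual to the basis \<open>1, u, \<dots>, u\<^sup>n\<^sup>-\<^sup>1, tilde_poly\<close>, for \<open>i < n\<close>.\<close>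

definition dual_fun :: "nat \<Rightarrow> (nat \<Rightarrow> 'f::field) \<Rightarrow> nat \<Rightarrow> 'f poly \<Rightarrow> 'f" where
  "dual_fun n A i h = poly.coeff (h mod min_poly n A) i + A (n - 1 - i) * poly.coeff (h mod min_poly n A) n"

lemma lin_fun_dual: "lin_fun (min_poly n A) (dual_fun n A i)"
  by unfold_locales (simp_all add: dual_fun_def poly_mod_add_left mod_smult_left algebra_simps)

lemma dual_fun_reduced:
  assumes "degree h \<le> n"
  shows "dual_fun n A i h = poly.coeff h i + A (n - 1 - i) * poly.coeff h n"
  using assms by (simp add: dual_fun_def mod_poly_less degree_min_poly)

lemma dual_fun_monom: "j < n \<Longrightarrow> dual_fun n A i (Polynomial.monom 1 j) = (if i = j then 1 else 0)"
  using order_trans[OF degree_monom_le[of 1 j], of n] by (subst dual_fun_reduced) auto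

lemma dual_fun_one: "0 < n \<Longrightarrow> dual_fun n A i 1 = (if i = 0 then 1 else 0)"
  using dual_fun_monom[of 0 n A i] by (simp add: monom_0 one_pCons)

lemma dual_fun_tilde: "i < n \<Longrightarrow> dual_fun n A i (tilde_poly n A) = 0"
  by (subst dual_fun_reduced) (auto intro: degree_le simp: coeff_tilde_poly)

definition tilde_comb :: "nat \<Rightarrow> (nat \<Rightarrow> 'a::comm_ring_1) \<Rightarrow> (nat \<Rightarrow> 'a) \<Rightarrow> 'a poly" where
  "tilde_comb n A c = (\<Sum>i<n. Polynomial.smult (c i) (Polynomial.monom 1 i)) + Polynomial.smult (c n) (tilde_poly n A)"

lemma dual_fun_comb: 
  assumes "i < n"
  shows "dual_fun n A i (tilde_comb n A c) = c i"
proof -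
  interpret lin_fun "min_poly n A" "dual_fun n A i" by (rule lin_fun_dual)
  have "(\<Sum>j<n. c j * dual_fun n A i (Polynomial.monom 1 j)) = (\<Sum>j<n. if i = j then c j else 0)"
    by (rule sum.cong) (auto simp: dual_fun_monom)
  then show ?thesis using assms by (simp add: tilde_comb_def add sum smult dual_fun_tilde)
qed

lemma dual_fun_var_tilde:
  "0 < n \<Longrightarrow> dual_fun n A i ([:0, 1:] * tilde_poly n A * h) = A n * dual_fun n A i h"
proof -
  interpret lin_fun "min_poly n A" "dual_fun n A i" by (rule lin_fun_dual)
  have "[:0, 1:] * tilde_poly n A * h = Polynomial.smult (A n) h - min_poly n A * h"
    by (simp add: min_poly_tilde algebra_simps)
  then show ?thesis by (simp only: diff smult ideal) simp
qed

lemma bi_u_tilde: "bi_u * in_u (tilde_poly n A) = bi_const (A n) - in_u (min_poly n A)"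
  and bi_v_tilde: "bi_v * in_v (tilde_poly n A) = bi_const (A n) - in_v (min_poly n A)"
  by (simp_all only: min_poly_tilde in_u.hom_diff in_u.hom_mult in_v.hom_diff in_v.hom_mult in_u_base in_v_base)
     simp_all

text \<open>With \<open>tilde_poly\<close> read as \<open>A\<^sub>n u\<^sup>-\<^sup>1\<close>, this is \<open>(v u\<^sup>-\<^sup>1 - u v\<^sup>-\<^sup>1) / (u - v) = - (u\<^sup>-\<^sup>1 + v\<^sup>-\<^sup>1)\<close>.\<close>

lemma divided_diff_tilde:
  "divided_diff (in_u (tilde_poly n A) * in_v b) +
     (in_u b - in_v b) * (in_u (tilde_poly n A) + in_v (tilde_poly n A)) \<in> bi_ideal (min_poly n A)"
proof -
  let ?t = "tilde_poly n A" and ?p = "min_poly n A"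
  have "diag_u (in_u b - in_v b) = 0" by (simp add: diag_u.hom_simps)
  from diag_u_zero_dvd[OF this] obtain e where e: "in_u b - in_v b = (bi_u - bi_v) * e" by (rule dvdE)
  have "sym_num (in_u ?t * in_v b) = (in_u b - in_v b) *
      ((bi_u * in_u ?t - bi_v * in_v ?t) - (bi_u - bi_v) * (in_u ?t + in_v ?t))"
    unfolding sym_num_prod by (simp add: algebra_simps)
  also have "\<dots> = (in_u b - in_v b) * (in_v ?p - in_u ?p) - (bi_u - bi_v) * ((in_u b - in_v b) * (in_u ?t + in_v ?t))"
    unfolding bi_u_tilde bi_v_tilde by (simp add: algebra_simps)
  also have "(in_u b - in_v b) * (in_v ?p - in_u ?p) = (bi_u - bi_v) * (e * (in_v ?p - in_u ?p))"
    unfolding e by (simp add: mult.assoc)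
  finally have "divided_diff (in_u ?t * in_v b) = e * (in_v ?p - in_u ?p) - (in_u b - in_v b) * (in_u ?t + in_v ?t)"
    by (intro divided_diff_unique) (simp add: right_diff_distrib)
  then have "divided_diff (in_u ?t * in_v b) + (in_u b - in_v b) * (in_u ?t + in_v ?t) = in_v ?p * e - in_u ?p * e"
    by (simp add: algebra_simps)
  then show ?thesis using bi_ideal_diff[OF bi_ideal_gens(2) bi_ideal_gens(1)] by simp
qed

context lin_fun2
begin

lemma bi_diff_mult: "\<Lambda> ((in_u b - in_v b) * (in_u f * in_v g)) = L (b * f) * L' g - L f * L' (b * g)"
proof -
  have "(in_u b - in_v b) * (in_u f * in_v g) = in_u (b * f) * in_v g - in_u f * in_v (b * g)"
    by (simp add: in_u.hom_mult in_v.hom_mult algebra_simps)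
  then show ?thesis by (simp add: bi_diff bi_prod)
qed

lemma bi_dd_one: "\<Lambda> (divided_diff (in_u 1 * in_v b)) = L 1 * L' b - L b * L' 1"
  by (simp only: divided_diff_one bi_diff bi_in_u bi_in_v)

lemma bi_dd_monom:
  assumes "m \<ge> 1"
  shows "\<Lambda> (divided_diff (in_u (Polynomial.monom 1 m) * in_v b)) =
    (\<Sum>s\<in>{1..<m}. L (b * Polynomial.monom 1 s) * L' (Polynomial.monom 1 (m - s))
      - L (Polynomial.monom 1 s) * L' (b * Polynomial.monom 1 (m - s)))"
  unfolding divided_diff_monom[OF assms] sum_distrib_left bi_sum bi_diff_mult ..

lemma bi_dd_tilde:
  assumes "p = min_poly n A"
  defines "t \<equiv> tilde_poly n A"
  shows "\<Lambda> (divided_diff (in_u t * in_v b)) = L t * L' b + L 1 * L' (b * t) - L (b * t) * L' 1 - L b * L' t"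
proof -
  have "\<Lambda> (divided_diff (in_u t * in_v b) + (in_u b - in_v b) * (in_u t + in_v t)) = 0"
    unfolding t_def by (rule bi_ideal) (simp only: assms(1) divided_diff_tilde)
  moreover have e: "(in_u b - in_v b) * (in_u t + in_v t) =
      (in_u b - in_v b) * (in_u t * in_v 1) + (in_u b - in_v b) * (in_u 1 * in_v t)"
    by (simp add: in_u.hom_one in_v.hom_one algebra_simps)
  ultimately have "\<Lambda> (divided_diff (in_u t * in_v b)) +
      (L (b * t) * L' 1 - L t * L' (b * 1) + (L (b * 1) * L' t - L 1 * L' (b * t))) = 0"
    unfolding e by (simp only: bi_add bi_diff_mult)
  then show ?thesis by (simp add: algebra_simps add_eq_0_iff)
qed

lemma bi_dd_comb:
  assumes "0 < n"
  shows "\<Lambda> (divided_diff (in_u (tilde_comb n A c) * in_v b)) =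
    (\<Sum>i<n. c i * \<Lambda> (divided_diff (in_u (Polynomial.monom 1 i) * in_v b))) +
    c n * \<Lambda> (divided_diff (in_u (tilde_poly n A) * in_v b))"
proof -
  define g where "g a = \<Lambda> (divided_diff (in_u a * in_v b))" for a
  have add: "g (a + a') = g a + g a'" for a a'
    by (simp add: g_def in_u.hom_add distrib_right divided_diff_add bi_add)
  have smult: "g (Polynomial.smult c a) = c * g a" for c a
  proof -
    have "in_u (Polynomial.smult c a) * in_v b = bi_const c * (in_u a * in_v b)"
      by (simp add: in_u_def bi_const_def)
    then show ?thesis by (simp only: g_def divided_diff_const_mult bi_const_mult)
  qed
  have "g 0 = 0" using smult[of 0 0] by simp
  then have sum: "g (sum h S) = (\<Sum>i\<in>S. g (h i))" for h and S :: "nat set"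
    by (induction S rule: infinite_finite_induct) (simp_all add: add)
  have "g (tilde_comb n A c) = (\<Sum>i<n. c i * g (Polynomial.monom 1 i)) + c n * g (tilde_poly n A)"
    by (simp add: tilde_comb_def add smult sum)
  then show ?thesis by (simp add: g_def)
qed

end

section \<open>Extracting coefficients\<close>

lemma dual_fun_comb_monom:
  assumes "i < n" "c (n - 1) = 0" "1 \<le> i" "2 \<le> n"
  shows "dual_fun n A i (tilde_comb n A c * Polynomial.monom 1 1) = c (i - 1)"
proof -
  interpret lin_fun "min_poly n A" "dual_fun n A i" by (rule lin_fun_dual)
  have m: "Polynomial.monom 1 1 = [:0, 1 :: 'a:]" by (simp add: monom_Suc monom_0)
  have "tilde_comb n A c * Polynomial.monom 1 1 =
      (\<Sum>j<n. Polynomial.smult (c j) (Polynomial.monom 1 (Suc j))) + Polynomial.smult (c n) ([:0, 1:] * tilde_poly n A * 1)"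
    unfolding tilde_comb_def distrib_right sum_distrib_right
    by (simp add: mult_monom m[symmetric] smult_monom) (simp add: m mult.commute)
  then have "dual_fun n A i (tilde_comb n A c * Polynomial.monom 1 1) =
      (\<Sum>j<n. c j * dual_fun n A i (Polynomial.monom 1 (Suc j)))"
    using assms by (simp only: add sum smult dual_fun_var_tilde) (simp add: dual_fun_one)
  also have "\<dots> = (\<Sum>j<n. if j = i - 1 then c j else 0)"
  proof (rule sum.cong)
    fix j assume "j \<in> {..<n}"
    then show "c j * dual_fun n A i (Polynomial.monom 1 (Suc j)) = (if j = i - 1 then c j else 0)"
      using assms by (cases "j = n - 1") (auto simp: dual_fun_monom)
  qed simp
  finally show ?thesis using assms by auto
qed

locale extraction =
  fixes n :: nat and A \<alpha> \<beta> :: "nat \<Rightarrow> 'f::field" and k1 k2 k3 :: 'f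
  assumes n: "n \<ge> 2" "n \<noteq> 3" and A: "A n \<noteq> 0"
    and small: "\<alpha> (n - 1) = 0" "\<beta> (n - 1) = 0"
    and zero_iff: "\<And>i. i \<le> n \<Longrightarrow> \<alpha> i = 0 \<longleftrightarrow> \<beta> i = 0"
    and k: "k1 \<noteq> 0" "k2 \<noteq> 0" "k1 + k2 \<noteq> 0"
    and eqn: "bi_const k1 * divided_diff (in_u (tilde_comb n A \<alpha>) * in_v (tilde_comb n A \<beta>)) +
      bi_const k2 * (in_v (tilde_comb n A \<alpha> * tilde_comb n A \<beta>) - in_u (tilde_comb n A \<alpha> * tilde_comb n A \<beta>)) +
      bi_const k3 * (in_u (tilde_comb n A \<alpha>) * in_v (tilde_comb n A \<beta>)
        - in_u (tilde_comb n A \<beta>) * in_v (tilde_comb n A \<alpha>)) \<in> bi_ideal (min_poly n A)"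
begin

abbreviation "a \<equiv> tilde_comb n A \<alpha>"
abbreviation "b \<equiv> tilde_comb n A \<beta>"
abbreviation "t \<equiv> tilde_poly n A"
abbreviation "L \<equiv> dual_fun n A"

sublocale L: lin_fun "min_poly n A" "L i" for i
  by (rule lin_fun_dual)

sublocale LL: lin_fun2 "min_poly n A" "L i" "L j" for i j ..

lemma applied:
  assumes "i < n" "j < n"
  shows "k1 * ((\<Sum>m<n. \<alpha> m * bi_fun (L i) (L j) (divided_diff (in_u (Polynomial.monom 1 m) * in_v b))) +
    \<alpha> n * (L j (b * t) * L i 1 - L i (b * t) * L j 1)) +
    k2 * (L i 1 * L j (a * b) - L i (a * b) * L j 1) + k3 * (\<alpha> i * \<beta> j - \<beta> i * \<alpha> j) = 0"
  using LL.bi_ideal[OF eqn, of i j] n assms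
  by (simp add: LL.bi_add LL.bi_const_mult LL.bi_diff LL.bi_in_u LL.bi_in_v LL.bi_prod dual_fun_comb
      LL.bi_dd_comb LL.bi_dd_tilde[OF refl] dual_fun_tilde mult.commute)

lemma middle:
  assumes "2 \<le> i" "i \<le> n - 1"
  shows "\<alpha> i = 0"
proof (rule ccontr)
  assume "\<alpha> i \<noteq> 0"
  define N where "N = Max {i\<in>{2..n-1}. \<alpha> i \<noteq> 0}"
  have "N \<in> {i\<in>{2..n-1}. \<alpha> i \<noteq> 0}"
    unfolding N_def using \<open>\<alpha> i \<noteq> 0\<close> assms by (intro Max_in) auto
  then have N': "2 \<le> N" "N \<le> n - 1" "\<alpha> N \<noteq> 0" by auto
  then have "N \<noteq> n - 1" using small by auto
  with N' have N: "2 \<le> N" "N \<le> n - 2" "\<alpha> N \<noteq> 0" by auto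
  have above: "\<alpha> m = 0" if "N < m" "m \<le> n - 1" for m
  proof (rule ccontr)
    assume "\<alpha> m \<noteq> 0"
    then have "m \<le> N" unfolding N_def using that N by (intro Max_ge) auto
    then show False using that by simp
  qed
  define i j where "i = N + 1" and "j = N - 1"
  have ij: "i < n" "j < n" "i \<noteq> 0" "j \<noteq> 0" using N n by (auto simp: i_def j_def)
  have \<alpha>i: "\<alpha> i = 0" "\<beta> i = 0" using above[of i] zero_iff[of i] N by (auto simp: i_def)
  have one: "L i 1 = 0" "L j 1 = 0" using ij n by (auto simp: dual_fun_one)
  \<comment> \<open>The monomial \<open>u\<^sup>N\<^sup>+\<^sup>1 v\<^sup>N\<^sup>-\<^sup>1\<close> arises only as \<open>b\<^sub>N u\<^sup>N \<cdot> a\<^sub>N u v\<^sup>N\<^sup>-\<^sup>1\<close>, and no exponent is reduced modulo \<open>p\<close>.\<close>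
  have "\<alpha> m * bi_fun (L i) (L j) (divided_diff (in_u (Polynomial.monom 1 m) * in_v b)) =
      (if m = N then \<alpha> N * \<beta> N else 0)" if "m < n" for m
  proof (cases "m = 0 \<or> N < m")
    case True
    then show ?thesis
    proof
      assume "m = 0"
      then show ?thesis using LL.bi_dd_one[of i j b] one N by (simp add: monom_0 one_pCons)
    qed (use above[of m] that N in auto)
  next
    case False
    then have m: "1 \<le> m" "m \<le> N" by auto
    have "bi_fun (L i) (L j) (divided_diff (in_u (Polynomial.monom 1 m) * in_v b)) =
       (\<Sum>s\<in>{1..<m}. if s = 1 \<and> m = N then \<beta> N else 0)"
      unfolding LL.bi_dd_monom[OF m(1)]
    proof (rule sum.cong)
      fix s assume s: "s \<in> {1..<m}"
      then have "L i (Polynomial.monom 1 s) = 0" using m N by (subst dual_fun_monom) (auto simp: i_def)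
      moreover have "L j (Polynomial.monom 1 (m - s)) = (if s = 1 \<and> m = N then 1 else 0)"
        using s m N by (subst dual_fun_monom) (auto simp: j_def)
      moreover have "L i (b * Polynomial.monom 1 1) = \<beta> N"
        using dual_fun_comb_monom[of i n \<beta> A] ij small n by (simp add: i_def)
      ultimately show "L i (b * Polynomial.monom 1 s) * L j (Polynomial.monom 1 (m - s))
          - L i (Polynomial.monom 1 s) * L j (b * Polynomial.monom 1 (m - s)) =
          (if s = 1 \<and> m = N then \<beta> N else 0)" by auto
    qed simp
    also have "\<dots> = (if m = N then \<beta> N else 0)"
      using m N by (cases "m = N") (auto simp: sum.delta cong: if_cong)
    finally show ?thesis by auto
  qed
  then have "(\<Sum>m<n. \<alpha> m * bi_fun (L i) (L j) (divided_diff (in_u (Polynomial.monom 1 m) * in_v b))) =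
     (\<Sum>m<n. if m = N then \<alpha> N * \<beta> N else 0)" by (intro sum.cong) auto
  also have "\<dots> = \<alpha> N * \<beta> N" using N n by (simp add: sum.delta)
  finally have "k1 * (\<alpha> N * \<beta> N) = 0"
    using applied[OF ij(1,2)] by (simp add: one \<alpha>i)
  then show False using k N zero_iff[of N] by auto
qed

definition "lin c = (if n = 2 then 0 else c 1)" for c :: "nat \<Rightarrow> 'f"

lemma comb_eq:
  assumes "c = \<alpha> \<or> c = \<beta>"
  shows "tilde_comb n A c = Polynomial.smult (c 0) 1 + Polynomial.smult (lin c) [:0, 1:] + Polynomial.smult (c n) t"
proof -
  have z: "c i = 0" if "2 \<le> i" "i \<le> n - 1" for i
    using assms middle[OF that] zero_iff[of i] that by auto
  have s: "(\<Sum>i<n. Polynomial.smult (c i) (Polynomial.monom 1 i)) = (\<Sum>i<2. Polynomial.smult (c i) (Polynomial.monom 1 i))"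
    using n z by (intro sum.mono_neutral_right) auto
  have "c 1 = 0" if "n = 2" using assms small that by auto
  then show ?thesis
    using n unfolding tilde_comb_def s lin_def
    by (cases "n = 2") (auto simp: numeral_2_eq_2 monom_0 monom_Suc one_pCons)
qed

lemma sum_zero:
  assumes "i < n" "i \<noteq> 0" "\<beta> i = 0"
  shows "(\<Sum>m<n. \<alpha> m * bi_fun (L i) (L 0) (divided_diff (in_u (Polynomial.monom 1 m) * in_v b))) = 0"
proof (rule sum.neutral, rule ballI)
  fix m assume "m \<in> {..<n}"
  then consider "m = 0" | "m = 1" | "2 \<le> m" "m \<le> n - 1" by fastforce
  then show "\<alpha> m * bi_fun (L i) (L 0) (divided_diff (in_u (Polynomial.monom 1 m) * in_v b)) = 0"
  proof cases
    case 1
    have "bi_fun (L i) (L 0) (divided_diff (in_u (Polynomial.monom 1 0) * in_v b)) = 0"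
      using LL.bi_dd_one[of i 0 b] assms n
      by (simp add: dual_fun_one dual_fun_comb monom_0 flip: one_pCons)
    then show ?thesis using 1 by simp
  next
    case 2
    then show ?thesis using LL.bi_dd_monom[of 1 i 0 b] by simp
  qed (simp add: middle)
qed

lemma L_var:
  "i < n \<Longrightarrow> i \<noteq> 1 \<or> n = 2 \<Longrightarrow> lin c * L i [:0, 1:] = 0"
  using n dual_fun_monom[of 1 n A i] by (auto simp: lin_def monom_Suc monom_0)

lemma L_tilde_mult: "i < n \<Longrightarrow> L i (t * Polynomial.monom c (Suc k)) = A n * L i (Polynomial.monom c k)"
proof -
  have "t * Polynomial.monom c (Suc k) = [:0, 1:] * t * Polynomial.monom c k"
    by (simp add: monom_Suc)
  then show ?thesis using n by (simp only: dual_fun_var_tilde)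
qed

lemma L_tilde_tilde: "L (n - 1) (t * t) = A n"
proof -
  have n1: "n = Suc (n - 1)" using n by simp
  have "L (n - 1) (t * t) = L (n - 1) (t * Polynomial.monom 1 n) - (\<Sum>i<n. L (n - 1) (t * Polynomial.monom (A i) (n - 1 - i)))"
    by (subst (2) tilde_poly_def) (simp only: right_diff_distrib sum_distrib_left L.diff L.sum)
  also have "L (n - 1) (t * Polynomial.monom 1 n) = A n"
    using n L_tilde_mult[of "n - 1" 1 "n - 1"] n1 by (simp add: dual_fun_monom)
  also have "(\<Sum>i<n. L (n - 1) (t * Polynomial.monom (A i) (n - 1 - i))) = 0"
  proof (rule sum.neutral, rule ballI)
    fix i assume "i \<in> {..<n}"
    then consider "i = n - 1" | k where "n - 1 - i = Suc k" by (cases "n - 1 - i") auto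
    then show "L (n - 1) (t * Polynomial.monom (A i) (n - 1 - i)) = 0"
    proof cases
      case 1
      then have "t * Polynomial.monom (A i) (n - 1 - i) = Polynomial.smult (A i) t" by (simp add: monom_0)
      then show ?thesis using n by (simp only: L.smult) (simp add: dual_fun_tilde)
    next
      case 2
      have "L (n - 1) (Polynomial.monom (A i) k) = A i * L (n - 1) (Polynomial.monom 1 k)"
        by (simp add: L.smult[symmetric] smult_monom)
      also have "\<dots> = 0" using 2 n by (subst dual_fun_monom) auto
      finally show ?thesis using L_tilde_mult[of "n - 1" "A i" k] 2 n by simp
    qed
  qed
  finally show ?thesis by simp
qed

lemma L_prod:
  assumes "i < n" "\<beta> i = 0" "i \<noteq> 0" "i \<noteq> 1 \<or> n = 2"
  shows "L i (b * t) = \<beta> n * L i (t * t)"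
    and "L i (a * b) = lin \<alpha> * (lin \<beta> * L i (Polynomial.monom 1 2)) + \<alpha> n * L i (b * t)"
proof -
  have ut: "L i ([:0, 1:] * t) = 0"
    using dual_fun_var_tilde[of n A i 1] assms n by (simp add: dual_fun_one)
  have "b * t = Polynomial.smult (\<beta> 0) t + Polynomial.smult (lin \<beta>) ([:0, 1:] * t) + Polynomial.smult (\<beta> n) (t * t)"
    by (subst comb_eq) (simp_all only: simp_thms distrib_right mult_smult_left mult_1_left)
  then show "L i (b * t) = \<beta> n * L i (t * t)"
    using assms by (simp only: L.add L.smult ut) (simp add: dual_fun_tilde)
  have "[:0, 1:] * [:0, 1:] = (Polynomial.monom 1 2 :: 'f poly)"
    by (simp add: numeral_2_eq_2 monom_Suc monom_0)
  then have ub: "[:0, 1:] * b = Polynomial.smult (\<beta> 0) [:0, 1:] + Polynomial.smult (lin \<beta>) (Polynomial.monom 1 2) + Polynomial.smult (\<beta> n) ([:0, 1:] * t)"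
    by (subst comb_eq) (simp_all only: simp_thms distrib_left mult_smult_right mult_1_right)
  have "a * b = Polynomial.smult (\<alpha> 0) b + Polynomial.smult (lin \<alpha>) ([:0, 1:] * b) + Polynomial.smult (\<alpha> n) (b * t)"
    by (subst comb_eq[of \<alpha>]) (simp_all only: simp_thms distrib_right mult_smult_left mult_1_left mult.commute[of t b])
  then have "L i (a * b) = \<alpha> 0 * L i b + lin \<alpha> * (\<beta> 0 * L i [:0, 1:] + lin \<beta> * L i (Polynomial.monom 1 2) + \<beta> n * L i ([:0, 1:] * t)) + \<alpha> n * L i (b * t)"
    by (simp only: ub L.add L.smult)
  then show "L i (a * b) = lin \<alpha> * (lin \<beta> * L i (Polynomial.monom 1 2)) + \<alpha> n * L i (b * t)"
    unfolding ut using assms L_var[of i \<alpha>] by (auto simp: dual_fun_comb)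
qed

lemma last_zero: "\<alpha> n = 0"
proof -
  let ?i = "n - 1"
  have i: "?i < n" "\<beta> ?i = 0" "?i \<noteq> 0" "?i \<noteq> 1 \<or> n = 2" using n small by auto
  have z: "lin \<alpha> * (lin \<beta> * L ?i (Polynomial.monom 1 2)) = 0"
    using n dual_fun_monom[of 2 n A ?i] unfolding lin_def by (cases "n = 2") simp_all
  have "(k1 + k2) * (\<alpha> n * (\<beta> n * A n)) = 0"
    using applied[of ?i 0] n i small L_prod[OF i] sum_zero[OF i(1,3,2)]
    unfolding L_tilde_tilde z by (simp add: dual_fun_one algebra_simps add_eq_0_iff)
  then show ?thesis using k A zero_iff[of n] by auto
qed

lemma first_zero: "\<alpha> 1 = 0"
proof (cases "n = 2")
  case True
  then show ?thesis using small by simp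
next
  case False
  have z: "\<alpha> n = 0" "\<alpha> 2 = 0" "\<beta> 2 = 0" using last_zero middle[of 2] zero_iff[of 2] n False by auto
  have i: "2 < n" "\<beta> 2 = 0" "(2::nat) \<noteq> 0" "(2::nat) \<noteq> 1 \<or> n = 2" using n False z by auto
  have "k2 * (\<alpha> 1 * \<beta> 1) = 0"
    using applied[of 2 0] L_prod[OF i] sum_zero[OF i(1,3,2)] z n False i
    by (simp add: dual_fun_one dual_fun_monom lin_def)
  then show ?thesis using k zero_iff[of 1] n by auto
qed

lemma all_zero: "1 \<le> i \<Longrightarrow> i \<le> n \<Longrightarrow> \<alpha> i = 0"
  using first_zero last_zero middle[of i] by (cases "i = 1 \<or> i = n") auto

end

section \<open>Evaluating polynomials in an algebra\<close>

locale alg_point = ring B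
  for B :: "('a, 'm) ring_scheme" (structure) +
  fixes \<eta> :: "'z::comm_ring_1 \<Rightarrow> 'a" and b :: 'a
  assumes \<eta>_hom: "\<eta> \<in> ring_hom ring_of_type_algebra B" and b_closed [simp]: "b \<in> carrier B"
    and b_comm: "\<And>c. b \<otimes> \<eta> c = \<eta> c \<otimes> b"
begin

abbreviation ev where "ev f \<equiv> alg_eval B \<eta> f b"

lemma \<eta>_simps:
  shows \<eta>_closed [simp]: "\<eta> c \<in> carrier B" and \<eta>_add: "\<eta> (c + d) = \<eta> c \<oplus> \<eta> d"
    and \<eta>_mult: "\<eta> (c * d) = \<eta> c \<otimes> \<eta> d" and \<eta>_one: "\<eta> 1 = \<one>"
  using ring_hom_closed[OF \<eta>_hom, of c] ring_hom_add[OF \<eta>_hom, of c d] ring_hom_mult[OF \<eta>_hom, of c d]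
    ring_hom_one[OF \<eta>_hom] by simp_all

lemma \<eta>_zero: "\<eta> 0 = \<zero>"
  using \<eta>_add[of 0 0, symmetric] by (simp add: add.l_cancel_one')

lemma ev_superset:
  assumes "degree f \<le> N"
  shows "ev f = (\<Oplus>i\<in>{..N}. \<eta> (poly.coeff f i) \<otimes> b [^] i)"
  unfolding alg_eval_def
proof (rule add.finprod_mono_neutral_cong_left)
  fix i assume "i \<in> {..N} - {..degree f}"
  then show "\<eta> (poly.coeff f i) \<otimes> b [^] i = \<zero>" by (simp add: coeff_eq_0 \<eta>_zero)
qed (use assms in auto)

lemma ev_closed [simp]: "ev f \<in> carrier B"
  by (auto simp: alg_eval_def)

lemma ev_pCons: "ev (pCons a f) = \<eta> a \<oplus> b \<otimes> ev f"
proof -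
  let ?N = "degree f"
  have "ev (pCons a f) = (\<Oplus>i\<in>{..Suc ?N}. \<eta> (poly.coeff (pCons a f) i) \<otimes> b [^] i)"
    by (rule ev_superset) (rule degree_pCons_le)
  also have "\<dots> = (\<Oplus>i\<in>{..?N}. \<eta> (poly.coeff (pCons a f) (Suc i)) \<otimes> b [^] Suc i) \<oplus> \<eta> (poly.coeff (pCons a f) 0) \<otimes> b [^] (0::nat)"
    by (rule finsum_Suc2) auto
  also have "(\<Oplus>i\<in>{..?N}. \<eta> (poly.coeff (pCons a f) (Suc i)) \<otimes> b [^] Suc i) =
      (\<Oplus>i\<in>{..?N}. b \<otimes> (\<eta> (poly.coeff f i) \<otimes> b [^] i))"
  proof (rule finsum_cong')
    fix i
    have "\<eta> (poly.coeff f i) \<otimes> b [^] Suc i = \<eta> (poly.coeff f i) \<otimes> (b \<otimes> b [^] i)"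
      by (subst nat_pow_Suc2) simp_all
    also have "\<dots> = b \<otimes> (\<eta> (poly.coeff f i) \<otimes> b [^] i)"
      by (simp add: m_assoc[symmetric] b_comm)
    finally show "\<eta> (poly.coeff (pCons a f) (Suc i)) \<otimes> b [^] Suc i = b \<otimes> (\<eta> (poly.coeff f i) \<otimes> b [^] i)"
      by simp
  qed auto
  also have "\<dots> = b \<otimes> ev f"
    unfolding alg_eval_def by (rule finsum_rdistr[symmetric]) auto
  finally show ?thesis by (simp add: a_comm)
qed

lemma ev_zero: "ev 0 = \<zero>"
  by (simp add: alg_eval_def \<eta>_zero)

lemma ev_const: "ev [:c:] = \<eta> c"
  using ev_pCons[of c 0] by (simp add: ev_zero)

lemma ev_var: "ev [:0, 1:] = b"
  using ev_pCons[of 0 "[:1:]"] by (simp add: ev_const \<eta>_zero \<eta>_one)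

lemma ev_add: "ev (f + g) = ev f \<oplus> ev g"
proof (induction f g rule: poly_induct2)
  case 0
  then show ?case by (simp add: ev_zero)
next
  case (pCons c f d g)
  then show ?case by (simp add: ev_pCons \<eta>_add r_distr a_ac)
qed

lemma ev_smult: "ev (Polynomial.smult c f) = \<eta> c \<otimes> ev f"
proof (induction f)
  case 0
  then show ?case by (simp add: ev_zero)
next
  case (pCons d f)
  have "b \<otimes> (\<eta> c \<otimes> ev f) = \<eta> c \<otimes> (b \<otimes> ev f)"
    by (simp add: m_assoc[symmetric] b_comm)
  then show ?case by (simp add: ev_pCons pCons \<eta>_mult r_distr)
qed

lemma ev_mult: "ev (f * g) = ev f \<otimes> ev g"
proof (induction f)
  case 0
  then show ?case by (simp add: ev_zero)
next
  case (pCons c f)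
  have "ev (pCons c f * g) = \<eta> c \<otimes> ev g \<oplus> b \<otimes> (ev f \<otimes> ev g)"
    by (simp add: ev_add ev_smult ev_pCons pCons \<eta>_zero)
  then show ?case by (simp add: ev_pCons l_distr m_assoc)
qed

lemma ev_hom: "(\<lambda>f. ev f) \<in> ring_hom ring_of_type_algebra B"
  by (rule ring_hom_memI) (use ev_const[of 1] in \<open>simp_all add: ev_add ev_mult \<eta>_one flip: one_pCons\<close>)

lemma ev_image:
  assumes "ring C" "h \<in> ring_hom B C" "c \<in> ring_hom ring_of_type_algebra C" "k \<in> ring_hom ring_of_type_algebra C"
    and "\<And>a. h (\<eta> a) = k [:a:]" "h b = k [:0, 1:]"
  shows "h (ev f) = k f"
proof (induction f)
  interpret C: ring C by fact
  interpret h: ring_hom_ring B C h by (intro ring_hom_ringI' ring_axioms assms)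
  interpret k: ring_hom_ring "ring_of_type_algebra :: 'z poly ring" C k
    by (intro ring_hom_ringI' ring_ring_of_type_algebra assms)
  case 0
  then show ?case using k.hom_zero by (simp add: ev_zero)
next
  interpret C: ring C by fact
  interpret h: ring_hom_ring B C h by (intro ring_hom_ringI' ring_axioms assms)
  case (pCons a f)
  have "pCons a f = [:a:] + [:0, 1:] * f" by simp
  then have "k (pCons a f) = k [:a:] \<oplus>\<^bsub>C\<^esub> k [:0, 1:] \<otimes>\<^bsub>C\<^esub> k f"
    using ring_hom_add[OF assms(4), of "[:a:]" "[:0, 1:] * f"] ring_hom_mult[OF assms(4), of "[:0, 1:]" f] by simp
  then show ?case by (simp add: ev_pCons pCons assms(5,6))
qed

end

section \<open>Homomorphisms out of the free algebra\<close>

lemma poly_mapping_additive_induct [case_names zero single add]: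
  assumes "P 0" "\<And>w c. P (Poly_Mapping.single w c)" "\<And>f g. P f \<Longrightarrow> P g \<Longrightarrow> P (f + g)"
  shows "P (f :: 'w \<Rightarrow>\<^sub>0 'c::comm_monoid_add)"
proof -
  have "f = (\<Sum>w\<in>Poly_Mapping.keys f. Poly_Mapping.single w (poly_mapping.lookup f w))"
  proof (rule poly_mapping_eqI)
    fix v
    have "poly_mapping.lookup (\<Sum>w\<in>Poly_Mapping.keys f. Poly_Mapping.single w (poly_mapping.lookup f w)) v =
      (\<Sum>w\<in>Poly_Mapping.keys f. if w = v then poly_mapping.lookup f v else 0)"
      unfolding lookup_sum by (rule sum.cong) (auto simp: lookup_single when_def)
    also have "\<dots> = poly_mapping.lookup f v" by (auto simp: sum.delta in_keys_iff)
    finally show "poly_mapping.lookup f v = poly_mapping.lookup (\<Sum>w\<in>Poly_Mapping.keys f. Poly_Mapping.single w (poly_mapping.lookup f w)) v" ..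
  qed
  moreover have "P (\<Sum>w\<in>W. Poly_Mapping.single w (g w))" for W and g :: "'w \<Rightarrow> 'c"
    by (induction W rule: infinite_finite_induct) (auto intro: assms)
  ultimately show ?thesis by metis
qed

fun gens_eval :: "('a, 'm) ring_scheme \<Rightarrow> 'a \<Rightarrow> 'a \<Rightarrow> gen list \<Rightarrow> 'a" where
  "gens_eval T r k [] = \<one>\<^bsub>T\<^esub>"
| "gens_eval T r k (Gen_R # w) = r \<otimes>\<^bsub>T\<^esub> gens_eval T r k w"
| "gens_eval T r k (Gen_K # w) = k \<otimes>\<^bsub>T\<^esub> gens_eval T r k w"

definition free_eval :: "('a, 'm) ring_scheme \<Rightarrow> ('z::comm_ring_1 \<Rightarrow> 'a) \<Rightarrow> 'a \<Rightarrow> 'a \<Rightarrow> 'z free_alg \<Rightarrow> 'a" where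
  "free_eval T \<epsilon> r k f = (\<Oplus>\<^bsub>T\<^esub>w\<in>Poly_Mapping.keys f. \<epsilon> (poly_mapping.lookup f w) \<otimes>\<^bsub>T\<^esub> gens_eval T r k (letters w))"

locale free_point = ring T
  for T :: "('a, 'm) ring_scheme" (structure) +
  fixes \<epsilon> :: "'z::comm_ring_1 \<Rightarrow> 'a" and r k :: 'a
  assumes \<epsilon>_hom: "\<epsilon> \<in> ring_hom ring_of_type_algebra T"
    and r_closed [simp]: "r \<in> carrier T" and k_closed [simp]: "k \<in> carrier T"
    and r_comm: "\<And>c. r \<otimes> \<epsilon> c = \<epsilon> c \<otimes> r" and k_comm: "\<And>c. k \<otimes> \<epsilon> c = \<epsilon> c \<otimes> k"
begin

sublocale alg_point T \<epsilon> k
  by unfold_locales (rule \<epsilon>_hom k_closed k_comm)+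

abbreviation we where "we w \<equiv> gens_eval T r k w"
abbreviation \<Phi> where "\<Phi> \<equiv> free_eval T \<epsilon> r k"

lemma we_induct [case_names Nil R K]:
  assumes "P []" "\<And>w. P w \<Longrightarrow> P (Gen_R # w)" "\<And>w. P w \<Longrightarrow> P (Gen_K # w)"
  shows "P w"
proof (induction w)
  case (Cons g w)
  then show ?case using assms by (cases g) auto
qed (rule assms)

lemma we_closed [simp]: "we w \<in> carrier T"
  by (induction w rule: we_induct) simp_all

lemma we_append: "we (w @ w') = we w \<otimes> we w'"
  by (induction w rule: we_induct) (simp_all add: m_assoc)

lemma we_comm: "we w \<otimes> \<epsilon> c = \<epsilon> c \<otimes> we w"
proof (induction w rule: we_induct)
  case (R w)
  have "r \<otimes> we w \<otimes> \<epsilon> c = r \<otimes> \<epsilon> c \<otimes> we w" by (simp add: m_assoc R)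
  then show ?case by (simp add: r_comm m_assoc)
next
  case (K w)
  have "k \<otimes> we w \<otimes> \<epsilon> c = k \<otimes> \<epsilon> c \<otimes> we w" by (simp add: m_assoc K)
  then show ?case by (simp add: k_comm m_assoc)
qed simp

lemma \<Phi>_superset:
  assumes "finite S" "Poly_Mapping.keys f \<subseteq> S"
  shows "\<Phi> f = (\<Oplus>w\<in>S. \<epsilon> (poly_mapping.lookup f w) \<otimes> we (letters w))"
  unfolding free_eval_def
proof (rule add.finprod_mono_neutral_cong_left)
  fix w assume "w \<in> S - Poly_Mapping.keys f"
  then show "\<epsilon> (poly_mapping.lookup f w) \<otimes> we (letters w) = \<zero>" by (simp add: in_keys_iff \<eta>_zero)
qed (use assms in auto)

lemma \<Phi>_add: "\<Phi> (f + g) = \<Phi> f \<oplus> \<Phi> g"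
proof -
  let ?S = "Poly_Mapping.keys f \<union> Poly_Mapping.keys g"
  have "\<Phi> (f + g) = (\<Oplus>w\<in>?S. \<epsilon> (poly_mapping.lookup (f + g) w) \<otimes> we (letters w))"
    using keys_add[of f g] by (intro \<Phi>_superset) auto
  also have "\<dots> = (\<Oplus>w\<in>?S. \<epsilon> (poly_mapping.lookup f w) \<otimes> we (letters w) \<oplus> \<epsilon> (poly_mapping.lookup g w) \<otimes> we (letters w))"
    by (intro finsum_cong') (auto simp: lookup_add \<eta>_add l_distr)
  also have "\<dots> = \<Phi> f \<oplus> \<Phi> g"
    by (subst (1 2) \<Phi>_superset[of ?S]) (auto intro!: finsum_addf)
  finally show ?thesis .
qed

lemma \<Phi>_closed [simp]: "\<Phi> f \<in> carrier T"
  by (auto simp: free_eval_def)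

lemma \<Phi>_single: "\<Phi> (Poly_Mapping.single w c) = \<epsilon> c \<otimes> we (letters w)"
  by (subst \<Phi>_superset[of "{w}"]) auto

lemma \<Phi>_zero: "\<Phi> 0 = \<zero>"
  by (simp add: free_eval_def)

lemma \<Phi>_mult: "\<Phi> (f * g) = \<Phi> f \<otimes> \<Phi> g"
proof (induction f rule: poly_mapping_additive_induct)
  case (single w c)
  show ?case
  proof (induction g rule: poly_mapping_additive_induct)
    case (single w' c')
    have "\<epsilon> c \<otimes> we (letters w) \<otimes> (\<epsilon> c' \<otimes> we (letters w')) = \<epsilon> c \<otimes> (we (letters w) \<otimes> \<epsilon> c') \<otimes> we (letters w')"
      by (simp add: m_assoc)
    then show ?case
      by (simp add: mult_single \<Phi>_single plus_word_def we_append \<eta>_mult we_comm m_assoc)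
  qed (simp_all add: \<Phi>_zero \<Phi>_add distrib_left r_distr)
qed (simp_all add: \<Phi>_zero \<Phi>_add distrib_right l_distr)

lemma \<Phi>_base: "\<Phi> (free_scalar c) = \<epsilon> c" "\<Phi> free_R = r" "\<Phi> free_K = k"
  by (simp_all add: free_scalar_def free_R_def free_K_def \<Phi>_single zero_word_def \<eta>_one)

lemma \<Phi>_hom: "\<Phi> \<in> ring_hom ring_of_type_algebra T"
proof (rule ring_hom_memI)
  show "\<Phi> \<one>\<^bsub>ring_of_type_algebra\<^esub> = \<one>"
    using \<Phi>_base(1)[of 1] by (simp add: free_scalar_def \<eta>_one)
qed (simp_all add: \<Phi>_add \<Phi>_mult)

end

section \<open>The affine Hecke algebra and its quotients\<close>

lemma tilde_comb_pCons:
  fixes A c :: "nat \<Rightarrow> 'a::comm_ring_1"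
  assumes "n \<ge> 1"
  shows "\<exists>c' g. pCons a (tilde_comb n A c) = tilde_comb n A c' + min_poly n A * g"
proof -
  obtain m where n: "n = Suc m" using assms by (cases n) auto
  define c' where "c' j = (if j = n then c m else
    (case j of 0 \<Rightarrow> a + c n * A n | Suc i \<Rightarrow> c i) + c m * A (m - j))" for j
  have mm: "Polynomial.smult x (Polynomial.monom 1 j) = Polynomial.monom x j" for x :: 'a and j
    by (simp add: smult_monom)
  have "tilde_poly n A = Polynomial.monom 1 n - (\<Sum>i<n. Polynomial.monom (A (m - i)) i)"
  proof -
    have "(\<Sum>i<n. Polynomial.monom (A i) (n - 1 - i)) = (\<Sum>i<n. Polynomial.monom (A (m - i)) i)"
      by (rule sum.reindex_bij_witness[of _ "\<lambda>i. m - i" "\<lambda>i. m - i"]) (auto simp: n)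
    then show ?thesis by (simp add: tilde_poly_def)
  qed
  then have top: "Polynomial.monom 1 n = tilde_poly n A + (\<Sum>i<n. Polynomial.monom (A (m - i)) i)"
    by simp
  have "pCons a (tilde_comb n A c) = [:a:] + [:0, 1:] * tilde_comb n A c" by simp
  also have "[:0, 1:] * tilde_comb n A c =
      (\<Sum>i<n. Polynomial.monom (c i) (Suc i)) + Polynomial.smult (c n) ([:0, 1:] * tilde_poly n A)"
    unfolding tilde_comb_def distrib_left sum_distrib_left mm mult_smult_right by (simp add: monom_Suc)
  also have "[:0, 1:] * tilde_poly n A = [:A n:] - min_poly n A" by (simp add: min_poly_tilde)
  also have "(\<Sum>i<n. Polynomial.monom (c i) (Suc i)) = (\<Sum>i<m. Polynomial.monom (c i) (Suc i)) + Polynomial.smult (c m) (Polynomial.monom 1 n)"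
    by (simp add: n mm)
  also have "[:a:] + ((\<Sum>i<m. Polynomial.monom (c i) (Suc i)) + Polynomial.smult (c m) (Polynomial.monom 1 n) +
      Polynomial.smult (c n) ([:A n:] - min_poly n A)) =
    ([:a + c n * A n:] + (\<Sum>i<m. Polynomial.monom (c i) (Suc i)) + Polynomial.smult (c m) (\<Sum>i<n. Polynomial.monom (A (m - i)) i)) +
      Polynomial.smult (c m) (tilde_poly n A) + min_poly n A * [:- c n:]"
    unfolding top by (simp add: smult_add_right smult_diff_right algebra_simps)
  also have "[:a + c n * A n:] + (\<Sum>i<m. Polynomial.monom (c i) (Suc i)) =
      (\<Sum>i<n. Polynomial.monom (case i of 0 \<Rightarrow> a + c n * A n | Suc j \<Rightarrow> c j) i)"
    unfolding n sum.lessThan_Suc_shift by (simp add: monom_0)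
  also have "Polynomial.smult (c m) (\<Sum>i<n. Polynomial.monom (A (m - i)) i) = (\<Sum>i<n. Polynomial.monom (c m * A (m - i)) i)"
    by (induction n) (simp_all add: smult_add_right smult_monom)
  also have "(\<Sum>i<n. Polynomial.monom (case i of 0 \<Rightarrow> a + c n * A n | Suc j \<Rightarrow> c j) i) + (\<Sum>i<n. Polynomial.monom (c m * A (m - i)) i) =
      (\<Sum>i<n. Polynomial.smult (c' i) (Polynomial.monom 1 i))"
    unfolding sum.distrib[symmetric] by (rule sum.cong) (auto simp: c'_def mm add_monom)
  finally have "pCons a (tilde_comb n A c) = tilde_comb n A c' + min_poly n A * [:- c n:]"
    by (simp add: tilde_comb_def c'_def)
  then show ?thesis by blast
qed

lemma tilde_division:
  fixes A :: "nat \<Rightarrow> 'a::comm_ring_1"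
  assumes "n \<ge> 1"
  shows "\<exists>c g. f = tilde_comb n A c + min_poly n A * g"
proof (induction f)
  case 0
  have "tilde_comb n A (\<lambda>_. 0) = 0" by (simp add: tilde_comb_def)
  then have "0 = tilde_comb n A (\<lambda>_. 0) + min_poly n A * 0" by simp
  then show ?case by blast
next
  case (pCons a f)
  then obtain c g where f: "f = tilde_comb n A c + min_poly n A * g" by blast
  obtain c' g' where c': "pCons a (tilde_comb n A c) = tilde_comb n A c' + min_poly n A * g'"
    using tilde_comb_pCons[OF assms] by blast
  have "pCons a f = pCons a (tilde_comb n A c) + min_poly n A * pCons 0 g"
    unfolding f by simp
  also have "\<dots> = tilde_comb n A c' + min_poly n A * (g' + pCons 0 g)"
    unfolding c' by (simp add: algebra_simps)
  finally show ?case by blast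
qed

lemma ring_hom_compI:
  assumes "f \<in> ring_hom R S" "g \<in> ring_hom S T"
  shows "(\<lambda>x. g (f x)) \<in> ring_hom R T"
  using assms by (intro ring_hom_memI) (simp_all add: ring_hom_closed ring_hom_mult ring_hom_add ring_hom_one)

lemma ring_hom_genideal_proj:
  assumes "ring R" "G \<subseteq> carrier R"
  shows "(\<lambda>a. genideal R G +>\<^bsub>R\<^esub> a) \<in> ring_hom R (R Quot genideal R G)"
    and "ring (R Quot genideal R G)"
  using ideal.rcos_ring_hom ideal.quotient_is_ring ring.genideal_ideal[OF assms] by blast+

lemma genideal_proj_zero:
  assumes "ring R" "G \<subseteq> carrier R" "g \<in> G"
  shows "genideal R G +>\<^bsub>R\<^esub> g = \<zero>\<^bsub>R Quot genideal R G\<^esub>"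
proof -
  interpret ring R by fact
  have "g \<in> genideal R G" using genideal_self[OF assms(2)] assms(3) by blast
  then show ?thesis using a_rcos_zero[OF genideal_ideal[OF assms(2)]] by (simp add: FactRing_def)
qed

context
  fixes \<phi> :: "'k::field \<Rightarrow> 'z::comm_ring_1" and q :: 'k and p :: "'z poly"
begin

abbreviation "free_ring \<equiv> (ring_of_type_algebra :: 'z free_alg ring)"

lemma free_scalar_add: "free_scalar (a + b :: 'z) = free_scalar a + free_scalar b"
  by (simp add: free_scalar_def single_add)

lemma free_scalar_mult: "free_scalar (a * b :: 'z) = free_scalar a * free_scalar b"
  by (simp add: free_scalar_def mult_single zero_word_def plus_word_def)

lemma free_scalar_one: "free_scalar (1 :: 'z) = 1"
  by (simp add: free_scalar_def)

lemma free_scalar_comm: "free_scalar (a :: 'z) * f = f * free_scalar a"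
  by (induction f rule: poly_mapping_additive_induct)
     (simp_all add: free_scalar_def mult_single distrib_left distrib_right mult.commute)

lemma ring_hecke: "ring (hecke \<phi> q)"
  and hecke_class_hom: "hecke_class \<phi> q \<in> ring_hom free_ring (hecke \<phi> q)"
  using ring_hom_genideal_proj[OF ring_ring_of_type_algebra]
  unfolding hecke_def hecke_ideal_def hecke_class_def[abs_def] by simp_all

lemma hecke_relations:
  "hecke_class \<phi> q (free_R ^ 2 - (free_scalar (hecke_omega \<phi> q) * free_R + 1)) = \<zero>\<^bsub>hecke \<phi> q\<^esub>"
  "hecke_class \<phi> q (free_R * free_K * free_R * free_K - free_K * free_R * free_K * free_R) = \<zero>\<^bsub>hecke \<phi> q\<^esub>"
  unfolding hecke_def hecke_ideal_def hecke_class_def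
  by (rule genideal_proj_zero[OF ring_ring_of_type_algebra]; simp)+

lemma free_scalar_hom: "(free_scalar :: 'z \<Rightarrow> _) \<in> ring_hom ring_of_type_algebra free_ring"
  by (rule ring_hom_memI) (simp_all add: free_scalar_add free_scalar_mult free_scalar_one)

lemma alg_point_free_image:
  fixes T (structure) and h :: "'z free_alg \<Rightarrow> 'a"
  assumes "ring T" "h \<in> ring_hom free_ring T"
  shows "alg_point T (\<lambda>c. h (free_scalar c)) (h free_K)"
proof (intro alg_point.intro alg_point_axioms.intro assms)
  show "(\<lambda>c. h (free_scalar c)) \<in> ring_hom ring_of_type_algebra T"
    by (rule ring_hom_compI[OF free_scalar_hom assms(2)])
  show "h free_K \<in> carrier T" using ring_hom_closed[OF assms(2)] by simp
  show "h free_K \<otimes> h (free_scalar c) = h (free_scalar c) \<otimes> h free_K" for c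
    using ring_hom_mult[OF assms(2), of free_K "free_scalar c"] ring_hom_mult[OF assms(2), of "free_scalar c" free_K]
      free_scalar_comm[of c free_K] by simp
qed

lemma alg_point_hecke: "alg_point (hecke \<phi> q) (\<lambda>c. hecke_class \<phi> q (free_scalar c)) (hecke_class \<phi> q free_K)"
  by (rule alg_point_free_image[OF ring_hecke hecke_class_hom])

definition "hecke_poly = alg_eval (hecke \<phi> q) (\<lambda>c. hecke_class \<phi> q (free_scalar c)) p (hecke_class \<phi> q free_K)"

lemma hecke_poly_closed: "{hecke_poly} \<subseteq> carrier (hecke \<phi> q)"
  unfolding hecke_poly_def using alg_point.ev_closed[OF alg_point_hecke] by simp

lemma ring_hecke_p: "ring (hecke_p \<phi> q p)"
  and hecke_p_proj_hom: "(\<lambda>a. hecke_p_ideal \<phi> q p +>\<^bsub>hecke \<phi> q\<^esub> a) \<in> ring_hom (hecke \<phi> q) (hecke_p \<phi> q p)"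
  using ring_hom_genideal_proj[OF ring_hecke hecke_poly_closed]
  unfolding hecke_p_def hecke_p_ideal_def hecke_poly_def by simp_all

lemma hecke_p_class_hom: "hecke_p_class \<phi> q p \<in> ring_hom free_ring (hecke_p \<phi> q p)"
  using ring_hom_compI[OF hecke_class_hom hecke_p_proj_hom] by (simp add: hecke_p_class_def[abs_def])

lemma hecke_p_class_closed [simp]: "hecke_p_class \<phi> q p f \<in> carrier (hecke_p \<phi> q p)"
  using ring_hom_closed[OF hecke_p_class_hom] by simp

lemma alg_point_hecke_p: "alg_point (hecke_p \<phi> q p) (Hp_scalar \<phi> q p) (Hp_K \<phi> q p)"
  using alg_point_free_image[OF ring_hecke_p hecke_p_class_hom]
  by (simp add: Hp_scalar_def[abs_def] Hp_K_def)

interpretation Hp: alg_point "hecke_p \<phi> q p" "Hp_scalar \<phi> q p" "Hp_K \<phi> q p"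
  by (rule alg_point_hecke_p)

interpretation cl: ring_hom_ring free_ring "hecke_p \<phi> q p" "hecke_p_class \<phi> q p"
  by (intro ring_hom_ringI' ring_ring_of_type_algebra ring_hecke_p hecke_p_class_hom)

lemma hecke_p_min_poly: "alg_eval (hecke_p \<phi> q p) (Hp_scalar \<phi> q p) p (Hp_K \<phi> q p) = \<zero>\<^bsub>hecke_p \<phi> q p\<^esub>"
proof -
  let ?\<pi> = "\<lambda>a. hecke_p_ideal \<phi> q p +>\<^bsub>hecke \<phi> q\<^esub> a"
  have "?\<pi> hecke_poly = alg_eval (hecke_p \<phi> q p) (Hp_scalar \<phi> q p) p (Hp_K \<phi> q p)"
    unfolding hecke_poly_def
  proof (rule alg_point.ev_image[OF alg_point_hecke ring_hecke_p hecke_p_proj_hom _ Hp.ev_hom])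
    show "(\<lambda>c. Hp_scalar \<phi> q p c) \<in> ring_hom ring_of_type_algebra (hecke_p \<phi> q p)" by (rule Hp.\<eta>_hom)
  qed (simp_all only: Hp.ev_const Hp.ev_var, simp_all only: Hp_scalar_def Hp_K_def hecke_p_class_def)
  moreover have "?\<pi> hecke_poly = \<zero>\<^bsub>hecke_p \<phi> q p\<^esub>"
    using genideal_proj_zero[OF ring_hecke hecke_poly_closed, of hecke_poly]
    unfolding hecke_p_def hecke_p_ideal_def hecke_poly_def by simp
  ultimately show ?thesis by simp
qed

lemma hecke_p_class_eqI:
  assumes "hecke_class \<phi> q (f - g) = \<zero>\<^bsub>hecke \<phi> q\<^esub>"
  shows "hecke_p_class \<phi> q p f = hecke_p_class \<phi> q p g"
proof -
  interpret \<pi>: ring_hom_ring "hecke \<phi> q" "hecke_p \<phi> q p" "\<lambda>a. hecke_p_ideal \<phi> q p +>\<^bsub>hecke \<phi> q\<^esub> a"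
    by (intro ring_hom_ringI' ring_hecke ring_hecke_p hecke_p_proj_hom)
  have "hecke_p_class \<phi> q p (f - g) = \<zero>\<^bsub>hecke_p \<phi> q p\<^esub>"
    unfolding hecke_p_class_def assms by (rule \<pi>.hom_zero)
  moreover have "hecke_p_class \<phi> q p f = hecke_p_class \<phi> q p (f - g) \<oplus>\<^bsub>hecke_p \<phi> q p\<^esub> hecke_p_class \<phi> q p g"
    using cl.hom_add[of "f - g" g] by simp
  ultimately show ?thesis by simp
qed

lemma Hp_R_inverse:
  "inv\<^bsub>hecke_p \<phi> q p\<^esub> Hp_R \<phi> q p = hecke_p_class \<phi> q p (free_R - free_scalar (hecke_omega \<phi> q))"
proof (rule Hp.inv_char)
  let ?R = "free_R :: 'z free_alg" and ?w = "free_scalar (hecke_omega \<phi> q)"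
  have "?R * (?R - ?w) - 1 = ?R ^ 2 - (?w * ?R + 1)" "(?R - ?w) * ?R - 1 = ?R ^ 2 - (?w * ?R + 1)"
    by (simp_all add: left_diff_distrib right_diff_distrib power2_eq_square free_scalar_comm[of _ free_R] diff_diff_add)
  then have "hecke_p_class \<phi> q p (?R * (?R - ?w)) = hecke_p_class \<phi> q p 1"
    "hecke_p_class \<phi> q p ((?R - ?w) * ?R) = hecke_p_class \<phi> q p 1"
    by (simp_all only: hecke_p_class_eqI hecke_relations(1))
  then show "Hp_R \<phi> q p \<otimes>\<^bsub>hecke_p \<phi> q p\<^esub> hecke_p_class \<phi> q p (?R - ?w) = \<one>\<^bsub>hecke_p \<phi> q p\<^esub>"
    "hecke_p_class \<phi> q p (?R - ?w) \<otimes>\<^bsub>hecke_p \<phi> q p\<^esub> Hp_R \<phi> q p = \<one>\<^bsub>hecke_p \<phi> q p\<^esub>"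
    using cl.hom_mult[of ?R "?R - ?w"] cl.hom_mult[of "?R - ?w" ?R] cl.hom_one by (simp_all add: Hp_R_def)
qed (simp_all add: Hp_R_def)

lemma hecke_p_universal:
  fixes T (structure)
  assumes "free_point T \<epsilon> r k"
    and quadratic: "r \<otimes> r = \<epsilon> (hecke_omega \<phi> q) \<otimes> r \<oplus> \<one>"
    and braid: "r \<otimes> k \<otimes> r \<otimes> k = k \<otimes> r \<otimes> k \<otimes> r"
    and min_poly: "alg_eval T \<epsilon> p k = \<zero>"
  shows "\<exists>\<Psi> \<in> ring_hom (hecke_p \<phi> q p) T. \<forall>f. \<Psi> (hecke_p_class \<phi> q p f) = free_eval T \<epsilon> r k f"
proof -
  interpret T: free_point T \<epsilon> r k by fact
  interpret \<Phi>: ring_hom_ring free_ring T T.\<Phi>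
    by (intro ring_hom_ringI' ring_ring_of_type_algebra T.ring_axioms T.\<Phi>_hom)
  let ?G = "{free_R ^ 2 - (free_scalar (hecke_omega \<phi> q) * free_R + 1),
      free_R * free_K * free_R * free_K - free_K * free_R * free_K * free_R} :: 'z free_alg set"
  have G0: "T.\<Phi> g = \<zero>" if "g \<in> ?G" for g
  proof -
    have minus: "T.\<Phi> (f - g) = \<zero>" if "T.\<Phi> f = T.\<Phi> g" for f g
    proof -
      have "T.\<Phi> (f - g) \<oplus> T.\<Phi> g = T.\<Phi> g" using T.\<Phi>_add[of "f - g" g] that by simp
      then show ?thesis by (simp add: T.add.r_cancel_one)
    qed
    have one: "T.\<Phi> 1 = \<one>" using \<Phi>.hom_one by simp
    have m1: "T.\<Phi> (free_R ^ 2) = T.\<Phi> (free_scalar (hecke_omega \<phi> q) * free_R + 1)"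
      using quadratic by (simp add: power2_eq_square T.\<Phi>_mult T.\<Phi>_add T.\<Phi>_base one)
    have m2: "T.\<Phi> (free_R * free_K * free_R * free_K) = T.\<Phi> (free_K * free_R * free_K * free_R)"
      using braid by (simp add: T.\<Phi>_mult T.\<Phi>_base)
    show ?thesis using that by (elim insertE emptyE) (simp_all only: minus[OF m1] minus[OF m2])
  qed
  have I: "ideal (hecke_ideal \<phi> q) free_ring"
    unfolding hecke_ideal_def by (rule ring.genideal_ideal[OF ring_ring_of_type_algebra]) simp
  have "T.\<Phi> i = \<zero>" if "i \<in> hecke_ideal \<phi> q" for i
    by (rule genideal_hom_zero[OF ring_ring_of_type_algebra T.ring_axioms T.\<Phi>_hom _ _ that[unfolded hecke_ideal_def]])
       (simp, rule G0)
  note lift1 = quotient_lift[OF ring_ring_of_type_algebra T.ring_axioms T.\<Phi>_hom I this]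
  define h where "h W = the_elem (T.\<Phi> ` W)" for W
  have h: "h \<in> ring_hom (hecke \<phi> q) T" "h (hecke_class \<phi> q f) = T.\<Phi> f" for f
    using lift1(1) lift1(2)[of f] by (simp_all add: h_def[abs_def] hecke_def hecke_class_def)
  have "h hecke_poly = alg_eval T \<epsilon> p k"
    unfolding hecke_poly_def
    by (rule alg_point.ev_image[OF alg_point_hecke T.ring_axioms h(1) T.\<eta>_hom T.ev_hom])
       (simp_all only: T.ev_const T.ev_var h T.\<Phi>_base)
  then have h0: "h g = \<zero>" if "g \<in> {hecke_poly}" for g using that min_poly by simp
  have J: "ideal (hecke_p_ideal \<phi> q p) (hecke \<phi> q)"
    using ring.genideal_ideal[OF ring_hecke hecke_poly_closed] by (simp add: hecke_p_ideal_def hecke_poly_def)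
  have "h i = \<zero>" if "i \<in> hecke_p_ideal \<phi> q p" for i
    using genideal_hom_zero[OF ring_hecke T.ring_axioms h(1) hecke_poly_closed h0] that
    by (simp add: hecke_p_ideal_def hecke_poly_def)
  note lift2 = quotient_lift[OF ring_hecke T.ring_axioms h(1) J this]
  show ?thesis
  proof (rule bexI, rule allI)
    show "(\<lambda>W. the_elem (h ` W)) \<in> ring_hom (hecke_p \<phi> q p) T"
      unfolding hecke_p_def by (rule lift2(1))
    show "the_elem (h ` hecke_p_class \<phi> q p f) = T.\<Phi> f" for f
      using lift2(2)[of "hecke_class \<phi> q f"] ring_hom_closed[OF hecke_class_hom, of f]
      by (simp add: hecke_p_class_def h)
  qed
qed

section \<open>The subalgebra generated by \<open>K\<close>\<close>

abbreviation "\<kappa> f \<equiv> alg_eval (hecke_p \<phi> q p) (Hp_scalar \<phi> q p) f (Hp_K \<phi> q p)"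

lemma K_alg_gens: "range (Hp_scalar \<phi> q p) \<union> {Hp_K \<phi> q p} \<subseteq> carrier (hecke_p \<phi> q p)"
  by auto

lemma ring_K_alg: "ring (K_alg \<phi> q p)"
  unfolding K_alg_def by (rule Hp.generate_ring_is_ring[OF K_alg_gens])

lemma K_alg_simps:
  "x \<oplus>\<^bsub>K_alg \<phi> q p\<^esub> y = x \<oplus>\<^bsub>hecke_p \<phi> q p\<^esub> y" "x \<otimes>\<^bsub>K_alg \<phi> q p\<^esub> y = x \<otimes>\<^bsub>hecke_p \<phi> q p\<^esub> y"
  "\<one>\<^bsub>K_alg \<phi> q p\<^esub> = \<one>\<^bsub>hecke_p \<phi> q p\<^esub>" "\<zero>\<^bsub>K_alg \<phi> q p\<^esub> = \<zero>\<^bsub>hecke_p \<phi> q p\<^esub>"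
  by (simp_all add: K_alg_def)

lemma K_alg_carrier: "carrier (K_alg \<phi> q p) = range (\<lambda>f. \<kappa> f)"
proof
  interpret \<kappa>: ring_hom_ring "ring_of_type_algebra :: 'z poly ring" "hecke_p \<phi> q p" "\<lambda>f. \<kappa> f"
    by (intro ring_hom_ringI' ring_ring_of_type_algebra ring_hecke_p Hp.ev_hom)
  have "x \<in> range (\<lambda>f. \<kappa> f)" if "x \<in> generate_ring (hecke_p \<phi> q p) (range (Hp_scalar \<phi> q p) \<union> {Hp_K \<phi> q p})" for x
    using that
  proof induction
    case one
    show ?case by (rule range_eqI[of _ _ 1]) (use ring_hom_one[OF Hp.ev_hom] in simp)
  next
    case (incl h)
    then consider c where "h = Hp_scalar \<phi> q p c" | "h = Hp_K \<phi> q p" by blast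
    then show ?case
    proof cases
      case (1 c)
      show ?thesis unfolding 1 by (rule range_eqI[of _ _ "[:c:]"]) (simp only: Hp.ev_const)
    next
      case 2
      show ?thesis unfolding 2 by (rule range_eqI[of _ _ "[:0, 1:]"]) (simp only: Hp.ev_var)
    qed
  next
    case (a_inv h)
    then obtain f where f: "h = \<kappa> f" by blast
    show ?case unfolding f by (rule range_eqI[of _ _ "- f"]) (use \<kappa>.hom_a_inv[of f] in simp)
  next
    case (eng_add h1 h2)
    then obtain f g where fg: "h1 = \<kappa> f" "h2 = \<kappa> g" by blast
    show ?case unfolding fg by (rule range_eqI[of _ _ "f + g"]) (simp only: Hp.ev_add)
  next
    case (eng_mult h1 h2)
    then obtain f g where fg: "h1 = \<kappa> f" "h2 = \<kappa> g" by blast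
    show ?case unfolding fg by (rule range_eqI[of _ _ "f * g"]) (simp only: Hp.ev_mult)
  qed
  then show "carrier (K_alg \<phi> q p) \<subseteq> range (\<lambda>f. \<kappa> f)" by (auto simp: K_alg_def)
  interpret K: ring "K_alg \<phi> q p" by (rule ring_K_alg)
  have "\<kappa> f \<in> carrier (K_alg \<phi> q p)" for f
  proof (induction f)
    case 0
    then show ?case using K.zero_closed by (simp only: Hp.ev_zero K_alg_simps)
  next
    case (pCons a f)
    have "Hp_scalar \<phi> q p a \<in> carrier (K_alg \<phi> q p)" "Hp_K \<phi> q p \<in> carrier (K_alg \<phi> q p)"
      by (auto simp: K_alg_def intro: generate_ring.incl)
    then have "Hp_scalar \<phi> q p a \<oplus>\<^bsub>K_alg \<phi> q p\<^esub> Hp_K \<phi> q p \<otimes>\<^bsub>K_alg \<phi> q p\<^esub> \<kappa> f \<in> carrier (K_alg \<phi> q p)"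
      using pCons.IH by blast
    then show ?case by (simp only: Hp.ev_pCons K_alg_simps)
  qed
  then show "range (\<lambda>f. \<kappa> f) \<subseteq> carrier (K_alg \<phi> q p)" by blast
qed

lemma \<kappa>_power: "\<kappa> (f ^ i) = \<kappa> f [^]\<^bsub>hecke_p \<phi> q p\<^esub> i"
proof (induction i)
  case 0
  show ?case using ring_hom_one[OF Hp.ev_hom] by simp
next
  case (Suc i)
  then show ?case by (simp only: power_Suc2 Hp.ev_mult Hp.nat_pow_Suc)
qed

lemma \<kappa>_monom: "\<kappa> (Polynomial.monom c i) = Hp_scalar \<phi> q p c \<otimes>\<^bsub>hecke_p \<phi> q p\<^esub> Hp_K \<phi> q p [^]\<^bsub>hecke_p \<phi> q p\<^esub> i"
proof -
  have "Polynomial.monom c i = Polynomial.smult c ([:0, 1:] ^ i)" by (simp add: monom_altdef)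
  then show ?thesis by (simp only: Hp.ev_smult \<kappa>_power Hp.ev_var)
qed

lemma \<kappa>_monom_one: "\<kappa> (Polynomial.monom 1 i) = Hp_K \<phi> q p [^]\<^bsub>hecke_p \<phi> q p\<^esub> i"
  by (simp add: \<kappa>_monom Hp.\<eta>_one)

lemma \<kappa>_sum: "finite S \<Longrightarrow> \<kappa> (sum f S) = (\<Oplus>\<^bsub>hecke_p \<phi> q p\<^esub>i\<in>S. \<kappa> (f i))"
  by (induction S rule: finite_induct) (simp_all add: Hp.ev_zero Hp.ev_add Hp.finsum_insert)

lemma \<kappa>_diff: "\<kappa> (f - g) = \<kappa> f \<ominus>\<^bsub>hecke_p \<phi> q p\<^esub> \<kappa> g"
proof -
  have "\<kappa> f = \<kappa> (f - g) \<oplus>\<^bsub>hecke_p \<phi> q p\<^esub> \<kappa> g" by (simp flip: Hp.ev_add)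
  then show ?thesis by (simp add: a_minus_def Hp.a_assoc Hp.r_neg)
qed

lemma K_tilde_eq: "K_tilde \<phi> q p n A = \<kappa> (tilde_poly n A)"
  by (simp add: K_tilde_def tilde_poly_def \<kappa>_diff \<kappa>_sum \<kappa>_monom \<kappa>_monom_one Hp.\<eta>_one)

end

section \<open>Homomorphisms on fraction fields\<close>

locale inj_hom = comm_hom f for f :: "'a::idom \<Rightarrow> 'b::field" +
  assumes inj: "f a = 0 \<Longrightarrow> a = 0"

definition fract_lift :: "('a::idom \<Rightarrow> 'b::field) \<Rightarrow> 'a fract \<Rightarrow> 'b" where
  "fract_lift f w = (THE v. \<exists>a b. b \<noteq> 0 \<and> w = Fract a b \<and> v = f a / f b)"

context inj_hom
begin

lemma fract_lift_Fract:
  assumes "b \<noteq> 0"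
  shows "fract_lift f (Fract a b) = f a / f b"
  unfolding fract_lift_def
proof (rule the_equality)
  show "\<exists>a' b'. b' \<noteq> 0 \<and> Fract a b = Fract a' b' \<and> f a / f b = f a' / f b'" using assms by blast
next
  fix v assume "\<exists>a' b'. b' \<noteq> 0 \<and> Fract a b = Fract a' b' \<and> v = f a' / f b'"
  then obtain a' b' where *: "b' \<noteq> 0" "Fract a b = Fract a' b'" "v = f a' / f b'" by blast
  then have "a * b' = a' * b" using assms by (simp add: eq_fract)
  then have "f a * f b' = f a' * f b" by (simp flip: hom_mult)
  moreover have "f b \<noteq> 0" "f b' \<noteq> 0" using inj assms * by blast+
  ultimately show "v = f a / f b" unfolding *(3) by (simp add: frac_eq_eq)
qed

lemma fract_lift_to_fract: "fract_lift f (to_fract a) = f a"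
  by (simp add: to_fract_def fract_lift_Fract hom_one)

lemma inj_hom_fract_lift: "inj_hom (fract_lift f)"
proof
  fix v w :: "'a fract"
  obtain a b where v: "v = Fract a b" "b \<noteq> 0" by (cases v)
  obtain c d where w: "w = Fract c d" "d \<noteq> 0" by (cases w)
  have nz: "f b \<noteq> 0" "f d \<noteq> 0" using inj v w by blast+
  show "fract_lift f (v + w) = fract_lift f v + fract_lift f w"
    using v w nz by (simp add: fract_lift_Fract hom_add hom_mult add_frac_eq)
  show "fract_lift f (v * w) = fract_lift f v * fract_lift f w"
    using v w nz by (simp add: fract_lift_Fract hom_mult)
next
  show "fract_lift f 1 = 1" using fract_lift_to_fract[of 1] by (simp add: hom_one)
next
  fix v :: "'a fract" assume "fract_lift f v = 0"
  moreover obtain a b where v: "v = Fract a b" "b \<noteq> 0" by (cases v)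
  moreover have "f b \<noteq> 0" using inj[of b] v by blast
  ultimately have "f a = 0" by (simp add: fract_lift_Fract)
  then have "a = 0" by (rule inj)
  then show "v = 0" using v by (simp add: fract_collapse)
qed

end

lemma hom_inverse: 
  fixes g :: "'c::field \<Rightarrow> 'd::field"
  assumes "comm_hom g"
  shows "g (inverse a) = inverse (g a)"
proof (cases "a = 0")
  case True
  then show ?thesis using comm_hom.hom_zero[OF assms] by simp
next
  case False
  then have "g a * g (inverse a) = 1"
    using comm_hom.hom_mult[OF assms, of a "inverse a"] comm_hom.hom_one[OF assms] by simp
  then show ?thesis by (rule inverse_unique[symmetric])
qed

lemma comm_hom_map_poly:
  assumes "comm_hom f"
  shows "comm_hom (map_poly f)"
proof -
  interpret comm_hom f by fact
  have c: "poly.coeff (map_poly f a) i = f (poly.coeff a i)" for a i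
    by (simp add: coeff_map_poly hom_zero)
  show ?thesis
  proof
    show "map_poly f (a + b) = map_poly f a + map_poly f b" for a b
      by (rule poly_eqI) (simp add: c hom_add)
    show "map_poly f (a * b) = map_poly f a * map_poly f b" for a b
      by (rule poly_eqI) (simp add: c coeff_mult hom_sum hom_mult)
    show "map_poly f 1 = 1"
      by (simp add: one_pCons map_poly_pCons hom_zero hom_one)
  qed
qed

lemma map_poly_inj:
  assumes "comm_hom f" "\<And>a. f a = 0 \<Longrightarrow> a = 0" "map_poly f p = 0"
  shows "p = 0"
proof (rule poly_eqI)
  fix i
  have "f (poly.coeff p i) = poly.coeff (map_poly f p) i"
    using comm_hom.hom_zero[OF assms(1)] by (simp add: coeff_map_poly)
  then show "poly.coeff p i = poly.coeff 0 i" using assms(2,3) by simp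
qed

lemma comm_hom_to_fract: "comm_hom (to_fract :: 'a::idom \<Rightarrow> 'a fract)"
  by unfold_locales (simp_all add: to_fract_def One_fract_def)

lemma to_fract_zero: "to_fract a = 0 \<Longrightarrow> a = 0"
  by (simp add: to_fract_def Zero_fract_def eq_fract)

section \<open>Rational functions in \<open>x\<close> and \<open>y\<close>\<close>

lemma kxy_to_fract: "kxy_const c = to_fract (bi_const c)" "kxy_x = to_fract bi_u" "kxy_y = to_fract bi_v"
  by (simp_all add: kxy_const_def kxy_x_def kxy_y_def bi_const_def bi_u_def bi_v_def)

lemma comm_hom_to_fract_bi_const: "comm_hom (\<lambda>c. to_fract (bi_const (c::'a::idom)))"
  by (rule comm_hom_compose[OF comm_hom_to_fract bi_const.comm_hom_axioms])

lemma poly_eval_bi: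
  "poly_eval (\<lambda>c. to_fract (bi_const c)) (to_fract bi_u) a = to_fract (in_u (a :: 'a::idom poly))"
  "poly_eval (\<lambda>c. to_fract (bi_const c)) (to_fract bi_v) a = to_fract (in_v (a :: 'a::idom poly))"
proof -
  interpret c: comm_hom "\<lambda>c. to_fract (bi_const (c :: 'a))" by (rule comm_hom_to_fract_bi_const)
  show "poly_eval (\<lambda>c. to_fract (bi_const c)) (to_fract bi_u) a = to_fract (in_u a)"
    by (rule uni_hom_eqI[OF c.comm_hom_poly_eval comm_hom_compose[OF comm_hom_to_fract in_u.comm_hom_axioms]])
       (simp_all only: c.poly_eval_const c.poly_eval_var in_u_base)
  show "poly_eval (\<lambda>c. to_fract (bi_const c)) (to_fract bi_v) a = to_fract (in_v a)"
    by (rule uni_hom_eqI[OF c.comm_hom_poly_eval comm_hom_compose[OF comm_hom_to_fract in_v.comm_hom_axioms]])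
       (simp_all only: c.poly_eval_const c.poly_eval_var in_v_base)
qed

lemma in_u_zero: "in_u a = 0 \<Longrightarrow> a = 0"
  by (simp add: in_u_def)

lemma in_v_zero: "in_v a = 0 \<Longrightarrow> a = 0"
  by (metis coeff_in_v coeff_0 pCons_eq_0_iff poly_eqI)

definition kx_point :: "'k::field poly poly fract \<Rightarrow> bool" where
  "kx_point t \<longleftrightarrow> t = kxy_x \<or> t = kxy_y"

lemma rat_at_fract_lift: "rat_at t = fract_lift (poly_eval kxy_const t)"
  by (intro ext) (simp add: rat_at_def fract_lift_def poly_eval_def)

lemma inj_hom_at_point:
  assumes "kx_point t"
  shows "inj_hom (poly_eval kxy_const (t :: 'k::field poly poly fract))"
proof -
  have c: "(kxy_const :: 'k \<Rightarrow> _) = (\<lambda>c. to_fract (bi_const c))" by (rule ext) (rule kxy_to_fract(1))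
  interpret c: comm_hom "kxy_const :: 'k \<Rightarrow> _" unfolding c by (rule comm_hom_to_fract_bi_const)
  interpret comm_hom "poly_eval kxy_const t" by (rule c.comm_hom_poly_eval)
  show ?thesis
  proof
    fix a assume "poly_eval kxy_const t a = 0"
    then have "to_fract (in_u a) = 0 \<or> to_fract (in_v a) = 0"
      using assms by (auto simp: kx_point_def c kxy_to_fract(2,3) poly_eval_bi)
    then show "a = 0" using to_fract_zero in_u_zero in_v_zero by blast
  qed
qed

context
  fixes \<phi> :: "'k::field \<Rightarrow> 'z::idom"
  assumes \<phi>: "\<phi> \<in> ring_hom ring_of_type_algebra ring_of_type_algebra"
begin

lemma comm_hom_\<phi>: "comm_hom \<phi>"
  using ring_hom_add[OF \<phi>] ring_hom_mult[OF \<phi>] ring_hom_one[OF \<phi>] by unfold_locales simp_all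

interpretation \<phi>: comm_hom \<phi> by (rule comm_hom_\<phi>)

lemma \<phi>_inj: "\<phi> a = 0 \<Longrightarrow> a = 0"
proof (rule ccontr)
  assume a: "\<phi> a = 0" "a \<noteq> 0"
  have "\<phi> (a * inverse a) = 0" unfolding \<phi>.hom_mult a(1) by simp
  then show False using a(2) \<phi>.hom_one by simp
qed

text \<open>\<open>k(x, y) \<rightarrow> Frac(\<zz>[x, y])\<close>\<close>

definition base_change :: "'k poly poly fract \<Rightarrow> 'z poly poly fract" where
  "base_change = fract_lift (\<lambda>h. to_fract (map_poly (map_poly \<phi>) h))"

lemma inj_hom_to_fract_map: "inj_hom (\<lambda>h. to_fract (map_poly (map_poly \<phi>) h))"
proof -
  interpret comm_hom "\<lambda>h. to_fract (map_poly (map_poly \<phi>) h)"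
    by (rule comm_hom_compose[OF comm_hom_to_fract comm_hom_map_poly[OF comm_hom_map_poly[OF comm_hom_\<phi>]]])
  show ?thesis
  proof
    fix h assume "to_fract (map_poly (map_poly \<phi>) h) = 0"
    then have "map_poly (map_poly \<phi>) h = 0" by (rule to_fract_zero)
    then show "h = 0"
      by (rule map_poly_inj[OF comm_hom_map_poly[OF comm_hom_\<phi>], rotated])
         (rule map_poly_inj[OF comm_hom_\<phi>], rule \<phi>_inj)
  qed
qed

interpretation bc0: inj_hom "\<lambda>h. to_fract (map_poly (map_poly \<phi>) h)"
  by (rule inj_hom_to_fract_map)

lemma inj_hom_base_change: "inj_hom base_change"
  unfolding base_change_def by (rule bc0.inj_hom_fract_lift)

interpretation bc: inj_hom base_change by (rule inj_hom_base_change)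

definition z_const :: "'z \<Rightarrow> 'z poly poly fract" where "z_const c = to_fract (bi_const c)"

lemma z_const_eta: "z_const = (\<lambda>c. to_fract (bi_const c))"
  by (rule ext) (rule z_const_def)

interpretation zc: comm_hom z_const
  unfolding z_const_eta by (rule comm_hom_to_fract_bi_const)

lemma base_change_base:
  "base_change (kxy_const c) = z_const (\<phi> c)" "base_change kxy_x = to_fract bi_u" "base_change kxy_y = to_fract bi_v"
  unfolding base_change_def kxy_to_fract bc0.fract_lift_to_fract z_const_def
  by (simp_all add: bi_const_def bi_u_def bi_v_def map_poly_pCons \<phi>.hom_zero \<phi>.hom_one)

definition eval_fun :: "'k poly poly fract \<Rightarrow> 'k poly fract \<Rightarrow> 'z poly poly fract" where
  "eval_fun t r = base_change (rat_at t r)"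

lemma comm_hom_eval_fun:
  assumes "kx_point t"
  shows "comm_hom (eval_fun t)"
proof -
  interpret inj_hom "poly_eval kxy_const t" by (rule inj_hom_at_point[OF assms])
  have "comm_hom (rat_at t)"
    unfolding rat_at_fract_lift using inj_hom_fract_lift by (simp add: inj_hom_def)
  from comm_hom_compose[OF bc.comm_hom_axioms this] show ?thesis
    unfolding eval_fun_def[abs_def] .
qed

lemma rat_at_base:
  fixes t :: "'k poly poly fract"
  assumes "kx_point t"
  shows "rat_at t (kx_const c) = kxy_const c" "rat_at t (to_fract [:0, 1:]) = t"
proof -
  interpret inj_hom "poly_eval kxy_const t" by (rule inj_hom_at_point[OF assms])
  have k: "(kxy_const :: 'k \<Rightarrow> _) = (\<lambda>c. to_fract (bi_const c))" by (rule ext) (rule kxy_to_fract(1))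
  interpret c: comm_hom "kxy_const :: 'k \<Rightarrow> _" unfolding k by (rule comm_hom_to_fract_bi_const)
  show "rat_at t (kx_const c) = kxy_const c" "rat_at t (to_fract [:0, 1:]) = t"
    unfolding rat_at_fract_lift kx_const_def fract_lift_to_fract
    by (rule c.poly_eval_const, rule c.poly_eval_var)
qed

lemma eval_fun_base:
  assumes "kx_point t"
  shows "eval_fun t (kx_const c) = z_const (\<phi> c)" "eval_fun t (to_fract [:0, 1:]) = base_change t"
  by (simp_all only: eval_fun_def rat_at_base[OF assms] base_change_base)

section \<open>Evaluating elements of \<open>\<zz>(x)\<close>\<close>

interpretation zx: tensor_alg \<phi> "ring_of_type_algebra :: 'z ring" kx_const "ring_of_type_algebra :: 'k poly fract ring"
  by (intro tensor_alg.intro ring_ring_of_type_algebra) simp_all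

abbreviation zx_elt :: "'z \<Rightarrow> 'k poly fract \<Rightarrow> _" where
  "zx_elt \<equiv> tensor_elt \<phi> (ring_of_type_algebra :: 'z ring) kx_const (ring_of_type_algebra :: 'k poly fract ring)"

lemma z_x_tensor: "z_x \<phi> = tensor_ring \<phi> ring_of_type_algebra kx_const ring_of_type_algebra"
  by (simp add: z_x_def ext_x_def)

definition z_eval :: "'k poly poly fract \<Rightarrow> ('z \<times> 'k poly fract \<Rightarrow>\<^sub>0 int) set \<Rightarrow> 'z poly poly fract" where
  "z_eval t = tensor_lift ring_of_type_algebra (\<lambda>a r. z_const a * eval_fun t r)"

lemma z_eval_map:
  assumes "kx_point t"
  shows "tensor_map \<phi> (ring_of_type_algebra :: 'z ring) kx_const (ring_of_type_algebra :: 'k poly fract ring)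
    ring_of_type_algebra (\<lambda>a r. z_const a * eval_fun t r)"
proof -
  interpret e: comm_hom "eval_fun t" by (rule comm_hom_eval_fun[OF assms])
  show ?thesis
    by (intro tensor_map.intro tensor_map_axioms.intro zx.tensor_alg_axioms ring_ring_of_type_algebra)
       (simp_all add: e.hom_add e.hom_mult e.hom_one zc.hom_add zc.hom_mult zc.hom_one
          eval_fun_base[OF assms] algebra_simps)
qed

lemma z_eval_hom:
  assumes "kx_point t"
  shows "z_eval t \<in> ring_hom (z_x \<phi>) ring_of_type_algebra"
  unfolding z_eval_def z_x_tensor by (rule tensor_map.lift_hom[OF z_eval_map[OF assms]])

lemma z_eval_elt:
  assumes "kx_point t"
  shows "z_eval t (zx_elt a r) = z_const a * eval_fun t r"
  unfolding z_eval_def by (rule tensor_map.lift_elt[OF z_eval_map[OF assms]]) simp_all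

lemma zx_point: "alg_point zx.T (\<lambda>c. zx_elt c 1) (zx_elt 1 (to_fract [:0, 1:]))"
proof (intro alg_point.intro alg_point_axioms.intro zx.T.ring_axioms)
  show "(\<lambda>c. zx_elt c 1) \<in> ring_hom ring_of_type_algebra zx.T"
  proof (rule ring_hom_memI)
    show "zx_elt (x \<otimes>\<^bsub>ring_of_type_algebra\<^esub> y) 1 = zx_elt x 1 \<otimes>\<^bsub>zx.T\<^esub> zx_elt y 1" for x y :: 'z
      by (simp add: zx.elt_mult)
    show "zx_elt (x \<oplus>\<^bsub>ring_of_type_algebra\<^esub> y) 1 = zx_elt x 1 \<oplus>\<^bsub>zx.T\<^esub> zx_elt y 1" for x y :: 'z
      by (rule zx.elt_add_left) simp_all
    show "zx_elt \<one>\<^bsub>ring_of_type_algebra\<^esub> 1 = \<one>\<^bsub>zx.T\<^esub>" using zx.elt_one by simp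
  qed (simp add: zx.elt_closed)
  show "zx_elt 1 (to_fract [:0, 1:]) \<otimes>\<^bsub>zx.T\<^esub> zx_elt c 1 = zx_elt c 1 \<otimes>\<^bsub>zx.T\<^esub> zx_elt 1 (to_fract [:0, 1:])" for c
    by (simp add: zx.elt_mult)
qed (simp add: zx.elt_closed)

interpretation zp: alg_point zx.T "\<lambda>c. zx_elt c 1" "zx_elt 1 (to_fract [:0, 1:])"
  by (rule zx_point)

lemma zx_poly: "zx_elt 1 (to_fract D) = zp.ev (map_poly \<phi> D)"
proof (induction D)
  case 0
  have "to_fract (0 :: 'k poly) = 0" by (simp add: to_fract_def Zero_fract_def)
  then show ?case using zx.elt_zero_right[of 1] by (simp add: zp.ev_zero)
next
  case (pCons d D)
  have "to_fract (pCons d D) = kx_const d * 1 + to_fract [:0, 1:] * to_fract D"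
    by (simp add: kx_const_def to_fract_def)
  then have "zx_elt 1 (to_fract (pCons d D)) = zx_elt 1 (kx_const d * 1) \<oplus>\<^bsub>zx.T\<^esub> zx_elt 1 (to_fract [:0, 1:] * to_fract D)"
    using zx.elt_add_right[of 1 "kx_const d * 1" "to_fract [:0, 1:] * to_fract D"] by simp
  also have "zx_elt 1 (kx_const d * 1) = zx_elt (\<phi> d) 1" using zx.elt_balanced[of 1 1 d] by simp
  also have "zx_elt 1 (to_fract [:0, 1:] * to_fract D) = zx_elt 1 (to_fract [:0, 1:]) \<otimes>\<^bsub>zx.T\<^esub> zx_elt 1 (to_fract D)"
    by (simp add: zx.elt_mult)
  also have "zx_elt (\<phi> d) 1 \<oplus>\<^bsub>zx.T\<^esub> (zx_elt 1 (to_fract [:0, 1:]) \<otimes>\<^bsub>zx.T\<^esub> zx_elt 1 (to_fract D)) = zp.ev (map_poly \<phi> (pCons d D))"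
    unfolding pCons.IH by (simp add: map_poly_pCons \<phi>.hom_zero zp.ev_pCons)
  finally show ?case .
qed

text \<open>Clearing denominators reduces the injectivity of \<open>\<zz>(x) \<rightarrow> Frac(\<zz>[x, y])\<close> to polynomials.\<close>

lemma zx_common_denominator:
  assumes "c \<in> carrier zx.T"
  shows "\<exists>D f. D \<noteq> 0 \<and> zx_elt 1 (to_fract D) \<otimes>\<^bsub>zx.T\<^esub> c = zp.ev f"
  using assms
proof (induction rule: zx.tensor_induct)
  case zero
  have z0: "zx_elt 1 (to_fract 1) \<otimes>\<^bsub>zx.T\<^esub> \<zero>\<^bsub>zx.T\<^esub> = zp.ev 0" by (simp add: zp.ev_zero zx.elt_closed)
  show ?case by (rule exI[of _ 1], rule exI[of _ 0], rule conjI[OF _ z0]) simp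
next
  case (elt a b)
  obtain N D where b: "b = Fract N D" "D \<noteq> 0" by (cases b)
  have "to_fract D * b = to_fract N" using b by (simp add: to_fract_def eq_fract)
  then have "zx_elt 1 (to_fract D) \<otimes>\<^bsub>zx.T\<^esub> zx_elt a b = zx_elt a 1 \<otimes>\<^bsub>zx.T\<^esub> zx_elt 1 (to_fract N)"
    by (simp add: zx.elt_mult)
  also have "\<dots> = zp.ev (Polynomial.smult a (map_poly \<phi> N))" by (simp only: zp.ev_smult flip: zx_poly)
  finally have e0: "zx_elt 1 (to_fract D) \<otimes>\<^bsub>zx.T\<^esub> zx_elt a b = zp.ev (Polynomial.smult a (map_poly \<phi> N))" .
  show ?case by (rule exI, rule exI, rule conjI, rule b(2), rule e0)
next
  case (diff c c')
  from diff(3) obtain D f where D1: "D \<noteq> 0" "zx_elt 1 (to_fract D) \<otimes>\<^bsub>zx.T\<^esub> c = zp.ev f"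
    by (elim exE conjE)
  from diff(4) obtain D' f' where D2: "D' \<noteq> 0" "zx_elt 1 (to_fract D') \<otimes>\<^bsub>zx.T\<^esub> c' = zp.ev f'"
    by (elim exE conjE)
  note D = D1 D2
  let ?e = "\<lambda>D. zx_elt 1 (to_fract D)"
  have e [simp]: "?e D \<in> carrier zx.T" for D by (simp add: zx.elt_closed)
  have em: "?e (D * D') = ?e D \<otimes>\<^bsub>zx.T\<^esub> ?e D'" for D D'
    by (simp add: zx.elt_mult to_fract_def)
  have "?e (D * D') \<otimes>\<^bsub>zx.T\<^esub> (c \<ominus>\<^bsub>zx.T\<^esub> c') = ?e (D' * D) \<otimes>\<^bsub>zx.T\<^esub> c \<ominus>\<^bsub>zx.T\<^esub> ?e (D * D') \<otimes>\<^bsub>zx.T\<^esub> c'"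
    using diff by (simp add: a_minus_def zx.T.r_distr zx.T.r_minus mult.commute)
  also have "\<dots> = ?e D' \<otimes>\<^bsub>zx.T\<^esub> zp.ev f \<ominus>\<^bsub>zx.T\<^esub> ?e D \<otimes>\<^bsub>zx.T\<^esub> zp.ev f'"
    unfolding em using diff by (simp only: zx.T.m_assoc e D)
  also have "\<dots> = zp.ev (map_poly \<phi> D' * f) \<ominus>\<^bsub>zx.T\<^esub> zp.ev (map_poly \<phi> D * f')"
    by (simp only: zp.ev_mult flip: zx_poly)
  also have "\<dots> = zp.ev (map_poly \<phi> D' * f - map_poly \<phi> D * f')"
  proof -
    have "zp.ev (f - g) \<oplus>\<^bsub>zx.T\<^esub> zp.ev g = zp.ev f" for f g by (simp flip: zp.ev_add)
    then have "zp.ev (map_poly \<phi> D' * f) = zp.ev (map_poly \<phi> D' * f - map_poly \<phi> D * f') \<oplus>\<^bsub>zx.T\<^esub> zp.ev (map_poly \<phi> D * f')"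
      by (rule sym)
    then show ?thesis
      by (simp only: a_minus_def zx.T.a_assoc zx.T.r_neg zp.ev_closed zx.T.a_inv_closed zx.T.r_zero)
  qed
  finally have "?e (D * D') \<otimes>\<^bsub>zx.T\<^esub> (c \<ominus>\<^bsub>zx.T\<^esub> c') = zp.ev (map_poly \<phi> D' * f - map_poly \<phi> D * f')" .
  note e0 = this
  have nz: "D * D' \<noteq> 0" using D by simp
  show ?case by (rule exI, rule exI, rule conjI, rule nz, rule e0)
qed

lemma z_eval_inj:
  assumes t: "kx_point t" and c: "c \<in> carrier (z_x \<phi>)" and 0: "z_eval t c = 0"
  shows "c = \<zero>\<^bsub>z_x \<phi>\<^esub>"
proof -
  interpret z: ring_hom_ring zx.T "ring_of_type_algebra :: 'z poly poly fract ring" "z_eval t"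
    using z_eval_hom[OF t] unfolding z_x_tensor
    by (intro ring_hom_ringI' zx.T.ring_axioms ring_ring_of_type_algebra)
  have c': "c \<in> carrier zx.T" using c by (simp add: z_x_tensor)
  obtain D f where D: "D \<noteq> 0" "zx_elt 1 (to_fract D) \<otimes>\<^bsub>zx.T\<^esub> c = zp.ev f"
    using zx_common_denominator[OF c'] by blast
  interpret e: comm_hom "eval_fun t" by (rule comm_hom_eval_fun[OF t])
  interpret pe: comm_hom "poly_eval z_const (base_change t)" by (rule zc.comm_hom_poly_eval)
  have pe: "poly_eval z_const (base_change t) \<in> ring_hom ring_of_type_algebra ring_of_type_algebra"
    by (rule ring_hom_memI) (simp_all add: pe.hom_add pe.hom_mult pe.hom_one)
  have zc: "z_const \<in> ring_hom ring_of_type_algebra ring_of_type_algebra"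
    by (rule ring_hom_memI) (simp_all add: zc.hom_add zc.hom_mult zc.hom_one)
  have "z_eval t (zp.ev f) = poly_eval z_const (base_change t) f"
  proof (rule zp.ev_image[OF ring_ring_of_type_algebra _ zc pe])
    show "z_eval t \<in> ring_hom zx.T ring_of_type_algebra" using z_eval_hom[OF t] by (simp add: z_x_tensor)
  qed (simp_all add: z_eval_elt[OF t] eval_fun_base[OF t] zc.poly_eval_const zc.poly_eval_var zc.hom_one e.hom_one)
  moreover have "z_eval t (zp.ev f) = 0"
    using z.hom_mult[OF _ c', of "zx_elt 1 (to_fract D)"] D 0 by (simp add: zx.elt_closed)
  ultimately have "poly_eval z_const (base_change t) f = 0" by simp
  then have "to_fract (in_u f) = 0 \<or> to_fract (in_v f) = 0"
    using t by (auto simp: kx_point_def base_change_base z_const_eta poly_eval_bi)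
  then have "f = 0" using to_fract_zero in_u_zero in_v_zero by blast
  then have eq: "zx_elt 1 (to_fract D) \<otimes>\<^bsub>zx.T\<^esub> c = \<zero>\<^bsub>zx.T\<^esub>" using D by (simp add: zp.ev_zero)
  have "inverse (to_fract D) * to_fract D = 1" using D to_fract_zero by fastforce
  then have "zx_elt 1 (inverse (to_fract D)) \<otimes>\<^bsub>zx.T\<^esub> zx_elt 1 (to_fract D) = \<one>\<^bsub>zx.T\<^esub>"
    using zx.elt_one by (simp add: zx.elt_mult)
  then have "c = zx_elt 1 (inverse (to_fract D)) \<otimes>\<^bsub>zx.T\<^esub> (zx_elt 1 (to_fract D) \<otimes>\<^bsub>zx.T\<^esub> c)"
    using c' by (subst zx.T.m_assoc[symmetric]) (simp_all add: zx.elt_closed)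
  then have "c = \<zero>\<^bsub>zx.T\<^esub>" unfolding eq by (simp add: zx.elt_closed)
  then show ?thesis by (simp add: z_x_tensor)
qed

end

section \<open>Operators on bivariate polynomials modulo an ideal\<close>

definition op_ring :: "'f::field poly \<Rightarrow> ('f poly poly \<Rightarrow> 'f poly poly) ring" where
  "op_ring p = \<lparr>carrier = {T. (\<forall>g h. T (g + h) = T g + T h) \<and>
      (\<forall>c h. T (bi_const c * h) = bi_const c * T h) \<and> (\<forall>h\<in>bi_ideal p. T h \<in> bi_ideal p)},
    monoid.mult = (\<lambda>S T h. S (T h)), one = (\<lambda>h. h), ring.zero = (\<lambda>h. 0), add = (\<lambda>S T h. S h + T h)\<rparr>"

lemma op_ring_simps [simp]:
  "S \<otimes>\<^bsub>op_ring p\<^esub> T = (\<lambda>h. S (T h))" "\<one>\<^bsub>op_ring p\<^esub> = (\<lambda>h. h)"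
  "\<zero>\<^bsub>op_ring p\<^esub> = (\<lambda>h. 0)" "S \<oplus>\<^bsub>op_ring p\<^esub> T = (\<lambda>h. S h + T h)"
  by (simp_all add: op_ring_def)

lemma op_ring_carrierI:
  assumes "\<And>g h. T (g + h) = T g + T h" "\<And>c h. T (bi_const c * h) = bi_const c * T h"
    and "\<And>h. h \<in> bi_ideal p \<Longrightarrow> T h \<in> bi_ideal p"
  shows "T \<in> carrier (op_ring p)"
  using assms by (simp add: op_ring_def)

lemma op_ring_carrierD:
  assumes "T \<in> carrier (op_ring p)"
  shows "T (g + h) = T g + T h" "T (bi_const c * h) = bi_const c * T h"
    and "h \<in> bi_ideal p \<Longrightarrow> T h \<in> bi_ideal p" "T 0 = 0"
proof -
  show "T (g + h) = T g + T h" "T (bi_const c * h) = bi_const c * T h"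
    "h \<in> bi_ideal p \<Longrightarrow> T h \<in> bi_ideal p"
    using assms by (simp_all add: op_ring_def)
  have "\<forall>g h. T (g + h) = T g + T h" using assms by (simp add: op_ring_def)
  then have "T (0 + 0) = T 0 + T 0" by blast
  then have "T 0 + T 0 = T 0" by (simp only: add_0_left)
  then show "T 0 = 0" by (simp only: add_cancel_left_right)
qed

lemma ring_op_ring: "ring (op_ring p)"
proof (rule ringI)
  show "abelian_group (op_ring p)"
  proof (rule abelian_groupI)
    fix T assume T: "T \<in> carrier (op_ring p)"
    have "(\<lambda>h. - T h) \<in> carrier (op_ring p)"
      by (rule op_ring_carrierI) (simp_all add: op_ring_carrierD[OF T] bi_ideal_uminus)
    then show "\<exists>S\<in>carrier (op_ring p). S \<oplus>\<^bsub>op_ring p\<^esub> T = \<zero>\<^bsub>op_ring p\<^esub>"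
      by (rule bexI[rotated]) simp
  next
    fix S T assume ST: "S \<in> carrier (op_ring p)" "T \<in> carrier (op_ring p)"
    have "(\<lambda>h. S h + T h) \<in> carrier (op_ring p)"
      by (rule op_ring_carrierI)
         (simp_all add: op_ring_carrierD[OF ST(1)] op_ring_carrierD[OF ST(2)] bi_ideal_add distrib_left add_ac)
    then show "S \<oplus>\<^bsub>op_ring p\<^esub> T \<in> carrier (op_ring p)" by simp
  next
    have "(\<lambda>h. 0) \<in> carrier (op_ring p)"
      by (rule op_ring_carrierI) (simp_all add: bi_ideal_zero)
    then show "\<zero>\<^bsub>op_ring p\<^esub> \<in> carrier (op_ring p)" by simp
  qed (simp_all add: add_ac)
  show "monoid (op_ring p)"
  proof (rule monoidI)
    fix S T assume ST: "S \<in> carrier (op_ring p)" "T \<in> carrier (op_ring p)"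
    have "(\<lambda>h. S (T h)) \<in> carrier (op_ring p)"
      by (rule op_ring_carrierI) (simp_all add: op_ring_carrierD[OF ST(1)] op_ring_carrierD[OF ST(2)])
    then show "S \<otimes>\<^bsub>op_ring p\<^esub> T \<in> carrier (op_ring p)" by simp
  next
    have "(\<lambda>h. h) \<in> carrier (op_ring p)" by (rule op_ring_carrierI) simp_all
    then show "\<one>\<^bsub>op_ring p\<^esub> \<in> carrier (op_ring p)" by simp
  qed simp_all
qed (simp_all add: op_ring_carrierD)

definition op_null :: "'f::field poly \<Rightarrow> ('f poly poly \<Rightarrow> 'f poly poly) set" where
  "op_null p = {T \<in> carrier (op_ring p). \<forall>h. T h \<in> bi_ideal p}"

lemma ideal_op_null: "ideal (op_null p) (op_ring p)"
proof (rule idealI[OF ring_op_ring])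
  interpret S: ring "op_ring p" by (rule ring_op_ring)
  show "subgroup (op_null p) (add_monoid (op_ring p))"
  proof (rule S.add.subgroupI)
    show "op_null p \<subseteq> carrier (op_ring p)" by (auto simp: op_null_def)
    show "op_null p \<noteq> {}"
      using S.zero_closed bi_ideal_zero[of p] by (auto simp: op_null_def intro!: exI[of _ "\<lambda>_. 0"])
  next
    fix T assume T: "T \<in> op_null p"
    then have Tc: "T \<in> carrier (op_ring p)" by (simp add: op_null_def)
    have c: "(\<lambda>h. - T h) \<in> carrier (op_ring p)"
      by (rule op_ring_carrierI) (simp_all add: op_ring_carrierD[OF Tc] bi_ideal_uminus)
    then have "\<ominus>\<^bsub>op_ring p\<^esub> T = (\<lambda>h. - T h)"
      using Tc by (intro S.minus_equality) simp_all
    then show "\<ominus>\<^bsub>op_ring p\<^esub> T \<in> op_null p"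
      using T c by (simp add: op_null_def bi_ideal_uminus)
  next
    fix S T assume "S \<in> op_null p" "T \<in> op_null p"
    then show "S \<oplus>\<^bsub>op_ring p\<^esub> T \<in> op_null p"
      using S.a_closed[of S T] by (simp add: op_null_def bi_ideal_add)
  qed
next
  interpret S: ring "op_ring p" by (rule ring_op_ring)
  fix S T assume *: "S \<in> op_null p" "T \<in> carrier (op_ring p)"
  then have "S \<in> carrier (op_ring p)" by (simp add: op_null_def)
  with * show "T \<otimes>\<^bsub>op_ring p\<^esub> S \<in> op_null p" "S \<otimes>\<^bsub>op_ring p\<^esub> T \<in> op_null p"
    using S.m_closed[of S T] S.m_closed[of T S] op_ring_carrierD(3)[OF *(2)] by (simp_all add: op_null_def)
qed

definition op_quot :: "'f::field poly \<Rightarrow> ('f poly poly \<Rightarrow> 'f poly poly) set ring" where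
  "op_quot p = op_ring p Quot op_null p"

definition op_class :: "'f::field poly \<Rightarrow> ('f poly poly \<Rightarrow> 'f poly poly) \<Rightarrow> ('f poly poly \<Rightarrow> 'f poly poly) set" where
  "op_class p T = op_null p +>\<^bsub>op_ring p\<^esub> T"

lemma ring_op_quot: "ring (op_quot p)"
  unfolding op_quot_def by (rule ideal.quotient_is_ring[OF ideal_op_null])

lemma op_class_hom: "op_class p \<in> ring_hom (op_ring p) (op_quot p)"
  using ideal.rcos_ring_hom[OF ideal_op_null, of p] by (simp add: op_quot_def op_class_def[abs_def])

lemma op_ring_minus:
  assumes "T \<in> carrier (op_ring p)"
  shows "S \<ominus>\<^bsub>op_ring p\<^esub> T = (\<lambda>h. S h - T h)"
proof -
  interpret S: ring "op_ring p" by (rule ring_op_ring)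
  have "\<ominus>\<^bsub>op_ring p\<^esub> T = (\<lambda>h. - T h)"
  proof (rule S.minus_equality)
    show "(\<lambda>h. - T h) \<in> carrier (op_ring p)"
      by (rule op_ring_carrierI) (simp_all add: op_ring_carrierD[OF assms] bi_ideal_uminus)
  qed (simp_all add: assms)
  then show ?thesis by (simp add: a_minus_def)
qed

lemma op_class_eqD:
  assumes "op_class p S = op_class p T" "S \<in> carrier (op_ring p)" "T \<in> carrier (op_ring p)"
  shows "S h - T h \<in> bi_ideal p"
proof -
  interpret S: ring "op_ring p" by (rule ring_op_ring)
  have "S \<ominus>\<^bsub>op_ring p\<^esub> T \<in> op_null p"
    using S.quotient_eq_iff_same_a_r_cos[OF ideal_op_null assms(2,3)] assms(1) by (simp add: op_class_def)
  then have "(S \<ominus>\<^bsub>op_ring p\<^esub> T) h \<in> bi_ideal p" by (simp add: op_null_def)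
  then show ?thesis by (simp add: op_ring_minus[OF assms(3)])
qed

lemma op_class_null:
  assumes "T \<in> op_null p"
  shows "op_class p T = \<zero>\<^bsub>op_quot p\<^esub>"
  using ring.a_rcos_zero[OF ring_op_ring ideal_op_null assms] by (simp add: op_class_def op_quot_def FactRing_def)

definition mult_op :: "'f::field poly poly \<Rightarrow> 'f poly poly \<Rightarrow> 'f poly poly" where
  "mult_op g h = g * h"

lemma mult_op_closed: "mult_op g \<in> carrier (op_ring p)"
  by (rule op_ring_carrierI) (simp_all add: mult_op_def distrib_left mult.left_commute bi_ideal_mult)

definition mult_class :: "'f::field poly \<Rightarrow> 'f poly poly \<Rightarrow> ('f poly poly \<Rightarrow> 'f poly poly) set" where
  "mult_class p g = op_class p (mult_op g)"

lemma mult_class_hom: "mult_class p \<in> ring_hom ring_of_type_algebra (op_quot p)"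
proof (rule ring_hom_memI)
  show "mult_class p g \<in> carrier (op_quot p)" for g
    unfolding mult_class_def by (rule ring_hom_closed[OF op_class_hom mult_op_closed])
  have m: "mult_op g \<otimes>\<^bsub>op_ring p\<^esub> mult_op h = mult_op (g * h)"
    and a: "mult_op g \<oplus>\<^bsub>op_ring p\<^esub> mult_op h = mult_op (g + h)"
    and o: "\<one>\<^bsub>op_ring p\<^esub> = mult_op 1" for g h
    by (auto simp: mult_op_def mult.assoc distrib_right intro!: ext)
  show "mult_class p (g \<otimes>\<^bsub>ring_of_type_algebra\<^esub> h) = mult_class p g \<otimes>\<^bsub>op_quot p\<^esub> mult_class p h" for g h
    unfolding mult_class_def ring_hom_mult[OF op_class_hom mult_op_closed mult_op_closed, symmetric] m by simp
  show "mult_class p (g \<oplus>\<^bsub>ring_of_type_algebra\<^esub> h) = mult_class p g \<oplus>\<^bsub>op_quot p\<^esub> mult_class p h" for g h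
    unfolding mult_class_def ring_hom_add[OF op_class_hom mult_op_closed mult_op_closed, symmetric] a by simp
  show "mult_class p \<one>\<^bsub>ring_of_type_algebra\<^esub> = \<one>\<^bsub>op_quot p\<^esub>"
    unfolding mult_class_def ring_hom_one[OF op_class_hom, symmetric] o by simp
qed

lemma mult_class_const_comm:
  assumes "x \<in> carrier (op_quot p)"
  shows "x \<otimes>\<^bsub>op_quot p\<^esub> mult_class p (bi_const c) = mult_class p (bi_const c) \<otimes>\<^bsub>op_quot p\<^esub> x"
proof -
  obtain T where T: "T \<in> carrier (op_ring p)" "x = op_class p T"
    using assms unfolding op_quot_def op_class_def by (rule FactRing_carrierE)
  show ?thesis
    unfolding T(2) mult_class_def ring_hom_mult[OF op_class_hom T(1) mult_op_closed, symmetric]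
      ring_hom_mult[OF op_class_hom mult_op_closed T(1), symmetric]
    by (simp add: mult_op_def[abs_def] op_ring_carrierD[OF T(1)])
qed

lemma (in hecke_rep) op_R_closed: "op_R \<in> carrier (op_ring p)"
  by (rule op_ring_carrierI) (simp_all add: op_R_add op_R_const_mult bi_ideal_op_R)

section \<open>The representation of \<open>\<H>\<^sub>p(x, y)\<close>\<close>

lemma map_poly_min_poly:
  assumes "comm_hom f"
  shows "map_poly f (min_poly n A) = min_poly n (\<lambda>i. f (A i))"
    and "map_poly f (tilde_poly n A) = tilde_poly n (\<lambda>i. f (A i))"
proof -
  interpret f: comm_hom f by fact
  interpret mf: comm_hom "map_poly f" by (rule comm_hom_map_poly[OF assms])
  show "map_poly f (min_poly n A) = min_poly n (\<lambda>i. f (A i))" "map_poly f (tilde_poly n A) = tilde_poly n (\<lambda>i. f (A i))"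
    by (simp_all add: min_poly_def tilde_poly_def mf.hom_add mf.hom_diff mf.hom_uminus mf.hom_sum map_poly_monom f.hom_zero f.hom_one)
qed

lemma (in alg_point) ev_unique:
  assumes "k \<in> ring_hom ring_of_type_algebra B" "\<And>a. \<eta> a = k [:a:]" "b = k [:0, 1:]"
  shows "ev f = k f"
  using ev_image[of B "\<lambda>x. x" \<eta> k f] assms ring_axioms \<eta>_hom by (simp add: ring_hom_def)

locale hecke_setup =
  fixes \<phi> :: "'k::field_char_0 \<Rightarrow> 'z::idom" and q :: 'k and n :: nat and A :: "nat \<Rightarrow> 'z" and p :: "'z poly"
  assumes \<phi>: "\<phi> \<in> ring_hom ring_of_type_algebra ring_of_type_algebra"
    and q: "q \<noteq> 0" "q \<noteq> 1" "q \<noteq> - 1" and n: "n \<ge> 1"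
    and p: "p = - Polynomial.monom 1 (n + 1) + (\<Sum>i\<le>n. Polynomial.monom (A i) (n - i))"
    and A: "A n \<noteq> 0"
begin

lemma p_min_poly: "p = min_poly n A"
  by (simp add: p min_poly_def)

sublocale \<phi>: comm_hom \<phi> by (rule comm_hom_\<phi>[OF \<phi>])
sublocale zc: comm_hom "z_const :: 'z \<Rightarrow> _"
  unfolding z_const_eta[OF \<phi>] by (rule comm_hom_to_fract_bi_const)
sublocale bc: inj_hom "base_change \<phi>" by (rule inj_hom_base_change[OF \<phi>])

lemma z_const_zero: "z_const (c :: 'z) = 0 \<Longrightarrow> c = 0"
  using to_fract_zero[of "bi_const c"] by (simp add: z_const_def[OF \<phi>] bi_const_def)

abbreviation "A' i \<equiv> z_const (A i)"
abbreviation "p' \<equiv> min_poly n (\<lambda>i. A' i)"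
abbreviation "\<omega> \<equiv> z_const (hecke_omega \<phi> q)"
abbreviation "Q \<equiv> op_quot p'"
abbreviation "cls \<equiv> op_class p'"
abbreviation "mc \<equiv> mult_class p'"

lemma omega_nonzero: "\<omega> \<noteq> 0"
proof
  assume "\<omega> = 0"
  then have "hecke_omega \<phi> q = 0" by (rule z_const_zero)
  then have "q - inverse q = 0" unfolding hecke_omega_def by (rule \<phi>_inj[OF \<phi>])
  then have "q * q = 1" using q(1) by (simp add: field_simps)
  then show False using q square_eq_1_iff[of q] by simp
qed

sublocale H: hecke_rep "z_const (\<phi> q)" \<omega>
proof
  have "q\<^sup>2 = (q - inverse q) * q + 1" using q by (simp add: algebra_simps power2_eq_square)
  from arg_cong[OF this, of "\<lambda>x. z_const (\<phi> x)"]
  show "(z_const (\<phi> q))\<^sup>2 = \<omega> * z_const (\<phi> q) + 1"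
    by (simp only: hecke_omega_def \<phi>.hom_add \<phi>.hom_mult \<phi>.hom_power \<phi>.hom_one zc.hom_add zc.hom_mult zc.hom_power zc.hom_one)
  have "z_const (\<phi> 2) = 2"
    by (metis \<phi>.hom_add \<phi>.hom_one one_add_one zc.hom_add zc.hom_one)
  moreover have "z_const (\<phi> 2) \<noteq> 0" using z_const_zero \<phi>_inj[OF \<phi>] by fastforce
  ultimately show "(2 :: 'z poly poly fract) \<noteq> 0" by simp
qed

sublocale Q: ring Q by (rule ring_op_quot)
sublocale mc: ring_hom_ring "ring_of_type_algebra :: 'z poly poly fract poly poly ring" Q mc
  by (intro ring_hom_ringI' ring_ring_of_type_algebra ring_op_quot mult_class_hom)
sublocale cls: ring_hom_ring "op_ring p'" Q cls
  by (intro ring_hom_ringI' ring_op_ring ring_op_quot op_class_hom)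

lemma op_R_closed [simp]: "H.op_R \<in> carrier (op_ring p')"
  by (rule H.op_R_closed)

lemma mc_closed [simp]: "mc g \<in> carrier Q"
  by (rule ring_hom_closed[OF mult_class_hom]) simp

lemma sub_hom:
  assumes "comm_hom f"
  shows "(\<lambda>c. mc (f c)) \<in> ring_hom ring_of_type_algebra Q"
proof -
  interpret comm_hom f by fact
  show ?thesis
    by (rule ring_hom_memI)
       (use mc.hom_add[simplified] mc.hom_mult[simplified] mc.hom_one[simplified]
         in \<open>simp_all only: hom_add hom_mult hom_one ring_of_type_algebra_simps UNIV_I mc_closed\<close>)
qed

lemma free_point: "free_point Q (\<lambda>c. mc (bi_const (z_const c))) (cls H.op_R) (mc bi_u)"
proof (intro free_point.intro free_point_axioms.intro Q.ring_axioms)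
  show "(\<lambda>c. mc (bi_const (z_const c))) \<in> ring_hom ring_of_type_algebra Q"
    by (rule sub_hom[OF comm_hom_compose[OF bi_const.comm_hom_axioms zc.comm_hom_axioms]])
qed (simp_all add: mult_class_const_comm)

sublocale FP: free_point Q "\<lambda>c. mc (bi_const (z_const c))" "cls H.op_R" "mc bi_u"
  by (rule free_point)

lemma in_u_hom: "(\<lambda>f. mc (in_u (map_poly z_const f))) \<in> ring_hom ring_of_type_algebra Q"
  by (rule sub_hom[OF comm_hom_compose[OF in_u.comm_hom_axioms comm_hom_map_poly[OF zc.comm_hom_axioms]]])

lemma ev_in_u: "FP.ev f = mc (in_u (map_poly z_const f))"
  by (rule FP.ev_unique[OF in_u_hom])
     (simp_all add: map_poly_pCons zc.hom_zero zc.hom_one in_u_base)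

lemma quadratic: "cls H.op_R \<otimes>\<^bsub>Q\<^esub> cls H.op_R = mc (bi_const \<omega>) \<otimes>\<^bsub>Q\<^esub> cls H.op_R \<oplus>\<^bsub>Q\<^esub> \<one>\<^bsub>Q\<^esub>"
proof -
  have "cls (H.op_R \<otimes>\<^bsub>op_ring p'\<^esub> H.op_R) =
      cls (mult_op (bi_const \<omega>) \<otimes>\<^bsub>op_ring p'\<^esub> H.op_R \<oplus>\<^bsub>op_ring p'\<^esub> \<one>\<^bsub>op_ring p'\<^esub>)"
    by (simp add: mult_op_def H.op_R_quadratic)
  then show ?thesis
    by (simp only: cls.hom_mult cls.hom_add cls.hom_one cls.R.m_closed cls.R.one_closed op_R_closed mult_op_closed mult_class_def)
qed

lemma braid: "cls H.op_R \<otimes>\<^bsub>Q\<^esub> mc bi_u \<otimes>\<^bsub>Q\<^esub> cls H.op_R \<otimes>\<^bsub>Q\<^esub> mc bi_u =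
    mc bi_u \<otimes>\<^bsub>Q\<^esub> cls H.op_R \<otimes>\<^bsub>Q\<^esub> mc bi_u \<otimes>\<^bsub>Q\<^esub> cls H.op_R"
proof -
  have "cls (H.op_R \<otimes>\<^bsub>op_ring p'\<^esub> mult_op bi_u \<otimes>\<^bsub>op_ring p'\<^esub> H.op_R \<otimes>\<^bsub>op_ring p'\<^esub> mult_op bi_u) =
      cls (mult_op bi_u \<otimes>\<^bsub>op_ring p'\<^esub> H.op_R \<otimes>\<^bsub>op_ring p'\<^esub> mult_op bi_u \<otimes>\<^bsub>op_ring p'\<^esub> H.op_R)"
    by (simp add: mult_op_def H.op_R_braid)
  then show ?thesis
    by (simp only: cls.hom_mult cls.R.m_closed op_R_closed mult_op_closed mult_class_def)
qed

lemma min_poly_zero: "alg_eval Q (\<lambda>c. mc (bi_const (z_const c))) p (mc bi_u) = \<zero>\<^bsub>Q\<^esub>"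
proof -
  have "mult_op (in_u p') \<in> op_null p'"
    using mult_op_closed by (auto simp: op_null_def mult_op_def bi_ideal_gens)
  then have "mc (in_u (map_poly z_const p)) = \<zero>\<^bsub>Q\<^esub>"
    unfolding p_min_poly map_poly_min_poly(1)[OF zc.comm_hom_axioms] mult_class_def
    by (rule op_class_null)
  then show ?thesis unfolding ev_in_u .
qed

definition \<Psi> where
  "\<Psi> = (SOME \<Psi>. \<Psi> \<in> ring_hom (hecke_p \<phi> q p) Q \<and>
    (\<forall>f. \<Psi> (hecke_p_class \<phi> q p f) = free_eval Q (\<lambda>c. mc (bi_const (z_const c))) (cls H.op_R) (mc bi_u) f))"

lemma \<Psi>: "\<Psi> \<in> ring_hom (hecke_p \<phi> q p) Q" "\<Psi> (hecke_p_class \<phi> q p f) = FP.\<Phi> f"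
proof -
  have "\<exists>\<Psi>. \<Psi> \<in> ring_hom (hecke_p \<phi> q p) Q \<and> (\<forall>f. \<Psi> (hecke_p_class \<phi> q p f) = FP.\<Phi> f)"
    using hecke_p_universal[OF free_point quadratic braid min_poly_zero] by blast
  from someI_ex[OF this] show "\<Psi> \<in> ring_hom (hecke_p \<phi> q p) Q" "\<Psi> (hecke_p_class \<phi> q p f) = FP.\<Phi> f"
    unfolding \<Psi>_def by blast+
qed

lemma \<Psi>_base:
  "\<Psi> (Hp_scalar \<phi> q p c) = mc (bi_const (z_const c))" "\<Psi> (Hp_R \<phi> q p) = cls H.op_R" "\<Psi> (Hp_K \<phi> q p) = mc bi_u"
  unfolding Hp_scalar_def Hp_R_def Hp_K_def \<Psi>(2) by (rule FP.\<Phi>_base)+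

lemma \<Psi>_\<kappa>: "\<Psi> (alg_eval (hecke_p \<phi> q p) (Hp_scalar \<phi> q p) f (Hp_K \<phi> q p)) = mc (in_u (map_poly z_const f))"
  by (rule alg_point.ev_image[OF alg_point_hecke_p ring_op_quot \<Psi>(1) FP.\<eta>_hom in_u_hom])
     (simp_all add: \<Psi>_base map_poly_pCons zc.hom_zero zc.hom_one in_u_base)

lemma \<Psi>_R_inverse:
  "\<Psi> (inv\<^bsub>hecke_p \<phi> q p\<^esub> Hp_R \<phi> q p) = cls H.op_R \<ominus>\<^bsub>Q\<^esub> mc (bi_const \<omega>)"
proof -
  have "FP.\<Phi> (free_R - free_scalar (hecke_omega \<phi> q)) \<oplus>\<^bsub>Q\<^esub> mc (bi_const \<omega>) = cls H.op_R"
    using FP.\<Phi>_add[of "free_R - free_scalar (hecke_omega \<phi> q)" "free_scalar (hecke_omega \<phi> q)"]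
    by (simp add: FP.\<Phi>_base)
  moreover have "x \<oplus>\<^bsub>Q\<^esub> y \<ominus>\<^bsub>Q\<^esub> y = x" if "x \<in> carrier Q" "y \<in> carrier Q" for x y
    using that by (simp add: Q.a_assoc Q.r_neg a_minus_def)
  from this[OF FP.\<Phi>_closed mc_closed]
  have "FP.\<Phi> (free_R - free_scalar (hecke_omega \<phi> q)) \<oplus>\<^bsub>Q\<^esub> mc (bi_const \<omega>) \<ominus>\<^bsub>Q\<^esub> mc (bi_const \<omega>) =
      FP.\<Phi> (free_R - free_scalar (hecke_omega \<phi> q))" .
  ultimately show ?thesis unfolding Hp_R_inverse \<Psi>(2) by (simp only:)
qed

end

lemma (in ring) diff_add_diff:
  assumes "a \<in> carrier R" "b \<in> carrier R" "c \<in> carrier R" "d \<in> carrier R"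
  shows "(a \<ominus> b) \<oplus> (c \<ominus> d) = (a \<oplus> c) \<ominus> (b \<oplus> d)"
  using assms by (simp add: a_minus_def minus_add a_ac)

lemma (in ring) finsum_diff:
  assumes "f \<in> S \<rightarrow> carrier R" "g \<in> S \<rightarrow> carrier R" "finite S"
  shows "(\<Oplus>i\<in>S. f i \<ominus> g i) = (\<Oplus>i\<in>S. f i) \<ominus> (\<Oplus>i\<in>S. g i)"
  using assms(3,1,2)
proof (induction S rule: finite_induct)
  case empty
  show ?case by (simp add: a_minus_def)
next
  case (insert j S)
  have c: "f j \<in> carrier R" "g j \<in> carrier R" "f \<in> S \<rightarrow> carrier R" "g \<in> S \<rightarrow> carrier R"
    using insert.prems by auto
  have d: "(\<lambda>i. f i \<ominus> g i) \<in> S \<rightarrow> carrier R" using c by auto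
  show ?case
    using insert.hyps c d insert.IH[OF c(3,4)] diff_add_diff[OF c(1,2) finsum_closed[OF c(3)] finsum_closed[OF c(4)]]
    by (simp add: finsum_insert)
qed

lemma (in tensor_alg) elt_finsum_left:
  assumes "finite S" "f \<in> S \<rightarrow> carrier A" "b \<in> carrier B"
  shows "elt (\<Oplus>\<^bsub>A\<^esub>i\<in>S. f i) b = (\<Oplus>\<^bsub>T\<^esub>i\<in>S. elt (f i) b)"
  using assms(1,2)
proof (induction S rule: finite_induct)
  case empty
  show ?case using assms(3) by (simp add: elt_zero_left)
next
  case (insert j S)
  have c: "f j \<in> carrier A" "f \<in> S \<rightarrow> carrier A" using insert.prems by auto
  have d: "(\<lambda>i. elt (f i) b) \<in> S \<rightarrow> carrier T" using c assms(3) by auto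
  show ?case
    using insert.hyps insert.IH[OF c(2)] c d assms(3)
    by (simp add: A.finsum_insert T.finsum_insert elt_add_left elt_closed)
qed

context hecke_setup
begin

abbreviation "Hp \<equiv> hecke_p \<phi> q p"
abbreviation "hs \<equiv> Hp_scalar \<phi> q p"
abbreviation "hc \<equiv> Hp_const \<phi> q p"
abbreviation "KA \<equiv> K_alg \<phi> q p"

sublocale Hp: alg_point Hp hs "Hp_K \<phi> q p" by (rule alg_point_hecke_p)
sublocale KA: ring KA by (rule ring_K_alg)

lemma hc_eq: "hc c = hs (\<phi> c)" by (simp add: Hp_const_def)

lemma KA_sub: "b \<in> carrier KA \<Longrightarrow> b \<in> carrier Hp"
  unfolding K_alg_carrier by auto

lemma hs_KA: "hs c \<in> carrier KA"
  unfolding K_alg_carrier using Hp.ev_const by (metis rangeI)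

lemma ev_KA: "Hp.ev f \<in> carrier KA"
  unfolding K_alg_carrier by blast

sublocale XY: tensor_alg hc Hp kxy_const "ring_of_type_algebra :: 'k poly poly fract ring"
  by (intro tensor_alg.intro Hp.ring_axioms ring_ring_of_type_algebra) (simp_all add: hc_eq)

sublocale KX: tensor_alg hc KA kx_const "ring_of_type_algebra :: 'k poly fract ring"
  by (intro tensor_alg.intro KA.ring_axioms ring_ring_of_type_algebra) (simp_all add: hc_eq hs_KA)

sublocale ZX: tensor_alg \<phi> "ring_of_type_algebra :: 'z ring" kx_const "ring_of_type_algebra :: 'k poly fract ring"
  by (intro tensor_alg.intro ring_ring_of_type_algebra) simp_all

lemma ring_names:
  "hecke_p_xy \<phi> q p = XY.T" "hecke_p_xy_elt \<phi> q p = XY.elt" "K_alg_x \<phi> q p = KX.T"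
  "K_alg_x_elt \<phi> q p b = KX.elt b 1" "z_x \<phi> = ZX.T"
  by (simp_all add: hecke_p_xy_def hecke_p_xy_elt_def K_alg_x_def K_alg_x_elt_def z_x_def
      ext_x_def ext_xy_def ext_x_elt_def ext_xy_elt_def)

abbreviation "\<sigma> c \<equiv> mc (bi_const c)"

lemma \<sigma>_simps: "\<sigma> (c + d) = \<sigma> c \<oplus>\<^bsub>Q\<^esub> \<sigma> d" "\<sigma> (c * d) = \<sigma> c \<otimes>\<^bsub>Q\<^esub> \<sigma> d" "\<sigma> 1 = \<one>\<^bsub>Q\<^esub>"
  using mc.hom_add[of "bi_const c" "bi_const d"] mc.hom_mult[of "bi_const c" "bi_const d"] mc.hom_one
  by (simp_all add: bi_const.hom_add bi_const.hom_mult bi_const.hom_one)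

lemma \<sigma>_comm: "x \<in> carrier Q \<Longrightarrow> x \<otimes>\<^bsub>Q\<^esub> \<sigma> c = \<sigma> c \<otimes>\<^bsub>Q\<^esub> x"
  by (rule mult_class_const_comm)

lemma Q_interchange:
  assumes "x \<in> carrier Q" "y \<in> carrier Q"
  shows "(x \<otimes>\<^bsub>Q\<^esub> y) \<otimes>\<^bsub>Q\<^esub> (\<sigma> c \<otimes>\<^bsub>Q\<^esub> \<sigma> d) = (x \<otimes>\<^bsub>Q\<^esub> \<sigma> c) \<otimes>\<^bsub>Q\<^esub> (y \<otimes>\<^bsub>Q\<^esub> \<sigma> d)"
proof -
  have "(x \<otimes>\<^bsub>Q\<^esub> y) \<otimes>\<^bsub>Q\<^esub> (\<sigma> c \<otimes>\<^bsub>Q\<^esub> \<sigma> d) = x \<otimes>\<^bsub>Q\<^esub> ((y \<otimes>\<^bsub>Q\<^esub> \<sigma> c) \<otimes>\<^bsub>Q\<^esub> \<sigma> d)"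
    using assms by (simp only: Q.m_assoc Q.m_closed mc_closed)
  also have "\<dots> = (x \<otimes>\<^bsub>Q\<^esub> \<sigma> c) \<otimes>\<^bsub>Q\<^esub> (y \<otimes>\<^bsub>Q\<^esub> \<sigma> d)"
    unfolding \<sigma>_comm[OF assms(2), of c] using assms by (simp only: Q.m_assoc Q.m_closed mc_closed)
  finally show ?thesis .
qed

definition \<Theta> where "\<Theta> = tensor_lift Q (\<lambda>b r. \<Psi> b \<otimes>\<^bsub>Q\<^esub> \<sigma> (base_change \<phi> r))"

lemma \<Psi>_closed: "b \<in> carrier Hp \<Longrightarrow> \<Psi> b \<in> carrier Q"
  by (rule ring_hom_closed[OF \<Psi>(1)])

lemma \<Theta>_map: "tensor_map hc Hp kxy_const (ring_of_type_algebra :: 'k poly poly fract ring) Q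
    (\<lambda>b r. \<Psi> b \<otimes>\<^bsub>Q\<^esub> \<sigma> (base_change \<phi> r))"
proof (intro tensor_map.intro tensor_map_axioms.intro XY.tensor_alg_axioms Q.ring_axioms)
  fix a b c assume a: "a \<in> carrier Hp"
  have "\<Psi> (hc c \<otimes>\<^bsub>Hp\<^esub> a) = \<sigma> (base_change \<phi> (kxy_const c)) \<otimes>\<^bsub>Q\<^esub> \<Psi> a"
    using ring_hom_mult[OF \<Psi>(1), of "hc c" a] a
    by (simp add: hc_eq \<Psi>_base base_change_base[OF \<phi>])
  then show "\<Psi> (hc c \<otimes>\<^bsub>Hp\<^esub> a) \<otimes>\<^bsub>Q\<^esub> \<sigma> (base_change \<phi> b) =
    \<Psi> a \<otimes>\<^bsub>Q\<^esub> \<sigma> (base_change \<phi> (kxy_const c \<otimes>\<^bsub>ring_of_type_algebra\<^esub> b))"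
    unfolding ring_of_type_algebra_simps bc.hom_mult \<sigma>_simps \<sigma>_comm[OF \<Psi>_closed[OF a], symmetric]
    by (simp only: Q.m_assoc \<Psi>_closed[OF a] mc_closed)
next
  fix a b a' b' assume a: "a \<in> carrier Hp" "a' \<in> carrier Hp"
  show "\<Psi> (a \<otimes>\<^bsub>Hp\<^esub> a') \<otimes>\<^bsub>Q\<^esub> \<sigma> (base_change \<phi> (b \<otimes>\<^bsub>ring_of_type_algebra\<^esub> b')) =
    \<Psi> a \<otimes>\<^bsub>Q\<^esub> \<sigma> (base_change \<phi> b) \<otimes>\<^bsub>Q\<^esub> (\<Psi> a' \<otimes>\<^bsub>Q\<^esub> \<sigma> (base_change \<phi> b'))"
    unfolding ring_of_type_algebra_simps bc.hom_mult \<sigma>_simps ring_hom_mult[OF \<Psi>(1) a]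
    by (rule Q_interchange[OF \<Psi>_closed[OF a(1)] \<Psi>_closed[OF a(2)]])
next
  show "\<Psi> \<one>\<^bsub>Hp\<^esub> \<otimes>\<^bsub>Q\<^esub> \<sigma> (base_change \<phi> \<one>\<^bsub>ring_of_type_algebra\<^esub>) = \<one>\<^bsub>Q\<^esub>"
    unfolding ring_hom_one[OF \<Psi>(1)] by (simp add: bc.hom_one \<sigma>_simps)
qed (simp_all add: \<Psi>_closed ring_hom_add[OF \<Psi>(1)] bc.hom_add \<sigma>_simps Q.l_distr Q.r_distr)

lemma \<Theta>_hom: "\<Theta> \<in> ring_hom XY.T Q"
  unfolding \<Theta>_def by (rule tensor_map.lift_hom[OF \<Theta>_map])

lemma \<Theta>_elt: "b \<in> carrier Hp \<Longrightarrow> \<Theta> (XY.elt b r) = \<Psi> b \<otimes>\<^bsub>Q\<^esub> \<sigma> (base_change \<phi> r)"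
  unfolding \<Theta>_def by (rule tensor_map.lift_elt[OF \<Theta>_map]) simp_all

lemma K_at_map:
  fixes t :: "'k poly poly fract"
  assumes t: "kx_point t"
  shows "tensor_map hc KA kx_const (ring_of_type_algebra :: 'k poly fract ring) XY.T (\<lambda>b f. XY.elt b (rat_at t f))"
proof -
  interpret e: inj_hom "poly_eval kxy_const t" by (rule inj_hom_at_point[OF t])
  interpret r: inj_hom "rat_at t" unfolding rat_at_fract_lift by (rule e.inj_hom_fract_lift)
  show ?thesis
  proof (intro tensor_map.intro tensor_map_axioms.intro KX.tensor_alg_axioms XY.T.ring_axioms)
    fix a b c assume a: "a \<in> carrier KA"
    show "XY.elt (hc c \<otimes>\<^bsub>KA\<^esub> a) (rat_at t b) = XY.elt a (rat_at t (kx_const c \<otimes>\<^bsub>ring_of_type_algebra\<^esub> b))"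
      using XY.elt_balanced[OF KA_sub[OF a], of "rat_at t b" c]
      by (simp add: r.hom_mult rat_at_base[OF \<phi> t] K_alg_simps)
  qed (simp_all add: KA_sub XY.elt_closed XY.elt_add_left XY.elt_add_right[simplified] XY.elt_mult K_alg_simps r.hom_add r.hom_mult r.hom_one
      XY.elt_one[simplified])
qed

lemma K_at_hom: "kx_point t \<Longrightarrow> K_at \<phi> q p t \<in> ring_hom KX.T XY.T"
  unfolding K_at_def ring_names by (rule tensor_map.lift_hom[OF K_at_map])

lemma K_at_elt: "kx_point t \<Longrightarrow> b \<in> carrier KA \<Longrightarrow> K_at \<phi> q p t (KX.elt b r) = XY.elt b (rat_at t r)"
  unfolding K_at_def ring_names by (rule tensor_map.lift_elt[OF K_at_map]) simp_all

definition spec where "spec t W = \<Theta> (K_at \<phi> q p t W)"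

lemma spec_hom: "kx_point t \<Longrightarrow> spec t \<in> ring_hom KX.T Q"
  unfolding spec_def[abs_def] by (rule ring_hom_compI[OF K_at_hom \<Theta>_hom])

lemma spec_elt: "kx_point t \<Longrightarrow> b \<in> carrier KA \<Longrightarrow> spec t (KX.elt b r) = \<Psi> b \<otimes>\<^bsub>Q\<^esub> \<sigma> (eval_fun \<phi> t r)"
  by (simp add: spec_def K_at_elt \<Theta>_elt KA_sub eval_fun_def[OF \<phi>])

lemma scalar_map: "tensor_map \<phi> (ring_of_type_algebra :: 'z ring) kx_const (ring_of_type_algebra :: 'k poly fract ring) KX.T
    (\<lambda>b f. KX.elt (hs b) f)"
proof (intro tensor_map.intro tensor_map_axioms.intro ZX.tensor_alg_axioms KX.T.ring_axioms)
  fix a b c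
  show "KX.elt (hs (\<phi> c \<otimes>\<^bsub>ring_of_type_algebra\<^esub> a)) b = KX.elt (hs a) (kx_const c \<otimes>\<^bsub>ring_of_type_algebra\<^esub> b)"
    using KX.elt_balanced[OF hs_KA[of a], of b c] by (simp add: Hp.\<eta>_mult hc_eq K_alg_simps)
qed (simp_all add: hs_KA KX.elt_closed Hp.\<eta>_add Hp.\<eta>_mult Hp.\<eta>_one KX.elt_add_left[simplified K_alg_simps] KX.elt_add_right[simplified]
    KX.elt_mult[simplified K_alg_simps] KX.elt_one[simplified K_alg_simps, simplified])

lemma K_alg_x_scalar_eq: "K_alg_x_scalar \<phi> q p = tensor_lift KX.T (\<lambda>b f. KX.elt (hs b) f)"
  by (simp add: K_alg_x_scalar_def ext_x_map_def ext_x_def ext_x_elt_def)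

abbreviation "scal \<equiv> K_alg_x_scalar \<phi> q p"

lemma scal_hom: "scal \<in> ring_hom ZX.T KX.T"
  unfolding K_alg_x_scalar_eq by (rule tensor_map.lift_hom[OF scalar_map])

lemma scal_elt: "scal (ZX.elt a r) = KX.elt (hs a) r"
  unfolding K_alg_x_scalar_eq by (rule tensor_map.lift_elt[OF scalar_map]) simp_all

lemma scal_closed: "c \<in> carrier ZX.T \<Longrightarrow> scal c \<in> carrier KX.T"
  by (rule ring_hom_closed[OF scal_hom])

lemma spec_scal:
  assumes t: "kx_point t" and c: "c \<in> carrier ZX.T"
  shows "spec t (scal c) = \<sigma> (z_eval \<phi> t c)"
proof (rule ZX.tensor_hom_eqI[OF Q.ring_axioms _ _ c])
  show "(\<lambda>c. spec t (scal c)) \<in> ring_hom ZX.T Q"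
    by (rule ring_hom_compI[OF scal_hom spec_hom[OF t]])
  have "\<sigma> \<in> ring_hom ring_of_type_algebra Q"
    by (rule ring_hom_memI) (simp_all add: \<sigma>_simps)
  from ring_hom_compI[OF z_eval_hom[OF \<phi> t] this]
  show "(\<lambda>c. \<sigma> (z_eval \<phi> t c)) \<in> ring_hom ZX.T Q" unfolding ring_names .
  fix a r
  show "spec t (scal (ZX.elt a r)) = \<sigma> (z_eval \<phi> t (ZX.elt a r))"
    by (simp only: scal_elt spec_elt[OF t hs_KA] \<Psi>_base z_eval_elt[OF \<phi> t] \<sigma>_simps)
qed

section \<open>Expansion over the basis\<close>

abbreviation "K_pow i \<equiv> Hp.ev (Polynomial.monom 1 i)"
abbreviation "K_til \<equiv> Hp.ev (tilde_poly n A)"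

definition comb where
  "comb c = (\<Oplus>\<^bsub>KX.T\<^esub>i\<in>{..<n}. scal (c i) \<otimes>\<^bsub>KX.T\<^esub> KX.elt (K_pow i) 1) \<oplus>\<^bsub>KX.T\<^esub> scal (c n) \<otimes>\<^bsub>KX.T\<^esub> KX.elt K_til 1"

lemma tilde_expansion_iff:
  "tilde_expansion \<phi> q p n A W c \<longleftrightarrow> (\<forall>i\<le>n. c i \<in> carrier ZX.T) \<and> W = comb c"
  unfolding tilde_expansion_def ring_names K_tilde_eq comb_def \<kappa>_monom_one ..

lemma ev_tilde_comb:
  "Hp.ev (tilde_comb n A c) = (\<Oplus>\<^bsub>Hp\<^esub>i\<in>{..<n}. hs (c i) \<otimes>\<^bsub>Hp\<^esub> K_pow i) \<oplus>\<^bsub>Hp\<^esub> hs (c n) \<otimes>\<^bsub>Hp\<^esub> K_til"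
  unfolding tilde_comb_def Hp.ev_add Hp.ev_smult by (simp only: \<kappa>_sum finite_lessThan Hp.ev_smult)

lemma KA_finsum:
  assumes "finite S" "f \<in> S \<rightarrow> carrier KA"
  shows "finsum KA f S = finsum Hp f S"
  using assms
proof (induction S rule: finite_induct)
  case empty
  show ?case by (simp add: K_alg_simps)
next
  case (insert j S)
  have c: "f j \<in> carrier KA" "f \<in> S \<rightarrow> carrier KA" using insert.prems by auto
  then have d: "f j \<in> carrier Hp" "f \<in> S \<rightarrow> carrier Hp" using KA_sub by auto
  show ?case using insert.hyps insert.IH[OF c(2)] c d by (simp add: KA.finsum_insert Hp.finsum_insert K_alg_simps)
qed

lemma comb_terms:
  assumes "\<And>i. i \<le> n \<Longrightarrow> c i \<in> carrier ZX.T"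
  shows "i < n \<Longrightarrow> scal (c i) \<otimes>\<^bsub>KX.T\<^esub> KX.elt (K_pow i) 1 \<in> carrier KX.T"
    "scal (c n) \<otimes>\<^bsub>KX.T\<^esub> KX.elt K_til 1 \<in> carrier KX.T"
  using assms ev_KA by (auto intro!: KX.T.m_closed scal_closed KX.elt_closed)

lemma spanning:
  assumes "W \<in> carrier KX.T"
  shows "\<exists>c. (\<forall>i\<le>n. c i \<in> carrier ZX.T) \<and> W = comb c"
  using assms
proof (induction rule: KX.tensor_induct)
  interpret scal: ring_hom_ring ZX.T KX.T scal
    by (intro ring_hom_ringI' ZX.T.ring_axioms KX.T.ring_axioms scal_hom)
  case zero
  have "comb (\<lambda>i. \<zero>\<^bsub>ZX.T\<^esub>) = \<zero>\<^bsub>KX.T\<^esub>"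
    unfolding comb_def by (simp add: KX.elt_closed ev_KA KX.T.finsum_zero)
  then show ?case by (intro exI[of _ "\<lambda>i. \<zero>\<^bsub>ZX.T\<^esub>"] conjI allI impI ZX.T.zero_closed) (rule sym)
next
  case (elt b r)
  from elt(1) obtain f where b: "b = Hp.ev f" unfolding K_alg_carrier by (rule rangeE)
  obtain c g where f: "f = tilde_comb n A c + min_poly n A * g" using tilde_division[OF n, of f A] by (elim exE)
  have z: "Hp.ev (min_poly n A) = \<zero>\<^bsub>Hp\<^esub>"
    using hecke_p_min_poly[of \<phi> q p] by (simp only: p_min_poly[symmetric])
  have b': "b = Hp.ev (tilde_comb n A c)"
    unfolding b f Hp.ev_add Hp.ev_mult z by simp
  have trm: "scal (ZX.elt a r) \<otimes>\<^bsub>KX.T\<^esub> KX.elt (Hp.ev g) 1 = KX.elt (hs a \<otimes>\<^bsub>Hp\<^esub> Hp.ev g) r" for a g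
    unfolding scal_elt using KX.elt_mult[OF hs_KA[of a], of r "Hp.ev g" 1] ev_KA[of g] by (simp add: K_alg_simps)
  have cl: "hs a \<otimes>\<^bsub>Hp\<^esub> Hp.ev g \<in> carrier KA" for a g
    using KA.m_closed[OF hs_KA[of a] ev_KA[of g]] by (simp add: K_alg_simps)
  have fs: "(\<Oplus>\<^bsub>Hp\<^esub>i\<in>{..<n}. hs (c i) \<otimes>\<^bsub>Hp\<^esub> K_pow i) = (\<Oplus>\<^bsub>KA\<^esub>i\<in>{..<n}. hs (c i) \<otimes>\<^bsub>Hp\<^esub> K_pow i)"
    by (rule KA_finsum[symmetric]) (use cl in auto)
  have "KX.elt b r = KX.elt (\<Oplus>\<^bsub>KA\<^esub>i\<in>{..<n}. hs (c i) \<otimes>\<^bsub>Hp\<^esub> K_pow i) r \<oplus>\<^bsub>KX.T\<^esub> KX.elt (hs (c n) \<otimes>\<^bsub>Hp\<^esub> K_til) r"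
    unfolding b' ev_tilde_comb fs
    using KX.elt_add_left[OF KA.finsum_closed cl, of "\<lambda>i. hs (c i) \<otimes>\<^bsub>Hp\<^esub> K_pow i" "{..<n}" r "c n" "tilde_poly n A"] cl
    by (simp add: K_alg_simps)
  also have "KX.elt (\<Oplus>\<^bsub>KA\<^esub>i\<in>{..<n}. hs (c i) \<otimes>\<^bsub>Hp\<^esub> K_pow i) r = (\<Oplus>\<^bsub>KX.T\<^esub>i\<in>{..<n}. KX.elt (hs (c i) \<otimes>\<^bsub>Hp\<^esub> K_pow i) r)"
    by (rule KX.elt_finsum_left) (use cl in auto)
  finally have "KX.elt b r = comb (\<lambda>i. ZX.elt (c i) r)"
    unfolding comb_def trm .
  then show ?case
    by (intro exI[of _ "\<lambda>i. ZX.elt (c i) r"] conjI allI impI ZX.elt_closed) simp_all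
next
  interpret scal: ring_hom_ring ZX.T KX.T scal
    by (intro ring_hom_ringI' ZX.T.ring_axioms KX.T.ring_axioms scal_hom)
  case (diff V W)
  from diff(3) obtain c where c': "\<forall>i\<le>n. c i \<in> carrier ZX.T" "V = comb c" by (elim exE conjE)
  from diff(4) obtain d where d': "\<forall>i\<le>n. d i \<in> carrier ZX.T" "W = comb d" by (elim exE conjE)
  note c = c'(1)[rule_format] c'(2) and d = d'(1)[rule_format] d'(2)
  have t: "scal (c i \<ominus>\<^bsub>ZX.T\<^esub> d i) \<otimes>\<^bsub>KX.T\<^esub> KX.elt (Hp.ev g) 1 =
      scal (c i) \<otimes>\<^bsub>KX.T\<^esub> KX.elt (Hp.ev g) 1 \<ominus>\<^bsub>KX.T\<^esub> scal (d i) \<otimes>\<^bsub>KX.T\<^esub> KX.elt (Hp.ev g) 1" if "i \<le> n" for i g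
    using c(1)[OF that] d(1)[OF that] ev_KA[of g] KX.elt_closed[of "Hp.ev g" 1]
    by (simp add: a_minus_def KX.T.l_distr KX.T.l_minus)
  let ?s = "\<lambda>c. \<Oplus>\<^bsub>KX.T\<^esub>i\<in>{..<n}. scal (c i) \<otimes>\<^bsub>KX.T\<^esub> KX.elt (K_pow i) 1"
  have cc: "(\<lambda>i. scal (c i) \<otimes>\<^bsub>KX.T\<^esub> KX.elt (K_pow i) 1) \<in> {..<n} \<rightarrow> carrier KX.T"
    and dd: "(\<lambda>i. scal (d i) \<otimes>\<^bsub>KX.T\<^esub> KX.elt (K_pow i) 1) \<in> {..<n} \<rightarrow> carrier KX.T"
    using comb_terms[of c, OF c(1)] comb_terms[of d, OF d(1)] by auto
  have "?s (\<lambda>i. c i \<ominus>\<^bsub>ZX.T\<^esub> d i) = (\<Oplus>\<^bsub>KX.T\<^esub>i\<in>{..<n}. scal (c i) \<otimes>\<^bsub>KX.T\<^esub> KX.elt (K_pow i) 1 \<ominus>\<^bsub>KX.T\<^esub> scal (d i) \<otimes>\<^bsub>KX.T\<^esub> KX.elt (K_pow i) 1)"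
    by (rule KX.T.finsum_cong') (use t cc dd in auto)
  also have "\<dots> = ?s c \<ominus>\<^bsub>KX.T\<^esub> ?s d" by (rule KX.T.finsum_diff[OF cc dd]) simp
  finally have s: "?s (\<lambda>i. c i \<ominus>\<^bsub>ZX.T\<^esub> d i) = ?s c \<ominus>\<^bsub>KX.T\<^esub> ?s d" .
  have "comb (\<lambda>i. c i \<ominus>\<^bsub>ZX.T\<^esub> d i) = V \<ominus>\<^bsub>KX.T\<^esub> W"
    unfolding c(2) d(2) comb_def s t[OF order_refl]
    by (rule KX.T.diff_add_diff[OF KX.T.finsum_closed[OF cc] KX.T.finsum_closed[OF dd] comb_terms(2)[of c, OF c(1)] comb_terms(2)[of d, OF d(1)]])
  then show ?case
    by (intro exI[of _ "\<lambda>i. c i \<ominus>\<^bsub>ZX.T\<^esub> d i"] conjI allI impI ZX.T.minus_closed c(1) d(1)) (assumption, assumption, rule sym)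
qed

section \<open>The reflection equation in the representation\<close>

definition R_op where
  "R_op \<tau> h = bi_const (1 - \<tau>) * H.op_R h + bi_const (\<omega> * \<tau>) * h"

lemma \<Theta>_R_at: "\<Theta> (R_at \<phi> q p t) = cls (R_op (base_change \<phi> (inverse t)))"
  and R_op_closed: "R_op \<tau> \<in> carrier (op_ring p')"
proof -
  interpret \<Theta>: ring_hom_ring XY.T Q \<Theta>
    by (intro ring_hom_ringI' XY.T.ring_axioms Q.ring_axioms \<Theta>_hom)
  let ?M = "\<lambda>c. mult_op (bi_const c)"
  let ?S = "op_ring p'"
  have op: "R_op \<tau> = H.op_R \<ominus>\<^bsub>?S\<^esub> (H.op_R \<ominus>\<^bsub>?S\<^esub> ?M \<omega>) \<otimes>\<^bsub>?S\<^esub> ?M \<tau>" for \<tau>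
  proof -
    have c: "(H.op_R \<ominus>\<^bsub>?S\<^esub> ?M \<omega>) \<otimes>\<^bsub>?S\<^esub> ?M \<tau> \<in> carrier ?S"
      by (simp only: cls.R.minus_closed cls.R.m_closed op_R_closed mult_op_closed)
    have u: "(H.op_R \<ominus>\<^bsub>?S\<^esub> ?M \<omega>) \<otimes>\<^bsub>?S\<^esub> ?M \<tau> =
        (\<lambda>h. H.op_R (bi_const \<tau> * h) - bi_const \<omega> * (bi_const \<tau> * h))"
      unfolding op_ring_minus[OF mult_op_closed] op_ring_simps mult_op_def ..
    have v: "R_op \<tau> h = H.op_R h - (H.op_R (bi_const \<tau> * h) - bi_const \<omega> * (bi_const \<tau> * h))" for h
      unfolding R_op_def H.op_R_const_mult bi_const.hom_diff bi_const.hom_mult bi_const.hom_one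
      by (simp add: algebra_simps)
    show ?thesis
      unfolding op_ring_minus[OF c] unfolding u by (rule ext) (rule v)
  qed
  show "R_op \<tau> \<in> carrier ?S"
    unfolding op by (simp only: cls.R.minus_closed cls.R.m_closed op_R_closed mult_op_closed)
  have R: "Hp_R \<phi> q p \<in> carrier Hp" by (simp add: Hp_R_def)
  have Ri: "inv\<^bsub>Hp\<^esub> Hp_R \<phi> q p \<in> carrier Hp" by (simp add: Hp_R_inverse)
  have e: "XY.elt (Hp_R \<phi> q p) 1 \<in> carrier XY.T" "XY.elt (inv\<^bsub>Hp\<^esub> Hp_R \<phi> q p) (inverse t) \<in> carrier XY.T"
    using R Ri by (simp_all add: XY.elt_closed)
  have hom_minus: "\<Theta> (x \<ominus>\<^bsub>XY.T\<^esub> y) = \<Theta> x \<ominus>\<^bsub>Q\<^esub> \<Theta> y" if "x \<in> carrier XY.T" "y \<in> carrier XY.T" for x y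
    using that by (simp add: a_minus_def)
  have cls_minus: "cls (x \<ominus>\<^bsub>?S\<^esub> y) = cls x \<ominus>\<^bsub>Q\<^esub> cls y" if "x \<in> carrier ?S" "y \<in> carrier ?S" for x y
    using that by (simp only: a_minus_def cls.hom_add cls.hom_a_inv cls.R.a_inv_closed)
  have "\<Theta> (R_at \<phi> q p t) = cls H.op_R \<ominus>\<^bsub>Q\<^esub> (cls H.op_R \<ominus>\<^bsub>Q\<^esub> mc (bi_const \<omega>)) \<otimes>\<^bsub>Q\<^esub> \<sigma> (base_change \<phi> (inverse t))"
    unfolding R_at_def ring_names hom_minus[OF e] \<Theta>_elt[OF R] \<Theta>_elt[OF Ri] \<Psi>_base \<Psi>_R_inverse bc.hom_one \<sigma>_simps
    by (simp only: Q.r_one cls.hom_closed op_R_closed)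
  also have "\<dots> = cls (R_op (base_change \<phi> (inverse t)))"
    unfolding op mult_class_def
    by (simp only: cls_minus cls.hom_mult cls.R.minus_closed cls.R.m_closed op_R_closed mult_op_closed)
  finally show "\<Theta> (R_at \<phi> q p t) = cls (R_op (base_change \<phi> (inverse t)))" .
qed

lemma spec_comb:
  assumes t: "kx_point t" and c: "\<And>i. i \<le> n \<Longrightarrow> c i \<in> carrier ZX.T"
  shows "spec t (comb c) = mc (in_u (tilde_comb n (\<lambda>i. A' i) (\<lambda>i. z_eval \<phi> t (c i))))"
proof -
  interpret s: ring_hom_ring KX.T Q "spec t"
    by (intro ring_hom_ringI' KX.T.ring_axioms Q.ring_axioms spec_hom[OF t])
  have trm: "spec t (scal (c i) \<otimes>\<^bsub>KX.T\<^esub> KX.elt (Hp.ev g) 1) = mc (in_u (Polynomial.smult (z_eval \<phi> t (c i)) (map_poly z_const g)))"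
    if "i \<le> n" for i g
  proof -
    have "spec t (KX.elt (Hp.ev g) 1) = mc (in_u (map_poly z_const g))"
      using spec_elt[OF t ev_KA[of g], of 1] comm_hom.hom_one[OF comm_hom_eval_fun[OF \<phi> t]]
      by (simp add: \<Psi>_\<kappa> \<sigma>_simps)
    then have "spec t (scal (c i) \<otimes>\<^bsub>KX.T\<^esub> KX.elt (Hp.ev g) 1) = \<sigma> (z_eval \<phi> t (c i)) \<otimes>\<^bsub>Q\<^esub> mc (in_u (map_poly z_const g))"
      using s.hom_mult[OF scal_closed[OF c[OF that]] KX.elt_closed[OF ev_KA[of g]], of 1] spec_scal[OF t c[OF that]] by simp
    also have "\<dots> = mc (bi_const (z_eval \<phi> t (c i)) * in_u (map_poly z_const g))"
      using mc.hom_mult[of "bi_const (z_eval \<phi> t (c i))" "in_u (map_poly z_const g)"] by simp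
    also have "bi_const (z_eval \<phi> t (c i)) * in_u (map_poly z_const g) = in_u (Polynomial.smult (z_eval \<phi> t (c i)) (map_poly z_const g))"
      by (simp add: bi_const_def in_u_def)
    finally show ?thesis .
  qed
  have cc: "(\<lambda>i. scal (c i) \<otimes>\<^bsub>KX.T\<^esub> KX.elt (K_pow i) 1) \<in> {..<n} \<rightarrow> carrier KX.T"
    using comb_terms[of c, OF c] by auto
  let ?g = "\<lambda>i. in_u (Polynomial.smult (z_eval \<phi> t (c i)) (Polynomial.monom 1 i))"
  have "spec t (\<Oplus>\<^bsub>KX.T\<^esub>i\<in>{..<n}. scal (c i) \<otimes>\<^bsub>KX.T\<^esub> KX.elt (K_pow i) 1) =
      (\<Oplus>\<^bsub>Q\<^esub>i\<in>{..<n}. mc (?g i))"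
    unfolding s.hom_finsum[OF cc] comp_def
    by (rule Q.finsum_cong') (auto simp: trm map_poly_monom zc.hom_zero zc.hom_one)
  also have "\<dots> = mc (\<Sum>i<n. ?g i)"
    using mc.hom_finsum[of ?g "{..<n}"] by (simp add: comp_def)
  finally have s1: "spec t (\<Oplus>\<^bsub>KX.T\<^esub>i\<in>{..<n}. scal (c i) \<otimes>\<^bsub>KX.T\<^esub> KX.elt (K_pow i) 1) = mc (\<Sum>i<n. ?g i)" .
  have "spec t (comb c) = spec t (\<Oplus>\<^bsub>KX.T\<^esub>i\<in>{..<n}. scal (c i) \<otimes>\<^bsub>KX.T\<^esub> KX.elt (K_pow i) 1) \<oplus>\<^bsub>Q\<^esub>
      spec t (scal (c n) \<otimes>\<^bsub>KX.T\<^esub> KX.elt K_til 1)"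
    unfolding comb_def by (rule s.hom_add[OF KX.T.finsum_closed[OF cc] comb_terms(2)[of c, OF c]])
  then have "spec t (comb c) = mc (\<Sum>i<n. ?g i) \<oplus>\<^bsub>Q\<^esub> mc (in_u (Polynomial.smult (z_eval \<phi> t (c n)) (tilde_poly n (\<lambda>i. A' i))))"
    unfolding s1 trm[OF order_refl] map_poly_min_poly(2)[OF zc.comm_hom_axioms] .
  also have "\<dots> = mc ((\<Sum>i<n. ?g i) + in_u (Polynomial.smult (z_eval \<phi> t (c n)) (tilde_poly n (\<lambda>i. A' i))))"
    using mc.hom_add[of "\<Sum>i<n. ?g i"] by simp
  finally show ?thesis unfolding tilde_comb_def in_u.hom_add in_u.hom_sum .
qed

lemma points: "kx_point (kxy_x :: 'k poly poly fract)" "kx_point (kxy_y :: 'k poly poly fract)"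
  by (simp_all add: kx_point_def)

lemma reflection_in_module:
  assumes "reflection_solution \<phi> q p W" "W = comb c" "\<And>i. i \<le> n \<Longrightarrow> c i \<in> carrier ZX.T"
  defines "\<tau>1 \<equiv> base_change \<phi> (inverse (kxy_x / kxy_y))"
    and "\<tau>2 \<equiv> base_change \<phi> (inverse (kxy_x * kxy_y))"
    and "a \<equiv> tilde_comb n (\<lambda>i. A' i) (\<lambda>i. z_eval \<phi> kxy_x (c i))"
    and "b \<equiv> tilde_comb n (\<lambda>i. A' i) (\<lambda>i. z_eval \<phi> kxy_y (c i))"
  shows "R_op \<tau>1 (in_u a * R_op \<tau>2 (in_u b)) - in_u b * R_op \<tau>2 (in_u a * R_op \<tau>1 1) \<in> bi_ideal p'"
proof -
  interpret \<Theta>: ring_hom_ring XY.T Q \<Theta>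
    by (intro ring_hom_ringI' XY.T.ring_axioms Q.ring_axioms \<Theta>_hom)
  have W: "W \<in> carrier KX.T" using assms(1) by (simp add: reflection_solution_def ring_names)
  let ?r1 = "R_at \<phi> q p (kxy_x / kxy_y)" and ?r2 = "R_at \<phi> q p (kxy_x * kxy_y)"
  let ?kx = "K_at \<phi> q p kxy_x W" and ?ky = "K_at \<phi> q p kxy_y W"
  have R: "Hp_R \<phi> q p \<in> carrier Hp" by (simp add: Hp_R_def)
  have Ri: "inv\<^bsub>Hp\<^esub> Hp_R \<phi> q p \<in> carrier Hp" by (simp add: Hp_R_inverse)
  have rc: "R_at \<phi> q p t \<in> carrier XY.T" for t
    unfolding R_at_def ring_names using R Ri by (intro XY.T.minus_closed XY.elt_closed) simp_all
  have kc: "?kx \<in> carrier XY.T" "?ky \<in> carrier XY.T"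
    using ring_hom_closed[OF K_at_hom[OF points(1)] W] ring_hom_closed[OF K_at_hom[OF points(2)] W] .
  have eq: "?r1 \<otimes>\<^bsub>XY.T\<^esub> ?kx \<otimes>\<^bsub>XY.T\<^esub> ?r2 \<otimes>\<^bsub>XY.T\<^esub> ?ky = ?ky \<otimes>\<^bsub>XY.T\<^esub> ?r2 \<otimes>\<^bsub>XY.T\<^esub> ?kx \<otimes>\<^bsub>XY.T\<^esub> ?r1"
    using assms(1) unfolding reflection_solution_def ring_names by (rule conjunct2)
  have "spec kxy_x W = mc (in_u a)" "spec kxy_y W = mc (in_u b)"
    unfolding assms(2) a_def b_def
    by (rule spec_comb[OF points(1)], rule assms(3), assumption)
       (rule spec_comb[OF points(2)], rule assms(3), assumption)
  then have k: "\<Theta> ?kx = cls (mult_op (in_u a))" "\<Theta> ?ky = cls (mult_op (in_u b))"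
    by (simp_all only: spec_def mult_class_def)
  let ?S = "op_ring p'"
  have "cls (R_op \<tau>1) \<otimes>\<^bsub>Q\<^esub> cls (mult_op (in_u a)) \<otimes>\<^bsub>Q\<^esub> cls (R_op \<tau>2) \<otimes>\<^bsub>Q\<^esub> cls (mult_op (in_u b)) =
    cls (mult_op (in_u b)) \<otimes>\<^bsub>Q\<^esub> cls (R_op \<tau>2) \<otimes>\<^bsub>Q\<^esub> cls (mult_op (in_u a)) \<otimes>\<^bsub>Q\<^esub> cls (R_op \<tau>1)"
    using arg_cong[OF eq, of \<Theta>]
    by (simp only: \<Theta>.hom_mult XY.T.m_closed rc kc k \<Theta>_R_at \<tau>1_def \<tau>2_def)
  then have "cls (R_op \<tau>1 \<otimes>\<^bsub>?S\<^esub> mult_op (in_u a) \<otimes>\<^bsub>?S\<^esub> R_op \<tau>2 \<otimes>\<^bsub>?S\<^esub> mult_op (in_u b)) =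
    cls (mult_op (in_u b) \<otimes>\<^bsub>?S\<^esub> R_op \<tau>2 \<otimes>\<^bsub>?S\<^esub> mult_op (in_u a) \<otimes>\<^bsub>?S\<^esub> R_op \<tau>1)"
    by (simp only: cls.hom_mult cls.R.m_closed R_op_closed mult_op_closed)
  moreover have "R_op \<tau>1 \<otimes>\<^bsub>?S\<^esub> mult_op (in_u a) \<otimes>\<^bsub>?S\<^esub> R_op \<tau>2 \<otimes>\<^bsub>?S\<^esub> mult_op (in_u b) \<in> carrier ?S"
    "mult_op (in_u b) \<otimes>\<^bsub>?S\<^esub> R_op \<tau>2 \<otimes>\<^bsub>?S\<^esub> mult_op (in_u a) \<otimes>\<^bsub>?S\<^esub> R_op \<tau>1 \<in> carrier ?S"
    by (simp_all only: cls.R.m_closed R_op_closed mult_op_closed)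
  ultimately have "(R_op \<tau>1 \<otimes>\<^bsub>?S\<^esub> mult_op (in_u a) \<otimes>\<^bsub>?S\<^esub> R_op \<tau>2 \<otimes>\<^bsub>?S\<^esub> mult_op (in_u b)) 1 -
      (mult_op (in_u b) \<otimes>\<^bsub>?S\<^esub> R_op \<tau>2 \<otimes>\<^bsub>?S\<^esub> mult_op (in_u a) \<otimes>\<^bsub>?S\<^esub> R_op \<tau>1) 1 \<in> bi_ideal p'"
    by (rule op_class_eqD)
  then show ?thesis
    by (simp only: op_ring_simps mult_op_def mult_1_right)
qed

lemma reflection_eqn:
  assumes "reflection_solution \<phi> q p W" "W = comb c" "\<And>i. i \<le> n \<Longrightarrow> c i \<in> carrier ZX.T"
  defines "\<tau>1 \<equiv> base_change \<phi> (inverse (kxy_x / kxy_y))"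
    and "\<tau>2 \<equiv> base_change \<phi> (inverse (kxy_x * kxy_y))"
    and "a \<equiv> tilde_comb n (\<lambda>i. A' i) (\<lambda>i. z_eval \<phi> kxy_x (c i))"
    and "b \<equiv> tilde_comb n (\<lambda>i. A' i) (\<lambda>i. z_eval \<phi> kxy_y (c i))"
  shows "bi_const ((1 - \<tau>1) * (1 - \<tau>2) * \<omega>) * divided_diff (in_u a * in_v b) +
      bi_const ((1 - \<tau>1) * (\<omega> * \<tau>2)) * (in_v (a * b) - in_u (a * b)) +
      bi_const (\<omega> * \<tau>1 * (1 - \<tau>2)) * (in_u a * in_v b - in_u b * in_v a) \<in> bi_ideal p'"
    (is "?E \<in> _")
proof -
  define c1 c0 d1 d0 w Q0 where defs: "c1 = bi_const (1 - \<tau>1)" "c0 = bi_const (\<omega> * \<tau>1)"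
    "d1 = bi_const (1 - \<tau>2)" "d0 = bi_const (\<omega> * \<tau>2)" "w = bi_const \<omega>" "Q0 = bi_const (z_const (\<phi> q))"
  note R = R_op_def[of \<tau>1, folded defs] R_op_def[of \<tau>2, folded defs]
  have R2u: "R_op \<tau>2 (in_u g) = d1 * (Q0 * in_v g) + d0 * in_u g" for g
    by (simp add: R H.op_R_in_u defs(6))
  have R11: "R_op \<tau>1 1 = c1 * Q0 + c0"
    using H.op_R_in_u[of 1] by (simp add: R in_u.hom_one in_v.hom_one defs(6))
  have ocm: "H.op_R (bi_const x * h) = bi_const x * H.op_R h" for x h by (rule H.op_R_const_mult)
  have R1: "R_op \<tau>1 (in_u a * R_op \<tau>2 (in_u b)) =
    c1 * (d1 * Q0 * (Q0 * (in_u b * in_v a) + w * divided_diff (in_u a * in_v b)) + d0 * (Q0 * in_v (a * b))) +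
    c0 * (in_u a * (d1 * (Q0 * in_v b) + d0 * in_u b))"
  proof -
    have "in_u a * R_op \<tau>2 (in_u b) = d1 * (Q0 * (in_u a * in_v b)) + d0 * in_u (a * b)"
      by (simp add: R2u in_u.hom_mult algebra_simps)
    then have "H.op_R (in_u a * R_op \<tau>2 (in_u b)) = d1 * (Q0 * H.op_R (in_u a * in_v b)) + d0 * H.op_R (in_u (a * b))"
      by (simp only: H.op_R_add defs ocm)
    then show ?thesis
      by (simp only: R(1)) (simp add: R2u H.op_R_in_v H.op_R_in_u defs(5,6) mult.assoc)
  qed
  have R2: "R_op \<tau>2 (in_u a * R_op \<tau>1 1) = (c1 * Q0 + c0) * (d1 * (Q0 * in_v a) + d0 * in_u a)"
  proof -
    have lin: "R_op \<tau>2 (bi_const x * h) = bi_const x * R_op \<tau>2 h" for x h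
      unfolding R_op_def ocm by (simp add: algebra_simps)
    have cc: "c1 * Q0 + c0 = bi_const ((1 - \<tau>1) * z_const (\<phi> q) + \<omega> * \<tau>1)"
      by (simp add: defs bi_const.hom_add bi_const.hom_mult)
    have "in_u a * R_op \<tau>1 1 = bi_const ((1 - \<tau>1) * z_const (\<phi> q) + \<omega> * \<tau>1) * in_u a"
      unfolding R11 cc by (rule mult.commute)
    then show ?thesis unfolding cc by (simp only: lin R2u)
  qed
  have "R_op \<tau>1 (in_u a * R_op \<tau>2 (in_u b)) - in_u b * R_op \<tau>2 (in_u a * R_op \<tau>1 1) =
    Q0 * (c1 * d1 * w * divided_diff (in_u a * in_v b) + c1 * d0 * (in_v (a * b) - in_u (a * b)) +
      c0 * d1 * (in_u a * in_v b - in_u b * in_v a))"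
    unfolding R1 R2 by (simp add: in_u.hom_mult algebra_simps)
  also have "\<dots> = Q0 * ?E" by (simp only: defs bi_const.hom_mult)
  finally have "Q0 * ?E \<in> bi_ideal p'"
    using reflection_in_module[OF assms(1,2,3)] by (simp only: \<tau>1_def \<tau>2_def a_def b_def)
  then have "bi_const (inverse (z_const (\<phi> q))) * (Q0 * ?E) \<in> bi_ideal p'" by (rule bi_ideal_mult)
  moreover have "z_const (\<phi> q) \<noteq> 0"
    using z_const_zero[of "\<phi> q"] \<phi>_inj[OF \<phi>, of q] q(1) by blast
  then have "bi_const (inverse (z_const (\<phi> q))) * (Q0 * ?E) = ?E"
    unfolding defs(6) mult.assoc[symmetric, of "bi_const _" "bi_const _"] bi_const.hom_mult[symmetric]
    by (simp only: left_inverse bi_const.hom_one mult_1_left not_False_eq_True)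
  ultimately show ?thesis by (simp only:)
qed

lemma coeffs_zero:
  assumes "reflection_solution \<phi> q p W" "W = comb c" "\<And>i. i \<le> n \<Longrightarrow> c i \<in> carrier ZX.T"
    and "c (n - 1) = \<zero>\<^bsub>ZX.T\<^esub>" "n \<ge> 2" "n \<noteq> 3" "1 \<le> i" "i \<le> n"
  shows "c i = \<zero>\<^bsub>ZX.T\<^esub>"
proof -
  let ?X = "to_fract bi_u :: 'z poly poly fract" and ?Y = "to_fract bi_v :: 'z poly poly fract"
  define \<tau>1 where "\<tau>1 = base_change \<phi> (inverse (kxy_x / kxy_y))"
  define \<tau>2 where "\<tau>2 = base_change \<phi> (inverse (kxy_x * kxy_y))"
  have nz: "bi_u \<noteq> (0 :: 'z poly poly)" "bi_v \<noteq> (0 :: 'z poly poly)"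
    by (simp_all add: bi_u_def bi_v_def)
  have nz1: "bi_u * bi_v - 1 \<noteq> (0 :: 'z poly poly)"
    by (simp add: bi_u_def bi_v_def one_pCons)
  have X: "?X \<noteq> 0" "?Y \<noteq> 0"
    using to_fract_zero[of "bi_u :: 'z poly poly"] to_fract_zero[of "bi_v :: 'z poly poly"] nz by blast+
  have XY: "?X \<noteq> ?Y"
  proof
    assume "?X = ?Y"
    then have "to_fract (bi_u - bi_v :: 'z poly poly) = 0"
      unfolding comm_hom.hom_diff[OF comm_hom_to_fract] by (simp only: diff_self)
    from to_fract_zero[OF this] show False by (rule notE[OF bi_u_minus_v_nonzero])
  qed
  have XY1: "?X * ?Y \<noteq> 1"
  proof
    assume "?X * ?Y = 1"
    then have "to_fract (bi_u * bi_v - 1 :: 'z poly poly) = 0"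
      unfolding comm_hom.hom_diff[OF comm_hom_to_fract] comm_hom.hom_mult[OF comm_hom_to_fract]
        comm_hom.hom_one[OF comm_hom_to_fract] by (simp only: diff_self)
    from to_fract_zero[OF this] show False by (rule notE[OF nz1])
  qed
  have \<tau>: "\<tau>1 = ?Y / ?X" "\<tau>2 = inverse (?X * ?Y)"
    by (simp_all add: \<tau>1_def \<tau>2_def hom_inverse[OF bc.comm_hom_axioms] bc.hom_mult divide_inverse base_change_base[OF \<phi>])
  have \<tau>nz: "1 - \<tau>1 \<noteq> 0" "1 - \<tau>2 \<noteq> 0" "\<tau>2 \<noteq> 0"
    using X XY XY1 by (auto simp: \<tau> field_simps)
  define \<alpha> where "\<alpha> i = z_eval \<phi> kxy_x (c i)" for i
  define \<beta> where "\<beta> i = z_eval \<phi> kxy_y (c i)" for i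
  have z0: "z_eval \<phi> t \<zero>\<^bsub>ZX.T\<^esub> = 0" if "kx_point t" for t
  proof -
    interpret z: ring_hom_ring ZX.T "ring_of_type_algebra :: 'z poly poly fract ring" "z_eval \<phi> t"
      using z_eval_hom[OF \<phi> that] unfolding ring_names
      by (intro ring_hom_ringI' ZX.T.ring_axioms ring_ring_of_type_algebra)
    show ?thesis using z.hom_zero by simp
  qed
  have iff: "z_eval \<phi> t (c i) = 0 \<longleftrightarrow> c i = \<zero>\<^bsub>ZX.T\<^esub>" if "kx_point t" "i \<le> n" for t i
    using z_eval_inj[OF \<phi> that(1), of "c i"] assms(3)[OF that(2)] z0[OF that(1)] unfolding ring_names by auto
  interpret E: extraction n "\<lambda>i. A' i" \<alpha> \<beta> "(1 - \<tau>1) * (1 - \<tau>2) * \<omega>" "(1 - \<tau>1) * (\<omega> * \<tau>2)" "\<omega> * \<tau>1 * (1 - \<tau>2)"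
  proof
    show "A' n \<noteq> 0" using z_const_zero A by blast
    show "\<alpha> (n - 1) = 0" "\<beta> (n - 1) = 0"
      by (simp_all only: \<alpha>_def \<beta>_def assms(4) z0[OF points(1)] z0[OF points(2)])
    show "\<alpha> i = 0 \<longleftrightarrow> \<beta> i = 0" if "i \<le> n" for i
      by (simp only: \<alpha>_def \<beta>_def iff[OF points(1) that] iff[OF points(2) that])
    have "(1 - \<tau>1) * (1 - \<tau>2) * \<omega> + (1 - \<tau>1) * (\<omega> * \<tau>2) = (1 - \<tau>1) * \<omega>" by (simp add: algebra_simps)
    then show "(1 - \<tau>1) * (1 - \<tau>2) * \<omega> + (1 - \<tau>1) * (\<omega> * \<tau>2) \<noteq> 0"
      using \<tau>nz omega_nonzero by simp
    show "(1 - \<tau>1) * (1 - \<tau>2) * \<omega> \<noteq> 0" "(1 - \<tau>1) * (\<omega> * \<tau>2) \<noteq> 0"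
      using \<tau>nz omega_nonzero by simp_all
    show "bi_const ((1 - \<tau>1) * (1 - \<tau>2) * \<omega>) * divided_diff (in_u (tilde_comb n (\<lambda>i. A' i) \<alpha>) * in_v (tilde_comb n (\<lambda>i. A' i) \<beta>)) +
      bi_const ((1 - \<tau>1) * (\<omega> * \<tau>2)) * (in_v (tilde_comb n (\<lambda>i. A' i) \<alpha> * tilde_comb n (\<lambda>i. A' i) \<beta>) - in_u (tilde_comb n (\<lambda>i. A' i) \<alpha> * tilde_comb n (\<lambda>i. A' i) \<beta>)) +
      bi_const (\<omega> * \<tau>1 * (1 - \<tau>2)) * (in_u (tilde_comb n (\<lambda>i. A' i) \<alpha>) * in_v (tilde_comb n (\<lambda>i. A' i) \<beta>) - in_u (tilde_comb n (\<lambda>i. A' i) \<beta>) * in_v (tilde_comb n (\<lambda>i. A' i) \<alpha>))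
      \<in> bi_ideal p'"
      using reflection_eqn[OF assms(1-3)] unfolding \<alpha>_def[abs_def] \<beta>_def[abs_def] \<tau>1_def \<tau>2_def .
  qed (rule assms)+
  have "z_eval \<phi> kxy_x (c i) = 0" using E.all_zero[OF assms(7,8)] by (simp only: \<alpha>_def)
  then show ?thesis using iff[OF points(1) assms(8)] by blast
qed

end

section \<open>Inverting the constant term\<close>

lemma ring_localization_at:
  assumes "(s :: 'z::idom) \<noteq> 0"
  shows "ring (localization_at s)"
proof -
  interpret R: ring "ring_of_type_algebra :: 'z fract ring" by (rule ring_ring_of_type_algebra)
  have s: "s ^ m \<noteq> 0" for m using assms by simp
  have "subring {Fract a (s ^ m) | a m. True} (ring_of_type_algebra :: 'z fract ring)"
  proof (rule R.subringI)
    have "\<one>\<^bsub>ring_of_type_algebra\<^esub> = Fract 1 (s ^ 0)" by (simp add: One_fract_def)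
    then show "\<one>\<^bsub>ring_of_type_algebra\<^esub> \<in> {Fract a (s ^ m) | a m. True}" by blast
  next
    fix h assume "h \<in> {Fract a (s ^ m) | a m. True}"
    then obtain a m where "h = Fract a (s ^ m)" by blast
    then have "\<ominus>\<^bsub>ring_of_type_algebra\<^esub> h = Fract (- a) (s ^ m)" by simp
    then show "\<ominus>\<^bsub>ring_of_type_algebra\<^esub> h \<in> {Fract a (s ^ m) | a m. True}" by blast
  next
    fix g h assume "g \<in> {Fract a (s ^ m) | a m. True}" "h \<in> {Fract a (s ^ m) | a m. True}"
    then obtain a m b k where gh: "g = Fract a (s ^ m)" "h = Fract b (s ^ k)" by blast
    have "g \<otimes>\<^bsub>ring_of_type_algebra\<^esub> h = Fract (a * b) (s ^ (m + k))"
      by (simp add: gh power_add)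
    then show "g \<otimes>\<^bsub>ring_of_type_algebra\<^esub> h \<in> {Fract a (s ^ m) | a m. True}" by blast
    have "g \<oplus>\<^bsub>ring_of_type_algebra\<^esub> h = Fract (a * s ^ k + b * s ^ m) (s ^ (m + k))"
      using s by (simp add: gh power_add)
    then show "g \<oplus>\<^bsub>ring_of_type_algebra\<^esub> h \<in> {Fract a (s ^ m) | a m. True}" by blast
  qed simp
  then show ?thesis unfolding localization_at_def by (rule R.subring_is_ring)
qed

lemma localization_at_simps [simp]:
  "x \<oplus>\<^bsub>localization_at s\<^esub> y = x + y" "x \<otimes>\<^bsub>localization_at s\<^esub> y = x * y"
  "\<one>\<^bsub>localization_at s\<^esub> = 1"
  by (simp_all add: localization_at_def)

lemma localization_at_mem: "Fract a (s ^ m) \<in> carrier (localization_at s)"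
  "to_fract a \<in> carrier (localization_at s)" "1 \<in> carrier (localization_at s)"
proof -
  show *: "Fract a (s ^ m) \<in> carrier (localization_at s)" for a m
    by (auto simp: localization_at_def)
  from *[of a 0] show "to_fract a \<in> carrier (localization_at s)" by (simp add: to_fract_def)
  from *[of 1 0] show "1 \<in> carrier (localization_at s)" by (simp add: One_fract_def)
qed

context hecke_setup
begin

abbreviation "Lo \<equiv> localization_at (A n)"

lemma poly_p_0: "poly p 0 = A n"
  by (simp add: p_min_poly min_poly_tilde)

sublocale LT: tensor_alg hs KA to_fract Lo
  by (intro tensor_alg.intro KA.ring_axioms ring_localization_at[OF A] hs_KA localization_at_mem)

lemma loc_names1: "K_loc \<phi> q p = LT.T" "K_loc_elt \<phi> q p b = LT.elt b 1" "K_loc_const \<phi> q p c = LT.elt (hc c) 1"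
  by (simp_all add: K_loc_def K_loc_elt_def K_loc_const_def poly_p_0)

abbreviation "kl b \<equiv> LT.elt b 1"

lemma kl_closed: "b \<in> carrier KA \<Longrightarrow> kl b \<in> carrier LT.T"
  by (rule LT.elt_closed[OF _ localization_at_mem(3)])

lemma kl_simps:
  assumes "a \<in> carrier KA" "b \<in> carrier KA"
  shows "kl (a \<oplus>\<^bsub>KA\<^esub> b) = kl a \<oplus>\<^bsub>LT.T\<^esub> kl b" "kl (a \<otimes>\<^bsub>KA\<^esub> b) = kl a \<otimes>\<^bsub>LT.T\<^esub> kl b"
    "kl \<one>\<^bsub>KA\<^esub> = \<one>\<^bsub>LT.T\<^esub>"
  using LT.elt_add_left[OF assms localization_at_mem(3)] LT.elt_mult[OF assms(1) localization_at_mem(3) assms(2) localization_at_mem(3)]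
    LT.elt_one by simp_all

lemma hc_KA: "hc c \<in> carrier KA"
  unfolding hc_eq by (rule hs_KA)

sublocale LX: tensor_alg "K_loc_const \<phi> q p" LT.T kx_const "ring_of_type_algebra :: 'k poly fract ring"
  unfolding loc_names1(3)
  by (intro tensor_alg.intro LT.T.ring_axioms ring_ring_of_type_algebra kl_closed hc_KA) simp

lemma loc_names2: "K_loc_x \<phi> q p = LX.T" "K_loc_x_elt \<phi> q p b = LX.elt b 1"
  "K_alg_x_to_loc \<phi> q p = tensor_lift LX.T (\<lambda>b f. LX.elt (kl b) f)"
  "K_loc_x_scalar \<phi> q p = tensor_lift LX.T (\<lambda>c f. LX.elt (kl (hs c)) f)"
  by (simp_all add: K_loc_x_def K_loc_x_elt_def K_alg_x_to_loc_def K_loc_x_scalar_def ext_x_map_def ext_x_def ext_x_elt_def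
      loc_names1(1,2))

lemma to_loc_map: "tensor_map hc KA kx_const (ring_of_type_algebra :: 'k poly fract ring) LX.T (\<lambda>b f. LX.elt (kl b) f)"
proof (intro tensor_map.intro tensor_map_axioms.intro KX.tensor_alg_axioms LX.T.ring_axioms)
  fix a b c assume a: "a \<in> carrier KA"
  show "LX.elt (kl (hc c \<otimes>\<^bsub>KA\<^esub> a)) b = LX.elt (kl a) (kx_const c \<otimes>\<^bsub>ring_of_type_algebra\<^esub> b)"
    using LX.elt_balanced[OF kl_closed[OF a], of b c] unfolding kl_simps(2)[OF hc_KA a] loc_names1(3) by simp
next
  show "LX.elt (kl \<one>\<^bsub>KA\<^esub>) \<one>\<^bsub>ring_of_type_algebra\<^esub> = \<one>\<^bsub>LX.T\<^esub>"
    unfolding kl_simps(3)[OF hc_KA hc_KA] by (rule LX.elt_one)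
next
  fix a b a' b' assume a: "a \<in> carrier KA" "a' \<in> carrier KA"
  show "LX.elt (kl (a \<otimes>\<^bsub>KA\<^esub> a')) (b \<otimes>\<^bsub>ring_of_type_algebra\<^esub> b') = LX.elt (kl a) b \<otimes>\<^bsub>LX.T\<^esub> LX.elt (kl a') b'"
    unfolding kl_simps(2)[OF a] by (rule LX.elt_mult[symmetric]) (simp_all add: kl_closed a)
next
  fix a a' b assume a: "a \<in> carrier KA" "a' \<in> carrier KA"
  show "LX.elt (kl (a \<oplus>\<^bsub>KA\<^esub> a')) b = LX.elt (kl a) b \<oplus>\<^bsub>LX.T\<^esub> LX.elt (kl a') b"
    unfolding kl_simps(1)[OF a] by (rule LX.elt_add_left) (simp_all add: kl_closed a)
next
  fix a b b' assume a: "a \<in> carrier KA"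
  show "LX.elt (kl a) (b \<oplus>\<^bsub>ring_of_type_algebra\<^esub> b') = LX.elt (kl a) b \<oplus>\<^bsub>LX.T\<^esub> LX.elt (kl a) b'"
    by (rule LX.elt_add_right) (simp_all add: kl_closed a)
next
  fix a b assume "a \<in> carrier KA"
  then show "LX.elt (kl a) b \<in> carrier LX.T" by (intro LX.elt_closed kl_closed) simp_all
qed

abbreviation "to_loc \<equiv> K_alg_x_to_loc \<phi> q p"

lemma to_loc_hom: "to_loc \<in> ring_hom KX.T LX.T"
  unfolding loc_names2 by (rule tensor_map.lift_hom[OF to_loc_map])

lemma to_loc_elt: "b \<in> carrier KA \<Longrightarrow> to_loc (KX.elt b r) = LX.elt (kl b) r"
  unfolding loc_names2 by (rule tensor_map.lift_elt[OF to_loc_map]) simp_all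

lemma loc_scalar_map: "tensor_map \<phi> (ring_of_type_algebra :: 'z ring) kx_const (ring_of_type_algebra :: 'k poly fract ring) LX.T
    (\<lambda>c f. LX.elt (kl (hs c)) f)"
proof -
  interpret to_loc: ring_hom_ring KX.T LX.T to_loc
    by (intro ring_hom_ringI' KX.T.ring_axioms LX.T.ring_axioms to_loc_hom)
  interpret scal: tensor_map \<phi> "ring_of_type_algebra :: 'z ring" kx_const "ring_of_type_algebra :: 'k poly fract ring" KX.T
    "\<lambda>b f. KX.elt (hs b) f" by (rule scalar_map)
  have eq: "LX.elt (kl (hs c)) f = to_loc (KX.elt (hs c) f)" for c f
    by (rule to_loc_elt[OF hs_KA, symmetric])
  have cl: "KX.elt (hs c) f \<in> carrier KX.T" for c f
    by (intro KX.elt_closed hs_KA) simp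
  show ?thesis
    unfolding eq
    by (intro tensor_map.intro tensor_map_axioms.intro ZX.tensor_alg_axioms LX.T.ring_axioms)
       (simp_all only: scal.F_add_left scal.F_add_right scal.F_balanced scal.F_mult scal.F_one
          to_loc.hom_add to_loc.hom_mult to_loc.hom_one to_loc.hom_closed cl)
qed

abbreviation "lscal \<equiv> K_loc_x_scalar \<phi> q p"

lemma lscal_hom: "lscal \<in> ring_hom ZX.T LX.T"
  unfolding loc_names2 by (rule tensor_map.lift_hom[OF loc_scalar_map])

lemma lscal_elt: "lscal (ZX.elt a r) = LX.elt (kl (hs a)) r"
  unfolding loc_names2 by (rule tensor_map.lift_elt[OF loc_scalar_map]) simp_all

lemma to_loc_scal:
  assumes "c \<in> carrier ZX.T"
  shows "to_loc (scal c) = lscal c"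
  by (rule ZX.tensor_hom_eqI[OF LX.T.ring_axioms ring_hom_compI[OF scal_hom to_loc_hom] lscal_hom assms])
     (simp only: scal_elt lscal_elt to_loc_elt[OF hs_KA])

lemma K_tilde_mult: "Hp.ev [:0, 1:] \<otimes>\<^bsub>Hp\<^esub> K_til = hs (A n)"
proof -
  have z: "Hp.ev (min_poly n A) = \<zero>\<^bsub>Hp\<^esub>"
    using hecke_p_min_poly[of \<phi> q p] by (simp only: p_min_poly[symmetric])
  have "[:0, 1:] * tilde_poly n A = [:A n:] - min_poly n A" by (simp add: min_poly_tilde)
  then have "Hp.ev ([:0, 1:] * tilde_poly n A) = hs (A n) \<ominus>\<^bsub>Hp\<^esub> \<zero>\<^bsub>Hp\<^esub>"
    by (simp only: \<kappa>_diff Hp.ev_const z)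
  moreover have "hs (A n) \<ominus>\<^bsub>Hp\<^esub> \<zero>\<^bsub>Hp\<^esub> = hs (A n)" by (simp add: a_minus_def)
  ultimately show ?thesis by (simp only: Hp.ev_mult)
qed

abbreviation "k_inv \<equiv> LT.elt K_til (Fract 1 (A n ^ 1))"

lemma A_cancel: "to_fract (A n) * Fract 1 (A n ^ 1) = 1"
  using A by (simp add: to_fract_def One_fract_def eq_fract)

lemma k_inv_closed: "k_inv \<in> carrier LT.T"
  by (intro LT.elt_closed ev_KA localization_at_mem)

lemma A_kl: 
  assumes "b \<in> carrier KA"
  shows "LT.elt (hs (A n) \<otimes>\<^bsub>Hp\<^esub> b) (Fract 1 (A n ^ 1)) = kl b"
  using LT.elt_balanced[OF assms localization_at_mem(1)[of 1 "A n" 1], of "A n"]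
  by (simp only: A_cancel localization_at_simps K_alg_simps)

lemma inv_K: "inv\<^bsub>LT.T\<^esub> (kl (Hp_K \<phi> q p)) = k_inv"
proof -
  have "inv\<^bsub>LT.T\<^esub> (kl (Hp.ev [:0, 1:])) = k_inv"
  proof (rule LT.T.inv_char)
  have one: "hs (A n) = hs (A n) \<otimes>\<^bsub>Hp\<^esub> \<one>\<^bsub>KA\<^esub>" by (simp add: K_alg_simps)
  have "LT.elt (hs (A n) \<otimes>\<^bsub>Hp\<^esub> \<one>\<^bsub>KA\<^esub>) (Fract 1 (A n ^ 1)) = kl \<one>\<^bsub>KA\<^esub>"
    by (rule A_kl[OF KA.one_closed])
  then have e: "LT.elt (hs (A n)) (Fract 1 (A n ^ 1)) = \<one>\<^bsub>LT.T\<^esub>"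
    by (simp only: one[symmetric] kl_simps(3)[OF hc_KA hc_KA])
  have c: "K_til \<otimes>\<^bsub>Hp\<^esub> Hp.ev [:0, 1:] = hs (A n)"
    using K_tilde_mult unfolding Hp.ev_mult[symmetric] by (simp only: mult.commute)
  show "kl (Hp.ev [:0, 1:]) \<in> carrier LT.T" by (rule kl_closed[OF ev_KA])
  show "k_inv \<in> carrier LT.T" by (rule k_inv_closed)
  show "kl (Hp.ev [:0, 1:]) \<otimes>\<^bsub>LT.T\<^esub> k_inv = \<one>\<^bsub>LT.T\<^esub>"
    unfolding LT.elt_mult[OF ev_KA localization_at_mem(3) ev_KA localization_at_mem(1)] K_alg_simps K_tilde_mult
    by (simp only: localization_at_simps mult_1_left e)
  show "k_inv \<otimes>\<^bsub>LT.T\<^esub> kl (Hp.ev [:0, 1:]) = \<one>\<^bsub>LT.T\<^esub>"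
    unfolding LT.elt_mult[OF ev_KA localization_at_mem(1) ev_KA localization_at_mem(3)] K_alg_simps c
    by (simp only: localization_at_simps mult_1_right e)
  qed
  then show ?thesis unfolding Hp.ev_var .
qed

lemma kl_K_til: "kl K_til = kl (hs (A n)) \<otimes>\<^bsub>LT.T\<^esub> k_inv"
  unfolding LT.elt_mult[OF hs_KA localization_at_mem(3) ev_KA localization_at_mem(1)] K_alg_simps
  by (simp only: localization_at_simps mult_1_left A_kl[OF ev_KA])

section \<open>Small solutions\<close>

lemma K_pow_0: "K_pow 0 = \<one>\<^bsub>Hp\<^esub>"
  using ring_hom_one[OF Hp.ev_hom] by (simp add: monom_0 flip: one_pCons)

lemma K_pow_1: "K_pow 1 = Hp_K \<phi> q p"
  unfolding \<kappa>_monom_one by simp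

lemma comb_scalar:
  assumes "\<And>i. i \<le> n \<Longrightarrow> c i \<in> carrier ZX.T" "\<And>i. 1 \<le> i \<Longrightarrow> i \<le> n \<Longrightarrow> c i = \<zero>\<^bsub>ZX.T\<^esub>"
  shows "comb c = scal (c 0)"
proof -
  interpret scal: ring_hom_ring ZX.T KX.T scal
    by (intro ring_hom_ringI' ZX.T.ring_axioms KX.T.ring_axioms scal_hom)
  have e1: "KX.elt (K_pow 0) 1 = \<one>\<^bsub>KX.T\<^esub>"
    unfolding K_pow_0 using KX.elt_one by (simp add: K_alg_simps)
  have ec: "KX.elt (Hp.ev g) 1 \<in> carrier KX.T" for g
    by (intro KX.elt_closed ev_KA) simp
  have "(\<Oplus>\<^bsub>KX.T\<^esub>i\<in>{..<n}. scal (c i) \<otimes>\<^bsub>KX.T\<^esub> KX.elt (K_pow i) 1) =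
      (\<Oplus>\<^bsub>KX.T\<^esub>i\<in>{..<n}. if 0 = i then scal (c i) else \<zero>\<^bsub>KX.T\<^esub>)"
  proof (rule KX.T.finsum_cong')
    fix i assume i: "i \<in> {..<n}"
    show "scal (c i) \<otimes>\<^bsub>KX.T\<^esub> KX.elt (K_pow i) 1 = (if 0 = i then scal (c i) else \<zero>\<^bsub>KX.T\<^esub>)"
    proof (cases "i = 0")
      case True
      then show ?thesis using e1 scal_closed[OF assms(1)[of 0]] by simp
    next
      case False
      then have "c i = \<zero>\<^bsub>ZX.T\<^esub>" using assms(2)[of i] i by simp
      then show ?thesis using False ec by simp
    qed
  qed (use scal_closed assms(1) in auto)
  also have "\<dots> = scal (c 0)"
    by (rule KX.T.finsum_singleton) (use n scal_closed assms(1) in auto)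
  finally show ?thesis
    unfolding comb_def using assms(2)[of n] n ec scal_closed[OF assms(1)[of 0]] by simp
qed

lemma to_loc_comb:
  assumes "n = 3" "\<And>i. i \<le> n \<Longrightarrow> c i \<in> carrier ZX.T" "c 2 = \<zero>\<^bsub>ZX.T\<^esub>"
  shows "to_loc (comb c) =
    lscal (c 1) \<otimes>\<^bsub>LX.T\<^esub> LX.elt (kl (Hp_K \<phi> q p)) 1 \<oplus>\<^bsub>LX.T\<^esub> lscal (c 0) \<oplus>\<^bsub>LX.T\<^esub>
    lscal (c 3 \<otimes>\<^bsub>ZX.T\<^esub> ZX.elt (A n) 1) \<otimes>\<^bsub>LX.T\<^esub> LX.elt (inv\<^bsub>LT.T\<^esub> (kl (Hp_K \<phi> q p))) 1"
proof -
  interpret to_loc: ring_hom_ring KX.T LX.T to_loc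
    by (intro ring_hom_ringI' KX.T.ring_axioms LX.T.ring_axioms to_loc_hom)
  interpret lscal: ring_hom_ring ZX.T LX.T lscal
    by (intro ring_hom_ringI' ZX.T.ring_axioms LX.T.ring_axioms lscal_hom)
  have cc: "c 0 \<in> carrier ZX.T" "c 1 \<in> carrier ZX.T" "c 2 \<in> carrier ZX.T" "c 3 \<in> carrier ZX.T"
    using assms(1,2) by auto
  have ec: "KX.elt (Hp.ev g) 1 \<in> carrier KX.T" for g
    by (intro KX.elt_closed ev_KA) simp
  have lc: "LX.elt (kl (Hp.ev g)) 1 \<in> carrier LX.T" for g
    by (intro LX.elt_closed kl_closed ev_KA) simp
  let ?f = "\<lambda>i. scal (c i) \<otimes>\<^bsub>KX.T\<^esub> KX.elt (K_pow i) 1"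
  have trm: "to_loc (scal (c i) \<otimes>\<^bsub>KX.T\<^esub> KX.elt (Hp.ev g) 1) = lscal (c i) \<otimes>\<^bsub>LX.T\<^esub> LX.elt (kl (Hp.ev g)) 1"
    if "c i \<in> carrier ZX.T" for i g
    using that by (simp only: to_loc.hom_mult scal_closed ec to_loc_scal to_loc_elt ev_KA)
  have fc: "?f 0 \<in> carrier KX.T" "?f 1 \<in> carrier KX.T" "?f 2 \<in> carrier KX.T"
    "scal (c 3) \<otimes>\<^bsub>KX.T\<^esub> KX.elt K_til 1 \<in> carrier KX.T"
    using cc by (simp_all only: KX.T.m_closed scal_closed ec)
  have set: "{..<n} = insert 2 (insert 1 {0})" using assms(1) by auto
  have "(\<Oplus>\<^bsub>KX.T\<^esub>i\<in>{..<n}. ?f i) = ?f 2 \<oplus>\<^bsub>KX.T\<^esub> (?f 1 \<oplus>\<^bsub>KX.T\<^esub> ?f 0)"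
    unfolding set using fc by (simp add: KX.T.finsum_insert)
  then have "comb c = (?f 2 \<oplus>\<^bsub>KX.T\<^esub> (?f 1 \<oplus>\<^bsub>KX.T\<^esub> ?f 0)) \<oplus>\<^bsub>KX.T\<^esub> scal (c 3) \<otimes>\<^bsub>KX.T\<^esub> KX.elt K_til 1"
    unfolding comb_def using assms(1) by simp
  then have "to_loc (comb c) = (to_loc (?f 2) \<oplus>\<^bsub>LX.T\<^esub> (to_loc (?f 1) \<oplus>\<^bsub>LX.T\<^esub> to_loc (?f 0))) \<oplus>\<^bsub>LX.T\<^esub>
      to_loc (scal (c 3) \<otimes>\<^bsub>KX.T\<^esub> KX.elt K_til 1)"
    by (simp only: to_loc.hom_add KX.T.a_closed fc)
  also have "to_loc (?f 2) = \<zero>\<^bsub>LX.T\<^esub>"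
    unfolding trm[OF cc(3)] unfolding assms(3) lscal.hom_zero by (rule LX.T.l_null[OF lc])
  also have "to_loc (?f 1) = lscal (c 1) \<otimes>\<^bsub>LX.T\<^esub> LX.elt (kl (Hp_K \<phi> q p)) 1"
    by (simp only: trm[OF cc(2)]) (simp only: K_pow_1)
  also have "to_loc (?f 0) = lscal (c 0)"
  proof -
    have "LX.elt (kl (K_pow 0)) 1 = \<one>\<^bsub>LX.T\<^esub>"
      unfolding K_pow_0 using LX.elt_one kl_simps(3)[OF hc_KA hc_KA] by (simp add: K_alg_simps)
    then show ?thesis
      unfolding trm[OF cc(1)] using LX.T.r_one[OF lscal.hom_closed[OF cc(1)]] by (simp only:)
  qed
  also have "to_loc (scal (c 3) \<otimes>\<^bsub>KX.T\<^esub> KX.elt K_til 1) =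
      lscal (c 3 \<otimes>\<^bsub>ZX.T\<^esub> ZX.elt (A n) 1) \<otimes>\<^bsub>LX.T\<^esub> LX.elt k_inv 1"
  proof -
    have zc: "ZX.elt (A n) 1 \<in> carrier ZX.T" by (intro ZX.elt_closed) simp_all
    have li: "LX.elt k_inv 1 \<in> carrier LX.T" by (intro LX.elt_closed k_inv_closed) simp
    have "LX.elt (kl K_til) 1 = lscal (ZX.elt (A n) 1) \<otimes>\<^bsub>LX.T\<^esub> LX.elt k_inv 1"
      unfolding kl_K_til lscal_elt using LX.elt_mult[OF kl_closed[OF hs_KA[of "A n"]] _ k_inv_closed, of 1 1] by simp
    then show ?thesis unfolding trm[OF cc(4)]
      by (simp only: lscal.hom_mult cc zc LX.T.m_assoc lscal.hom_closed li)
  qed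
  finally show ?thesis
    unfolding inv_K using cc LX.T.l_zero LX.T.m_closed[OF lscal.hom_closed[OF cc(2)]] lc[of "[:0, 1:]"]
    by (simp add: Hp.ev_var)
qed

lemma small_solution_form:
  assumes refl: "reflection_solution \<phi> q p W" and nontriv: "\<not> trivial_solution \<phi> q p W"
    and small: "small_solution \<phi> q p n A W"
  shows "(\<exists>a_plus \<in> carrier (z_x \<phi>). \<exists>a_zero \<in> carrier (z_x \<phi>). \<exists>a_minus \<in> carrier (z_x \<phi>).
       K_alg_x_to_loc \<phi> q p W =
         K_loc_x_scalar \<phi> q p a_plus \<otimes>\<^bsub>K_loc_x \<phi> q p\<^esub>
           K_loc_x_elt \<phi> q p (K_loc_elt \<phi> q p (Hp_K \<phi> q p))
         \<oplus>\<^bsub>K_loc_x \<phi> q p\<^esub> K_loc_x_scalar \<phi> q p a_zero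
         \<oplus>\<^bsub>K_loc_x \<phi> q p\<^esub> K_loc_x_scalar \<phi> q p a_minus \<otimes>\<^bsub>K_loc_x \<phi> q p\<^esub>
           K_loc_x_elt \<phi> q p (inv\<^bsub>K_loc \<phi> q p\<^esub> K_loc_elt \<phi> q p (Hp_K \<phi> q p)))
     \<and> n = 3"
proof -
  have W: "W \<in> carrier KX.T" using refl by (simp add: reflection_solution_def ring_names)
  obtain c where c: "\<forall>i\<le>n. c i \<in> carrier ZX.T" "W = comb c"
    using spanning[OF W] by (elim exE conjE)
  note cc = c(1)[rule_format]
  have np: "\<not> principal_solution \<phi> q p n A W" using small by (simp add: small_solution_def)
  then have "n \<noteq> 1" using refl by (auto simp: principal_solution_def)
  then have n2: "n \<ge> 2" using n by simp
  have "tilde_expansion \<phi> q p n A W c" unfolding tilde_expansion_iff using c by simp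
  then have top: "c (n - 1) = \<zero>\<^bsub>ZX.T\<^esub>"
    using np refl n2 unfolding principal_solution_def ring_names by auto
  have n3: "n = 3"
  proof (rule ccontr)
    assume "n \<noteq> 3"
    have "W = scal (c 0)"
      unfolding c(2)
      by (rule comb_scalar[OF cc]) (use coeffs_zero[OF refl c(2) cc top n2 \<open>n \<noteq> 3\<close>] in simp_all)
    then have "trivial_solution \<phi> q p W"
      using refl cc[of 0] unfolding trivial_solution_def ring_names by blast
    then show False using nontriv by simp
  qed
  have "c 2 = \<zero>\<^bsub>ZX.T\<^esub>" using top n3 by simp
  note eq = to_loc_comb[where c = c, OF n3 cc this, folded c(2)]
  have mem: "c 1 \<in> carrier ZX.T" "c 0 \<in> carrier ZX.T" "c 3 \<otimes>\<^bsub>ZX.T\<^esub> ZX.elt (A n) 1 \<in> carrier ZX.T"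
    using cc[of 1] cc[of 0] cc[of 3] n3 ZX.T.m_closed ZX.elt_closed by simp_all
  show ?thesis
    unfolding ring_names loc_names1(1,2) loc_names2(1,2)
    by (rule conjI[OF _ n3], rule bexI[OF _ mem(1)], rule bexI[OF _ mem(2)], rule bexI[OF _ mem(3)], rule eq)
qed

end

theorem corollary4p9:
  fixes \<phi> :: "'k::field_char_0 \<Rightarrow> 'z::idom" and q :: 'k and n :: nat
    and A :: "nat \<Rightarrow> 'z" and p :: "'z poly"
    and Kx :: "('z free_alg set set \<times> 'k poly fract \<Rightarrow>\<^sub>0 int) set"
  assumes "\<phi> \<in> ring_hom ring_of_type_algebra ring_of_type_algebra"
    and "q \<noteq> 0" and "q \<noteq> 1" and "q \<noteq> - 1"
    and "n \<ge> 1"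
    and "p = - Polynomial.monom 1 (n + 1) + (\<Sum>i\<le>n. Polynomial.monom (A i) (n - i))"
    and "A n \<noteq> 0"
    and "reflection_solution \<phi> q p Kx"
    and "\<not> trivial_solution \<phi> q p Kx"
    and "small_solution \<phi> q p n A Kx"
  shows "(\<exists>a_plus \<in> carrier (z_x \<phi>). \<exists>a_zero \<in> carrier (z_x \<phi>). \<exists>a_minus \<in> carrier (z_x \<phi>).
       K_alg_x_to_loc \<phi> q p Kx =
         K_loc_x_scalar \<phi> q p a_plus \<otimes>\<^bsub>K_loc_x \<phi> q p\<^esub>
           K_loc_x_elt \<phi> q p (K_loc_elt \<phi> q p (Hp_K \<phi> q p))
         \<oplus>\<^bsub>K_loc_x \<phi> q p\<^esub> K_loc_x_scalar \<phi> q p a_zero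
         \<oplus>\<^bsub>K_loc_x \<phi> q p\<^esub> K_loc_x_scalar \<phi> q p a_minus \<otimes>\<^bsub>K_loc_x \<phi> q p\<^esub>
           K_loc_x_elt \<phi> q p (inv\<^bsub>K_loc \<phi> q p\<^esub> K_loc_elt \<phi> q p (Hp_K \<phi> q p)))
     \<and> n = 3"
  by (rule hecke_setup.small_solution_form[OF hecke_setup.intro[OF assms(1-7)] assms(8-10)])

end
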